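(* Let $M$ be a finite-dimensional complex left Leibniz algebra with Leibniz kernel $N=C(M)$ and solvable radical $B=B(M)$. Let $S$ be a Levi subalgebra of $M$, and suppose that $[SN]=0$. If $T\subseteq M$ is any semisimple Lie subalgebra, then there is an automorphism $\alpha=\exp(\mathrm{ad}\,x)$ of $M$, with $x\in[M,B]$, such that $\alpha(T)\subseteq S$.
   Context: A left Leibniz algebra is a (nonassociative) $\mathbb{C}$-algebra $M$ with product $[\ ]$ satisfying $[a[bc]]=[[ab]c]+[b[ac]]$ for all $a,b,c\in M$. All algebras are finite-dimensional over $\mathbb{C}$. For subsets $A,A'\subseteq M$, $[AA']=[A,A']$ denotes the subspace spanned by all $[aa']$ with $a\in A$, $a'\in A'$. The left adjoint map is $\mathrm{ad}\,x: b\mapsto [xb]$, which is a derivation of $M$. The Leibniz kernel $C(M)$ is the span of all $[aa]$, $a\in M$; it is a $2$-sided ideal. A Lie subalgebra of $M$ is a subalgebra which is a Lie algebra under $[\ ]$ (i.e. $[aa]=0$ for all its elements $a$). Put $M^{(0)}=M$, $M^{(n+1)}=[M^{(n)}M^{(n)}]$; $M$ is solvable if $M^{(n)}=0$ for some $n\ge 0$. The solvable radical $B(M)$ is the unique maximal solvable ideal of $M$. A Levi subalgebra of $M$ is a semisimple Lie subalgebra $S$ with $M=B(M)\oplus S$ as vector spaces. *)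

theory Defs
  imports Complex_Main
begin

locale left_leibniz_algebra = vector_space scale
  for scale :: "complex \<Rightarrow> 'a::ab_group_add \<Rightarrow> 'a" +
  fixes br :: "'a \<Rightarrow> 'a \<Rightarrow> 'a"
  assumes linear_right: "Vector_Spaces.linear scale scale (\<lambda>b. br a b)"
    and linear_left: "Vector_Spaces.linear scale scale (\<lambda>a. br a b)"
    and left_leibniz: "br a (br b c) = br (br a b) c + br b (br a c)"
begin

definition bracket :: "'a set \<Rightarrow> 'a set \<Rightarrow> 'a set" where
  "bracket A A' = span {br a a' | a a'. a \<in> A \<and> a' \<in> A'}"

definition ad :: "'a \<Rightarrow> 'a \<Rightarrow> 'a" where
  "ad x b = br x b"

definition leibniz_kernel :: "'a set" where
  "leibniz_kernel = span {br a a | a. True}"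

definition subalgebra :: "'a set \<Rightarrow> bool" where
  "subalgebra L \<longleftrightarrow> subspace L \<and> (\<forall>a\<in>L. \<forall>b\<in>L. br a b \<in> L)"

definition lie_subalgebra :: "'a set \<Rightarrow> bool" where
  "lie_subalgebra L \<longleftrightarrow> subalgebra L \<and> (\<forall>a\<in>L. br a a = 0)"

text \<open>Two-sided ideals of a subalgebra \<open>L\<close>; ideals of the whole algebra are the case
  \<open>L = UNIV\<close>.\<close>

definition ideal_of :: "'a set \<Rightarrow> 'a set \<Rightarrow> bool" where
  "ideal_of I L \<longleftrightarrow> subspace I \<and> I \<subseteq> L \<and> (\<forall>a\<in>L. \<forall>b\<in>I. br a b \<in> I \<and> br b a \<in> I)"

primrec derived :: "'a set \<Rightarrow> nat \<Rightarrow> 'a set" where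
  "derived L 0 = L"
| "derived L (Suc n) = bracket (derived L n) (derived L n)"

definition solvable :: "'a set \<Rightarrow> bool" where
  "solvable L \<longleftrightarrow> (\<exists>n. derived L n = {0})"

definition maximal_solvable_ideal :: "'a set \<Rightarrow> 'a set \<Rightarrow> bool" where
  "maximal_solvable_ideal I L \<longleftrightarrow> ideal_of I L \<and> solvable I \<and>
     (\<forall>J. ideal_of J L \<and> solvable J \<and> I \<subseteq> J \<longrightarrow> J = I)"

text \<open>Well defined in finite dimension: see \<open>maximal_solvable_ideal_unique_exists\<close> below.\<close>

definition solvable_radical :: "'a set \<Rightarrow> 'a set" where
  "solvable_radical L = (THE I. maximal_solvable_ideal I L)"

definition semisimple_lie_subalgebra :: "'a set \<Rightarrow> bool" where
  "semisimple_lie_subalgebra S \<longleftrightarrow> lie_subalgebra S \<and> solvable_radical S = {0}"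

definition levi_subalgebra :: "'a set \<Rightarrow> bool" where
  "levi_subalgebra S \<longleftrightarrow> semisimple_lie_subalgebra S \<and>
     solvable_radical UNIV \<inter> S = {0} \<and>
     {b + s | b s. b \<in> solvable_radical UNIV \<and> s \<in> S} = UNIV"

definition automorphism :: "('a \<Rightarrow> 'a) \<Rightarrow> bool" where
  "automorphism \<alpha> \<longleftrightarrow> Vector_Spaces.linear scale scale \<alpha> \<and> bij \<alpha> \<and>
     (\<forall>a b. \<alpha> (br a b) = br (\<alpha> a) (\<alpha> b))"

text \<open>\<open>E = exp D\<close>, i.e. \<open>E v = (\<Sum>n. D\<^sup>n v / n!)\<close>. The type \<open>'a\<close> carries no topology, so
  convergence in the finite-dimensional space is tested against all linear functionals
  (equivalently, coordinatewise in any basis); see \<open>is_exp_unique_exists\<close> below.\<close>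

definition is_exp :: "('a \<Rightarrow> 'a) \<Rightarrow> ('a \<Rightarrow> 'a) \<Rightarrow> bool" where
  "is_exp D E \<longleftrightarrow> (\<forall>v f. Vector_Spaces.linear scale (*) f \<longrightarrow>
     (\<lambda>n. f (scale (1 / fact n) ((D ^^ n) v))) sums f (E v))"

lemma subspace_bracket: "subspace (bracket A A')"
  unfolding bracket_def by (rule subspace_span)

lemma bracket_mono: "A \<subseteq> A1 \<Longrightarrow> A' \<subseteq> A1' \<Longrightarrow> bracket A A' \<subseteq> bracket A1 A1'"
  unfolding bracket_def by (rule span_mono) blast

lemma br_add_left: "br (a + b) c = br a c + br b c"
  using linear_left[of c] by (simp add: Vector_Spaces.linear_iff)

lemma br_add_right: "br c (a + b) = br c a + br c b"
  using linear_right[of c] by (simp add: Vector_Spaces.linear_iff)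

lemma br_0_left: "br 0 c = 0"
  using br_add_left[of 0 0 c] by simp

lemma br_0_right: "br c 0 = 0"
  using br_add_right[of c 0 0] by simp

lemma derived_mono: "A \<subseteq> A' \<Longrightarrow> derived A n \<subseteq> derived A' n"
  by (induction n) (auto intro: bracket_mono[THEN subsetD])

lemma derived_add: "derived A (m + n) = derived (derived A m) n"
  by (induction n) auto

lemma zero_in_derived: "subspace A \<Longrightarrow> 0 \<in> derived A n"
  by (cases n) (auto simp: subspace_0 subspace_bracket)

lemma derived_subset: "subalgebra A \<Longrightarrow> derived A n \<subseteq> A"
proof (induction n)
  case (Suc n)
  have "derived A (Suc n) \<subseteq> bracket A A"
    using Suc by (simp add: bracket_mono)
  also have "\<dots> \<subseteq> A"
    unfolding bracket_def using Suc.prems by (intro span_minimal) (auto simp: subalgebra_def)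
  finally show ?case .
qed simp

lemma ideal_subalgebra: "ideal_of I L \<Longrightarrow> subalgebra I"
  by (auto simp: ideal_of_def subalgebra_def)

lemma zero_solvable_ideal:
  assumes "subalgebra L"
  shows "ideal_of {0} L" "solvable {0}"
proof -
  show "ideal_of {0} L"
    using assms by (auto simp: ideal_of_def subalgebra_def subspace_0 br_0_left br_0_right)
  show "solvable {0}"
    unfolding solvable_def by (rule exI[of _ 0]) simp
qed

lemma solvable_ideal_sum:
  assumes L: "subalgebra L"
    and I: "ideal_of I L" "solvable I" and J: "ideal_of J L" "solvable J"
  defines "K \<equiv> {i + j | i j. i \<in> I \<and> j \<in> J}"
  shows "ideal_of K L" "solvable K"
proof -
  have sI: "subspace I" and sJ: "subspace J" and sL: "subspace L"
    using I J L by (auto simp: ideal_of_def subalgebra_def)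
  have KL: "K \<subseteq> L"
    using I J sL by (auto simp: K_def ideal_of_def intro!: subspace_add)
  have sK: "subspace K"
    unfolding K_def by (rule subspace_sums[OF sI sJ])
  have "br a b \<in> K \<and> br b a \<in> K" if a: "a \<in> L" and b: "b \<in> K" for a b
  proof -
    obtain i j where ij: "i \<in> I" "j \<in> J" "b = i + j" using b by (auto simp: K_def)
    have "br a i \<in> I" "br i a \<in> I" "br a j \<in> J" "br j a \<in> J"
      using I J a ij by (auto simp: ideal_of_def)
    then show ?thesis
      unfolding K_def ij(3) br_add_left br_add_right by blast
  qed
  then show "ideal_of K L"
    using sK KL by (auto simp: ideal_of_def)
  have step: "derived K n \<subseteq> {i + j | i j. i \<in> derived I n \<and> j \<in> J}" for n
  proof (induction n)
    case 0
    show ?case by (simp add: K_def)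
  next
    case (Suc n)
    let ?R = "{i + j | i j. i \<in> derived I (Suc n) \<and> j \<in> J}"
    have "br a b \<in> ?R" if a: "a \<in> derived K n" and b: "b \<in> derived K n" for a b
    proof -
      obtain i j where a': "i \<in> derived I n" "j \<in> J" "a = i + j"
        using a Suc by blast
      obtain i' j' where b': "i' \<in> derived I n" "j' \<in> J" "b = i' + j'"
        using b Suc by blast
      have inL: "i \<in> L" "i' \<in> L" "j' \<in> L"
        using a' b' derived_subset[OF ideal_subalgebra[OF I(1)], of n] I J
        by (auto simp: ideal_of_def)
      have "br i j' \<in> J" "br j i' \<in> J" "br j j' \<in> J"
        using J inL a' b' by (auto simp: ideal_of_def)
      then have "br i j' + (br j i' + br j j') \<in> J"
        using sJ by (auto intro: subspace_add)
      moreover have "br i i' \<in> derived I (Suc n)"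
        using a' b' by (auto simp: bracket_def intro!: span_base)
      moreover have "br a b = br i i' + (br i j' + (br j i' + br j j'))"
        by (simp add: a' b' br_add_left br_add_right algebra_simps)
      ultimately show ?thesis by blast
    qed
    moreover have "subspace ?R"
      using sJ by (intro subspace_sums) (simp_all add: subspace_bracket)
    ultimately show ?case
      unfolding derived.simps(2)[of K] bracket_def[of "derived K n"]
      by (intro span_minimal) blast+
  qed
  obtain m n where mn: "derived I m = {0}" "derived J n = {0}"
    using I J by (auto simp: solvable_def)
  have "derived K m \<subseteq> J" using step[of m] mn by auto
  then have "derived K (m + n) \<subseteq> {0}"
    using derived_mono[of "derived K m" J n] mn by (simp add: derived_add)
  then show "solvable K"
    using zero_in_derived[OF sK, of "m + n"] unfolding solvable_def by blast
qed

end

locale fd_left_leibniz_algebra =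
  left_leibniz_algebra scale br + finite_dimensional_vector_space scale Basis
  for scale :: "complex \<Rightarrow> 'a::ab_group_add \<Rightarrow> 'a" and br and Basis
begin

lemma maximal_solvable_ideal_unique_exists:
  assumes L: "subalgebra L"
  shows "\<exists>!I. maximal_solvable_ideal I L"
proof (rule ex_ex1I)
  let ?P = "\<lambda>I. ideal_of I L \<and> solvable I"
  have "\<forall>I. ?P I \<longrightarrow> dim I < Suc dimension"
    by (simp add: dim_subset_UNIV less_Suc_eq_le)
  then obtain I where I: "?P I" and max: "\<And>J. ?P J \<Longrightarrow> dim J \<le> dim I"
    using ex_has_greatest_nat[of ?P "{0}" dim "Suc dimension"] zero_solvable_ideal[OF L]
    by auto
  have "maximal_solvable_ideal I L"
    unfolding maximal_solvable_ideal_def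
  proof (intro conjI allI impI)
    fix J assume J: "ideal_of J L \<and> solvable J \<and> I \<subseteq> J"
    then have "I = J"
      using I max[of J] by (intro subspace_dim_equal) (auto simp: ideal_of_def)
    then show "J = I" ..
  qed (use I in auto)
  then show "\<exists>I. maximal_solvable_ideal I L" ..
next
  fix I J assume I: "maximal_solvable_ideal I L" and J: "maximal_solvable_ideal J L"
  let ?K = "{i + j | i j. i \<in> I \<and> j \<in> J}"
  have K: "ideal_of ?K L" "solvable ?K"
    using solvable_ideal_sum[OF L] I J by (auto simp: maximal_solvable_ideal_def)
  have z: "0 \<in> I" "0 \<in> J"
    using I J by (auto simp: maximal_solvable_ideal_def ideal_of_def subspace_0)
  have "I \<subseteq> ?K" "J \<subseteq> ?K" using z by force+
  then have "?K = I" "?K = J"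
    using I J K unfolding maximal_solvable_ideal_def by blast+
  then show "I = J" by simp
qed

lemma is_exp_unique_exists:
  assumes D: "Vector_Spaces.linear scale scale D"
  shows "\<exists>!E. is_exp D E"
proof (rule ex_ex1I)
  define c where "c b v = representation Basis v b" for b v
  have B: "v \<in> span Basis" for v by (simp add: span_Basis)
  have c_add: "c b (v + w) = c b v + c b w" for b v w
    unfolding c_def using representation_add[OF independent_Basis B B] by simp
  have c_scale: "c b (scale r v) = r * c b v" for b r v
    unfolding c_def using representation_scale[OF independent_Basis B] by simp
  have expand: "(\<Sum>b\<in>Basis. scale (c b v) b) = v" for v
    unfolding c_def using sum_representation_eq[OF independent_Basis B finite_Basis] by simp
  have lin_expand: "f v = (\<Sum>b\<in>Basis. c b v * f b)"
    if f: "Vector_Spaces.linear scale (*) f" for f :: "'a \<Rightarrow> complex" and v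
  proof -
    interpret f: Vector_Spaces.linear scale "(*)" f by (rule f)
    have "f v = f (\<Sum>b\<in>Basis. scale (c b v) b)" by (simp add: expand)
    then show ?thesis by (simp add: f.sum f.scale)
  qed
  interpret D: Vector_Spaces.linear scale scale D by (rule D)
  have cD: "c b (D v) = (\<Sum>b'\<in>Basis. c b' v * c b (D b'))" for b v
  proof -
    interpret cb: Vector_Spaces.linear scale "(*)" "c b"
      by unfold_locales (simp_all add: c_add c_scale algebra_simps)
    have "c b (D v) = c b (D (\<Sum>b'\<in>Basis. scale (c b' v) b'))" by (simp add: expand)
    then show ?thesis by (simp add: D.sum D.scale cb.sum cb.scale)
  qed
  define s where "s v = (\<Sum>b\<in>Basis. norm (c b v))" for v
  define M where "M = (\<Sum>b\<in>Basis. s (D b))"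
  have s_nonneg: "0 \<le> s v" for v by (simp add: s_def sum_nonneg)
  have M_nonneg: "0 \<le> M" by (simp add: M_def sum_nonneg s_nonneg)
  have sD: "s (D v) \<le> M * s v" for v
  proof -
    have "norm (c b (D v)) \<le> (\<Sum>b'\<in>Basis. norm (c b' v) * norm (c b (D b')))" for b
      by (subst cD, rule order.trans[OF norm_sum]) (simp add: norm_mult)
    then have "s (D v) \<le> (\<Sum>b\<in>Basis. \<Sum>b'\<in>Basis. norm (c b' v) * norm (c b (D b')))"
      unfolding s_def by (intro sum_mono)
    also have "\<dots> = (\<Sum>b'\<in>Basis. norm (c b' v) * s (D b'))"
      by (subst sum.swap) (simp add: s_def sum_distrib_left)
    also have "\<dots> \<le> (\<Sum>b'\<in>Basis. norm (c b' v) * M)"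
      unfolding M_def
      by (intro sum_mono mult_left_mono member_le_sum) (auto simp: s_nonneg finite_Basis)
    also have "\<dots> = M * s v"
      by (simp add: s_def sum_distrib_left mult.commute)
    finally show ?thesis .
  qed
  have sDn: "s ((D ^^ n) v) \<le> M ^ n * s v" for n v
  proof (induction n)
    case (Suc n)
    have "s ((D ^^ Suc n) v) \<le> M * s ((D ^^ n) v)" using sD by simp
    also have "\<dots> \<le> M * (M ^ n * s v)" using Suc M_nonneg by (intro mult_left_mono)
    finally show ?case by (simp add: mult.assoc)
  qed simp
  have c_le: "norm (c b v) \<le> s v" if "b \<in> Basis" for b v
    unfolding s_def using that finite_Basis by (intro member_le_sum) auto
  have summ: "summable (\<lambda>n. c b (scale (1 / fact n) ((D ^^ n) v)))" if b: "b \<in> Basis" for b v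
  proof (rule summable_comparison_test')
    show "summable (\<lambda>n. (inverse (fact n) * M ^ n) * s v)"
      by (intro summable_mult2 summable_exp)
    fix n :: nat
    have "norm (c b ((D ^^ n) v)) \<le> M ^ n * s v"
      using c_le[OF b] sDn order.trans by blast
    then show "norm (c b (scale (1 / fact n) ((D ^^ n) v))) \<le> (inverse (fact n) * M ^ n) * s v"
      by (simp add: c_scale norm_divide field_simps)
  qed
  define E where "E v = (\<Sum>b\<in>Basis. scale (\<Sum>n. c b (scale (1 / fact n) ((D ^^ n) v))) b)" for v
  have "is_exp D E"
    unfolding is_exp_def
  proof (intro allI impI)
    fix v and f :: "'a \<Rightarrow> complex" assume f: "Vector_Spaces.linear scale (*) f"
    interpret f: Vector_Spaces.linear scale "(*)" f by (rule f)
    have "f (E v) = (\<Sum>b\<in>Basis. (\<Sum>n. c b (scale (1 / fact n) ((D ^^ n) v))) * f b)"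
      by (simp add: E_def f.sum f.scale)
    moreover have "(\<lambda>n. \<Sum>b\<in>Basis. c b (scale (1 / fact n) ((D ^^ n) v)) * f b) sums
        (\<Sum>b\<in>Basis. (\<Sum>n. c b (scale (1 / fact n) ((D ^^ n) v))) * f b)"
      by (intro sums_sum sums_mult2 summable_sums summ)
    ultimately show "(\<lambda>n. f (scale (1 / fact n) ((D ^^ n) v))) sums f (E v)"
      by (subst lin_expand[OF f]) simp
  qed
  then show "\<exists>E. is_exp D E" by blast
  fix E1 E2 assume EE: "is_exp D E1" "is_exp D E2"
  show "E1 = E2"
  proof
    fix v
    have "c b (E1 v) = c b (E2 v)" for b
    proof -
      have "Vector_Spaces.linear scale (*) (c b)"
        by unfold_locales (simp_all add: c_add c_scale algebra_simps)
      then show ?thesis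
        using EE unfolding is_exp_def by (meson sums_unique2)
    qed
    then have "(\<Sum>b\<in>Basis. scale (c b (E1 v)) b) = (\<Sum>b\<in>Basis. scale (c b (E2 v)) b)"
      by simp
    then show "E1 v = E2 v" by (simp only: expand)
  qed
qed

end

end

theory Submission
  imports Defs "HOL-Computational_Algebra.Fundamental_Theorem_Algebra"
begin

text \<open>Let \<open>P = [M, B]\<close>. By an argument in the style of Lie's theorem the left multiplications by \<open>P\<close>
  are jointly nilpotent, so \<open>M\<close> has a flag of left ideals \<open>U\<^sub>i\<close> with \<open>[P, U\<^sub>i\<^sub>+\<^sub>1] \<subseteq> U\<^sub>i\<close>, and
  \<open>F\<^sub>i = (U\<^sub>i \<inter> P) + N\<close> is a filtration from \<open>P + N\<close> down to \<open>N\<close>. As \<open>T\<close> is perfect,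
  \<open>T \<subseteq> S + P + N\<close>. If \<open>exp (ad x)\<close> maps \<open>T\<close> into \<open>S + F\<^sub>i\<^sub>+\<^sub>1\<close>, the component in \<open>F\<^sub>i\<^sub>+\<^sub>1\<close> is a
  cocycle modulo \<open>F\<^sub>i\<close>, hence a coboundary by Whitehead's first lemma, given by some
  \<open>w \<in> U\<^sub>i\<^sub>+\<^sub>1 \<inter> P\<close> modulo \<open>N\<close>; since \<open>exp (ad (x + w)) t \<equiv> exp (ad x) t + [w, t]\<close> modulo \<open>F\<^sub>i\<close>,
  replacing \<open>x\<close> by \<open>x + w\<close> pushes \<open>T\<close> into \<open>S + F\<^sub>i\<close>, without any Baker--Campbell--Hausdorff
  formula. In the end \<open>T\<close> lands in \<open>S + N\<close>, and then in \<open>S\<close>, because \<open>[S, N] = [N, M] = 0\<close>.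
  Whitehead's lemma is obtained from the Casimir operator and Cartan's criterion.\<close>

text \<open>The obstacle is that \<open>br\<close> is not antisymmetric: left multiplications form a
  representation, but \<open>br a b\<close> and \<open>- br b a\<close> agree only modulo
  \<open>N\<close>. Hence every layer contains \<open>N\<close>. Left multiplication by an element
  of \<open>N\<close> is zero, so a correction taken from \<open>N\<close> changes nothing; the last
  component, in \<open>N\<close>, is therefore removed by \<open>[S, N] = 0\<close> and not by
  conjugation. All modules are subquotients \<open>V / U\<close> of one space and stay on it: as
  invariant pairs \<open>U \<subseteq> V\<close>, or compressed by a projection \<open>p\<close>
  onto a complement of \<open>U\<close> in \<open>V\<close>. One trace then serves for all of them.
  The eigenvalue arguments rest on one device, the operator that is \<open>cnj c\<close> on the
  generalized \<open>c\<close>-eigenspace of \<open>x\<close>. Its product with \<open>x\<close> has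
  trace the sum of the squared moduli of the eigenvalues. This gives Cartan's criterion and also
  Jacobson's lemma on commutators; the latter replaces weight vectors in the proof that
  \<open>P\<close> acts nilpotently.\<close>

locale complex_fd_space = finite_dimensional_vector_space scale Basis
  for scale :: "complex \<Rightarrow> 'a::ab_group_add \<Rightarrow> 'a" and Basis
begin

abbreviation lin :: "('a \<Rightarrow> 'a) \<Rightarrow> bool" where
  "lin \<equiv> Vector_Spaces.linear scale scale"

section \<open>Linear maps and coordinates\<close>

lemma linI:
  assumes "\<And>u v. f (u + v) = f u + f v" "\<And>c v. f (scale c v) = scale c (f v)"
  shows "lin f"
  by (intro Vector_Spaces.linear_iff[THEN iffD2] conjI allI assms vector_space_axioms)

lemma lin_add: "lin f \<Longrightarrow> f (u + v) = f u + f v"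
  and lin_scale: "lin f \<Longrightarrow> f (scale c v) = scale c (f v)"
  by (simp_all add: Vector_Spaces.linear_iff)

lemma lin_0: "lin f \<Longrightarrow> f 0 = 0"
  using lin_scale[of f 0 0] by simp

lemma lin_minus: "lin f \<Longrightarrow> f (- v) = - f v"
  using lin_scale[of f "- 1" v] by simp

lemma lin_diff: "lin f \<Longrightarrow> f (u - v) = f u - f v"
  using lin_add[of f u "- v"] lin_minus[of f v] by simp

lemma lin_sum:
  assumes f: "lin f"
  shows "f (sum g A) = (\<Sum>i\<in>A. f (g i))"
  by (induction A rule: infinite_finite_induct) (simp_all add: lin_0[OF f] lin_add[OF f])

lemmas lin_simps = lin_0 lin_add lin_scale lin_minus lin_diff lin_sum

lemma lin_id: "lin (\<lambda>v. v)"
  and lin_zero: "lin (\<lambda>v. 0)"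
  by (auto intro!: linI)

lemma lin_comp:
  assumes f: "lin f" and g: "lin g"
  shows "lin (\<lambda>v. f (g v))"
  by (rule linI) (simp_all add: lin_simps[OF f] lin_simps[OF g])

lemma lin_fun_add:
  assumes f: "lin f" and g: "lin g"
  shows "lin (\<lambda>v. f v + g v)"
  by (rule linI) (simp_all add: lin_simps[OF f] lin_simps[OF g] algebra_simps)

lemma lin_fun_scale:
  assumes f: "lin f"
  shows "lin (\<lambda>v. scale c (f v))"
  by (rule linI) (simp_all add: lin_simps[OF f] algebra_simps)

lemma lin_fun_diff:
  assumes f: "lin f" and g: "lin g"
  shows "lin (\<lambda>v. f v - g v)"
  by (rule linI) (simp_all add: lin_simps[OF f] lin_simps[OF g] algebra_simps)

lemma lin_fun_sum: "(\<And>i. i \<in> A \<Longrightarrow> lin (f i)) \<Longrightarrow> lin (\<lambda>v. \<Sum>i\<in>A. f i v)"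
  by (induction A rule: infinite_finite_induct) (auto intro: lin_zero lin_fun_add)

lemma lin_funpow: "lin f \<Longrightarrow> lin (f ^^ n)"
proof (induction n)
  case (Suc n)
  then show ?case using lin_comp[of f "f ^^ n"] by (simp add: comp_def)
qed (simp add: id_def lin_id)

lemmas lin_intros = lin_id lin_zero lin_fun_add lin_fun_diff lin_fun_scale lin_fun_sum

lemma lin_eq_on_span:
  assumes "lin f" "lin g" "\<And>b. b \<in> B \<Longrightarrow> f b = g b" "v \<in> span B"
  shows "f v = g v"
  using assms(4)
  by (induction rule: span_induct_alt) (simp_all add: assms lin_simps[OF assms(1)] lin_simps[OF assms(2)])

lemma subspace_lin_vimage:
  assumes f: "lin f" and W: "subspace W"
  shows "subspace {v. f v \<in> W}"
  using W by (auto simp: subspace_def lin_simps[OF f])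

lemma subspace_lin_image:
  assumes f: "lin f" and W: "subspace W"
  shows "subspace (f ` W)"
proof (rule subspaceI)
  show "0 \<in> f ` W"
    using subspace_0[OF W] lin_0[OF f] by (metis imageI)
next
  fix x y assume "x \<in> f ` W" "y \<in> f ` W"
  then show "x + y \<in> f ` W"
    using subspace_add[OF W] lin_add[OF f] by (metis (no_types, lifting) imageE imageI)
next
  fix c x assume "x \<in> f ` W"
  then show "scale c x \<in> f ` W"
    using subspace_scale[OF W] lin_scale[OF f] by (metis (no_types, lifting) imageE imageI)
qed

lemma lin_rep:
  assumes B: "independent B" and r: "\<And>v. f v \<in> span B" and f: "lin f"
  shows "lin (\<lambda>v. scale (representation B (f v) b) u)"
  by (rule linI)
    (simp_all add: lin_simps[OF f] representation_add[OF B r r] representation_scale[OF B r] algebra_simps)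

lemma rep_sum:
  assumes "independent B" "v \<in> span B"
  shows "(\<Sum>b\<in>B. scale (representation B v b) b) = v"
  using sum_representation_eq[OF assms] finiteI_independent[OF assms(1)] by simp

subsection \<open>Trace\<close>

definition tr :: "('a \<Rightarrow> 'a) \<Rightarrow> complex" where
  "tr f = (\<Sum>b\<in>Basis. representation Basis (f b) b)"

lemma in_span_Basis: "v \<in> span Basis"
  by (simp add: span_Basis)

lemmas Brep_add = representation_add[OF independent_Basis in_span_Basis in_span_Basis]
  and Brep_scale = representation_scale[OF independent_Basis in_span_Basis]
  and Brep_sum = rep_sum[OF independent_Basis in_span_Basis]

lemma Brep_setsum: "representation Basis (sum f A) b = (\<Sum>i\<in>A. representation Basis (f i) b)"
  by (induction A rule: infinite_finite_induct) (simp_all add: Brep_add representation_zero)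

lemma tr_add: "tr (\<lambda>v. f v + g v) = tr f + tr g"
  by (simp add: tr_def Brep_add sum.distrib)

lemma tr_scale: "tr (\<lambda>v. scale c (f v)) = c * tr f"
  by (simp add: tr_def Brep_scale sum_distrib_left)

lemma tr_zero: "tr (\<lambda>v. 0) = 0"
  by (simp add: tr_def representation_zero)

lemma tr_diff: "tr (\<lambda>v. f v - g v) = tr f - tr g"
  using tr_add[of f "\<lambda>v. scale (- 1) (g v)"] by (simp only: tr_scale) simp

lemma tr_sum: "tr (\<lambda>v. \<Sum>i\<in>A. f i v) = (\<Sum>i\<in>A. tr (f i))"
  by (induction A rule: infinite_finite_induct) (simp_all add: tr_zero tr_add)

lemma tr_cyclic:
  assumes f: "lin f" and g: "lin g"
  shows "tr (\<lambda>v. f (g v)) = tr (\<lambda>v. g (f v))"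
proof -
  have *: "tr (\<lambda>v. f (g v)) = (\<Sum>b\<in>Basis. \<Sum>c\<in>Basis.
      representation Basis (g b) c * representation Basis (f c) b)" if "lin f" for f g
  proof -
    have "representation Basis (f (g b)) b
        = representation Basis (f (\<Sum>c\<in>Basis. scale (representation Basis (g b) c) c)) b" for b
      by (simp add: Brep_sum)
    then show ?thesis
      by (simp add: tr_def lin_simps[OF that] Brep_setsum Brep_scale)
  qed
  show ?thesis
    unfolding *[OF f] *[OF g] by (subst sum.swap) (simp add: mult.commute)
qed

text \<open>\<open>f\<close> is the sum over \<open>b\<close> in \<open>B\<close> of the rank-one
  maps sending \<open>v\<close> to the \<open>b\<close>-part of \<open>f v\<close>, and a rank-one
  map has as trace the value of its functional at its vector. No base change is involved.\<close>

lemma tr_independent: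
  assumes f: "lin f" and B: "independent B" and r: "\<And>v. f v \<in> span B"
  shows "tr f = (\<Sum>b\<in>B. representation B (f b) b)"
proof -
  let ?c = "\<lambda>v b. representation B (f v) b"
  have c_add: "?c (u + v) b = ?c u b + ?c v b" for u v b
    by (simp add: lin_simps[OF f] representation_add[OF B r r])
  have c_scale: "?c (scale t v) b = t * ?c v b" for t v b
    by (simp add: lin_simps[OF f] representation_scale[OF B r])
  have c_sum: "?c (sum g A) b = (\<Sum>i\<in>A. ?c (g i) b)" for g and A :: "'a set" and b
    by (induction A rule: infinite_finite_induct)
      (simp_all add: c_add lin_0[OF f] representation_zero)
  have "tr (\<lambda>v. scale (?c v b) b) = ?c b b" for b
  proof -
    have "?c b b = ?c (\<Sum>e\<in>Basis. scale (representation Basis b e) e) b"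
      by (simp add: Brep_sum)
    then show ?thesis
      by (simp add: tr_def Brep_scale c_sum c_scale mult.commute)
  qed
  moreover have "tr f = tr (\<lambda>v. \<Sum>b\<in>B. scale (?c v b) b)"
    by (simp add: rep_sum[OF B r])
  ultimately show ?thesis by (simp add: tr_sum)
qed

subsection \<open>Projections onto subquotients\<close>

text \<open>A basis of \<open>U\<close> is extended to one of \<open>V\<close> and then of the whole
  space; \<open>p\<close> keeps the coordinates added in the first extension. Its range is a copy of
  \<open>V / U\<close>. With \<open>U = {0}\<close> it is a projection onto
  \<open>V\<close>.\<close>

lemma subquotient_projection:
  assumes U: "subspace U" and V: "subspace V" and UV: "U \<subseteq> V"
  obtains p where "lin p" "\<And>v. p v \<in> V" "\<And>u. u \<in> U \<Longrightarrow> p u = 0"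
    "\<And>v. v \<in> V \<Longrightarrow> v - p v \<in> U" "\<And>v. p (p v) = p v"
proof -
  obtain BU where BU: "BU \<subseteq> U" "independent BU" "U \<subseteq> span BU"
    using maximal_independent_subset[of U] by blast
  obtain BV where BV: "BU \<subseteq> BV" "BV \<subseteq> V" "independent BV" "V \<subseteq> span BV"
    using maximal_independent_subset_extend[of BU V] BU UV by blast
  obtain B where B: "BV \<subseteq> B" "independent B" "UNIV \<subseteq> span B"
    by (rule maximal_independent_subset_extend[OF subset_UNIV BV(3)])
  have sp: "v \<in> span B" for v using B(3) by auto
  have fin: "finite B" by (rule finiteI_independent[OF B(2)])
  define p where "p v = (\<Sum>b\<in>BV - BU. scale (representation B v b) b)" for v
  have lp: "lin p"
    unfolding p_def by (intro lin_intros lin_rep[OF B(2) sp lin_id])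
  have fin': "finite (BV - BU)" using fin B finite_subset by blast
  have pb: "p b = (if b \<in> BV - BU then b else 0)" if "b \<in> B" for b
  proof -
    have "p b = (\<Sum>b'\<in>BV - BU. if b = b' then b else 0)"
      unfolding p_def representation_basis[OF B(2) that] by (intro sum.cong) auto
    then show ?thesis using fin' by simp
  qed
  have pV: "p v \<in> span (BV - BU)" for v
    unfolding p_def by (intro span_sum span_scale span_base)
  have spV: "span (BV - BU) \<subseteq> V"
    using BV V by (intro span_minimal) auto
  have "p u = 0" if "u \<in> span BU" for u
    by (rule lin_eq_on_span[OF lp lin_zero _ that]) (use pb BV B in auto)
  moreover have "v - p v \<in> span BU" if "v \<in> span BV" for v
    using that
  proof (induction rule: span_induct_alt)
    case base
    then show ?case by (simp add: lin_0[OF lp] span_zero)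
  next
    case (step c x y)
    have "x - p x \<in> span BU"
      using step(1) B(1) pb[of x] span_base[of x BU] span_zero[of BU] by (cases "x \<in> BU") auto
    then have "scale c (x - p x) + (y - p y) \<in> span BU"
      using step by (intro span_add span_scale)
    then show ?case by (simp add: lin_simps[OF lp] algebra_simps)
  qed
  moreover have "p (p v) = p v" for v
    by (rule lin_eq_on_span[OF lp lin_id _ pV]) (use pb BV B in auto)
  moreover have "span BU \<subseteq> U" using BU U by (intro span_minimal)
  ultimately show thesis
    using that[of p] lp pV spV BU(3) BV(4) by (metis subsetD)
qed

definition nilp :: "('a \<Rightarrow> 'a) \<Rightarrow> bool" where
  "nilp f \<longleftrightarrow> (\<exists>k. \<forall>v. (f ^^ k) v = 0)"

text \<open>The images of the powers of \<open>f\<close> shrink to zero, and \<open>f\<close> may be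
  precomposed with a projection onto each of them without changing its trace: if \<open>q\<close>
  projects onto the \<open>k\<close>-th image and \<open>p\<close> onto the next, then
  \<open>f q = p f q\<close>, cyclicity turns this into \<open>f q p\<close>, and
  \<open>q p = p\<close>.\<close>

lemma tr_nilp:
  assumes f: "lin f" and "nilp f"
  shows "tr f = 0"
proof -
  obtain m where m: "\<And>v. (f ^^ m) v = 0" using assms by (auto simp: nilp_def)
  have "\<exists>q. lin q \<and> (\<forall>v. q v \<in> range (f ^^ k)) \<and> (\<forall>v\<in>range (f ^^ k). q v = v) \<and>
      tr f = tr (\<lambda>v. f (q v))" for k
  proof (induction k)
    case 0
    show ?case by (intro exI[of _ "\<lambda>v. v"]) (simp add: lin_id)
  next
    case (Suc k)
    then obtain q where q: "lin q" "\<And>v. q v \<in> range (f ^^ k)" "\<And>v. v \<in> range (f ^^ k) \<Longrightarrow> q v = v"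
      "tr f = tr (\<lambda>v. f (q v))" by blast
    have "subspace (range (f ^^ Suc k))"
      by (intro subspace_lin_image lin_funpow f subspace_UNIV)
    then obtain p where p: "lin p" "\<And>v. p v \<in> range (f ^^ Suc k)"
        "\<And>v. v \<in> range (f ^^ Suc k) \<Longrightarrow> v - p v \<in> {0}"
      using subquotient_projection[of "{0}" "range (f ^^ Suc k)"] by (metis (no_types, lifting)
        empty_subsetI insert_subset subspace_0 subspace_single_0)
    have mono: "range (f ^^ Suc k) \<subseteq> range (f ^^ k)"
      by (auto simp: funpow_swap1)
    have "p (f (q v)) = f (q v)" for v
    proof -
      obtain u where "q v = (f ^^ k) u" using q(2)[of v] by blast
      then show ?thesis using p(3)[of "f (q v)"] by auto
    qed
    then have "tr f = tr (\<lambda>v. p (f (q v)))" by (simp add: q(4))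
    also have "\<dots> = tr (\<lambda>v. f (q (p v)))"
      using tr_cyclic[OF p(1) lin_comp[OF f q(1)]] by simp
    also have "\<dots> = tr (\<lambda>v. f (p v))"
      using q(3) p(2) mono by (metis subsetD)
    finally show ?case using p by (intro exI[of _ p]) auto
  qed
  from this[of m] obtain q where "\<And>v. q v \<in> range (f ^^ m)" "tr f = tr (\<lambda>v. f (q v))" by blast
  moreover have "range (f ^^ m) = {0}" using m by auto
  ultimately have "tr f = tr (\<lambda>v. f 0)" by simp
  then show ?thesis by (simp add: lin_0[OF f] tr_zero)
qed

subsection \<open>Generalized eigenvectors\<close>

definition gev :: "('a \<Rightarrow> 'a) \<Rightarrow> complex \<Rightarrow> 'a \<Rightarrow> bool" where
  "gev x c v \<longleftrightarrow> (\<exists>k. ((\<lambda>v. x v - scale c v) ^^ k) v = 0)"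

lemma lin_shift: "lin x \<Longrightarrow> lin (\<lambda>v. x v - scale c v)"
  by (intro lin_fun_diff lin_fun_scale lin_id)

lemma funpow_zero_mono:
  assumes f: "lin f" and v: "(f ^^ k) v = 0" and "k \<le> m"
  shows "(f ^^ m) v = 0"
proof -
  have "(f ^^ m) v = (f ^^ (m - k)) ((f ^^ k) v)"
    using funpow_add[of "m - k" k f] \<open>k \<le> m\<close> by simp
  then show ?thesis by (simp add: v lin_0[OF lin_funpow[OF f]])
qed

lemma gev_shift:
  assumes x: "lin x" and "gev x c v"
  shows "gev x c (x v - scale c v)"
proof -
  obtain k where "((\<lambda>v. x v - scale c v) ^^ k) v = 0" using assms by (auto simp: gev_def)
  then have "((\<lambda>v. x v - scale c v) ^^ k) (x v - scale c v) = 0"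
    using funpow_zero_mono[OF lin_shift[OF x], of k c v "Suc k"] by (simp add: funpow_Suc_right del: funpow.simps(2))
  then show ?thesis unfolding gev_def by (rule exI)
qed

lemma subspace_gev:
  assumes x: "lin x"
  shows "subspace {v. gev x c v}"
proof -
  let ?f = "\<lambda>v. x v - scale c v"
  note lf = lin_shift[OF x, of c]
  note lk = lin_funpow[OF lf]
  have "gev x c (u + v)" if uv: "gev x c u" "gev x c v" for u v
  proof -
    obtain k where k: "(?f ^^ k) u = 0" using uv by (auto simp: gev_def)
    obtain m where m: "(?f ^^ m) v = 0" using uv by (auto simp: gev_def)
    have "(?f ^^ (k + m)) (u + v) = 0"
      using funpow_zero_mono[OF lf k, of "k + m"] funpow_zero_mono[OF lf m, of "k + m"]
      by (simp add: lin_add[OF lk])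
    then show ?thesis unfolding gev_def by (rule exI)
  qed
  moreover have "gev x c (scale t v)" if gv: "gev x c v" for t v
  proof -
    obtain k where k: "(?f ^^ k) v = 0" using gv by (auto simp: gev_def)
    then have "(?f ^^ k) (scale t v) = 0" by (simp add: lin_scale[OF lk])
    then show ?thesis unfolding gev_def by (rule exI)
  qed
  moreover have "gev x c 0" unfolding gev_def by (rule exI[of _ 0]) simp
  ultimately show ?thesis by (simp add: subspace_def)
qed

lemma gev_shift_other:
  assumes x: "lin x" and v: "gev x c v"
  shows "gev x c (x v - scale d v)"
proof -
  have "(x v - scale c v) + scale (c - d) v \<in> {v. gev x c v}"
    using gev_shift[OF x v] v
    by (intro subspace_add[OF subspace_gev[OF x]] subspace_scale[OF subspace_gev[OF x]]) auto
  then show ?thesis by (simp add: algebra_simps)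
qed

text \<open>On the generalized \<open>c\<close>-eigenspace \<open>x - d\<close> is
  \<open>c - d\<close> plus a nilpotent map, hence invertible; the induction on the nilpotency
  exponent builds the inverse term by term.\<close>

lemma gev_solve:
  assumes x: "lin x" and v: "gev x c v" and "c \<noteq> d"
  shows "\<exists>h. gev x c h \<and> x h - scale d h = v"
proof -
  have "\<exists>h. gev x c h \<and> x h - scale d h = v" if "((\<lambda>v. x v - scale c v) ^^ k) v = 0" for k v
    using that
  proof (induction k arbitrary: v)
    case 0
    then show ?case
      using subspace_0[OF subspace_gev[OF x]] by (intro exI[of _ 0]) (simp add: lin_0[OF x])
  next
    case (Suc k)
    let ?u = "x v - scale c v"
    have gv: "gev x c v" unfolding gev_def using Suc.prems by (rule exI)
    have "((\<lambda>v. x v - scale c v) ^^ k) ?u = 0" using Suc.prems by (simp add: funpow_Suc_right del: funpow.simps(2))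
    then obtain h where h: "gev x c h" "x h - scale d h = ?u" using Suc.IH by blast
    have "gev x c (v - h)"
      using subspace_diff[OF subspace_gev[OF x], of v c h] gv h(1) by simp
    then have g: "gev x c (scale (1 / (c - d)) (v - h))"
      using subspace_scale[OF subspace_gev[OF x], of "v - h" c] by simp
    have "x (v - h) - scale d (v - h) = (x v - scale d v) - ?u"
      unfolding h(2)[symmetric] by (simp add: lin_diff[OF x] algebra_simps)
    also have "\<dots> = scale (c - d) v" by (simp add: algebra_simps)
    finally have *: "x (v - h) - scale d (v - h) = scale (c - d) v" .
    have "x (scale (1 / (c - d)) (v - h)) - scale d (scale (1 / (c - d)) (v - h))
        = scale (1 / (c - d)) (x (v - h) - scale d (v - h))"
      by (simp add: lin_scale[OF x] lin_diff[OF x] scale_right_diff_distrib mult.commute)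
    also have "\<dots> = v" using \<open>c \<noteq> d\<close> by (simp add: *)
    finally show ?case using g by blast
  qed
  then show ?thesis using v unfolding gev_def by blast
qed

text \<open>Components of \<open>(x - d) v\<close> for eigenvalues other than \<open>d\<close> can
  be divided by \<open>x - d\<close>. Subtracting the quotients \<open>h\<close> from
  \<open>v\<close> leaves a vector that \<open>x - d\<close> maps into the generalized
  \<open>d\<close>-eigenspace, so it lies there itself.\<close>

lemma span_gev_step:
  assumes x: "lin x" and v: "x v - scale d v \<in> span {v. \<exists>c. gev x c v}"
  shows "v \<in> span {v. \<exists>c. gev x c v}"
proof -
  let ?G = "{v. \<exists>c. gev x c v}"
  have "\<exists>g h. gev x d g \<and> h \<in> span ?G \<and> u = g + (x h - scale d h)" if "u \<in> span ?G" for u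
    using that
  proof (induction rule: span_induct_alt)
    case base
    show ?case
      using subspace_0[OF subspace_gev[OF x]] span_zero[of ?G]
      by (intro exI[of _ 0]) (simp add: lin_0[OF x])
  next
    case (step t w u)
    then obtain g h where gh: "gev x d g" "h \<in> span ?G" "u = g + (x h - scale d h)" by blast
    obtain c where c: "gev x c w" using step(1) by blast
    show ?case
    proof (cases "c = d")
      case True
      have "gev x d (scale t w + g)"
        using c gh(1) subspace_add[OF subspace_gev[OF x], of "scale t w" d g]
          subspace_scale[OF subspace_gev[OF x], of w d t] True by simp
      then show ?thesis
        using gh by (intro exI[of _ "scale t w + g"] exI[of _ h]) (simp add: add.assoc)
    next
      case False
      then obtain k where k: "gev x c k" "x k - scale d k = w" using gev_solve[OF x c] by blast
      have "scale t k + h \<in> span ?G"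
        using k(1) gh(2) by (intro span_add span_scale) (auto intro: span_base)
      moreover have "scale t w + u = g + (x (scale t k + h) - scale d (scale t k + h))"
        unfolding gh(3) k(2)[symmetric] by (simp add: lin_simps[OF x] algebra_simps)
      ultimately show ?thesis using gh(1) by blast
    qed
  qed
  from this[OF v] obtain g h where
    gh: "gev x d g" "h \<in> span ?G" "x v - scale d v = g + (x h - scale d h)" by blast
  then have "x (v - h) - scale d (v - h) = g" by (simp add: lin_diff[OF x] algebra_simps)
  moreover obtain k where "((\<lambda>v. x v - scale d v) ^^ k) g = 0" using gh(1) by (auto simp: gev_def)
  ultimately have "((\<lambda>v. x v - scale d v) ^^ Suc k) (v - h) = 0" by (simp add: funpow_Suc_right del: funpow.simps(2))
  then have "gev x d (v - h)" unfolding gev_def by (rule exI)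
  then have "v - h \<in> span ?G" by (auto intro: span_base)
  then have "(v - h) + h \<in> span ?G" using gh(2) by (rule span_add)
  then show ?thesis by simp
qed

section \<open>Generalized eigenvectors span the space\<close>

definition poly_act :: "('a \<Rightarrow> 'a) \<Rightarrow> complex poly \<Rightarrow> 'a \<Rightarrow> 'a" where
  "poly_act x p v = (\<Sum>i\<le>degree p. scale (coeff p i) ((x ^^ i) v))"

lemma poly_act_bound:
  assumes "degree p \<le> n"
  shows "poly_act x p v = (\<Sum>i\<le>n. scale (coeff p i) ((x ^^ i) v))"
  unfolding poly_act_def
  by (rule sum.mono_neutral_left) (use assms in \<open>auto simp: coeff_eq_0\<close>)

lemma poly_act_linear_factor:
  assumes x: "lin x"
  shows "poly_act x ([:- z, 1:] * q) v = poly_act x q (x v - scale z v)"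
proof -
  let ?n = "degree q"
  have q: "[:- z, 1:] * q = pCons 0 q - smult z q" by simp
  have deg: "degree (pCons 0 q - smult z q) \<le> Suc ?n"
    by (intro degree_diff_le) (auto simp: degree_pCons_le order.trans[OF degree_smult_le])
  have pw: "(x ^^ i) (x v - scale z v) = (x ^^ Suc i) v - scale z ((x ^^ i) v)" for i
    by (simp add: lin_diff[OF lin_funpow[OF x]] lin_scale[OF lin_funpow[OF x]] funpow_Suc_right del: funpow.simps(2))
  have 1: "(\<Sum>i\<le>Suc ?n. scale (coeff (pCons 0 q) i) ((x ^^ i) v))
      = (\<Sum>i\<le>?n. scale (coeff q i) ((x ^^ Suc i) v))"
    by (subst sum.atMost_Suc_shift) simp

  have 3: "(\<Sum>i\<le>Suc ?n. scale (z * coeff q i) ((x ^^ i) v))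
      = (\<Sum>i\<le>?n. scale (z * coeff q i) ((x ^^ i) v))"
    by (simp add: coeff_eq_0)
  have "poly_act x ([:- z, 1:] * q) v
      = (\<Sum>i\<le>Suc ?n. scale (coeff (pCons 0 q) i) ((x ^^ i) v))
        - (\<Sum>i\<le>Suc ?n. scale (z * coeff q i) ((x ^^ i) v))"
    unfolding q poly_act_bound[OF deg] sum_subtractf[symmetric]
    by (simp add: scale_left_diff_distrib)
  also have "\<dots> = (\<Sum>i\<le>?n. scale (coeff q i) ((x ^^ i) (x v - scale z v)))"
    unfolding 1 3 pw sum_subtractf[symmetric]
    by (simp add: scale_right_diff_distrib mult.commute)
  finally show ?thesis by (simp add: poly_act_def)
qed

lemma span_image_sum:
  assumes "finite A" "u \<in> span (g ` A)"
  shows "\<exists>c. u = (\<Sum>i\<in>A. scale (c i) (g i))"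
  using assms(2)
proof (induction rule: span_induct_alt)
  case base
  show ?case by (rule exI[of _ "\<lambda>_. 0"]) simp
next
  case (step t w u)
  then obtain c j where c: "u = (\<Sum>i\<in>A. scale (c i) (g i))" and j: "j \<in> A" "w = g j" by blast
  have "scale t w = (\<Sum>i\<in>A. scale (if i = j then t else 0) (g i))"
    using assms(1) j by (simp add: if_distrib[of "\<lambda>t. scale t _"] cong: if_cong)
  then have "scale t w + u = (\<Sum>i\<in>A. scale ((if i = j then t else 0) + c i) (g i))"
    unfolding c by (simp add: scale_left_distrib sum.distrib)
  then show ?case by (intro exI[of _ "\<lambda>i. (if i = j then t else 0) + c i"])
qed

text \<open>More than \<open>dimension\<close> iterates of one vector cannot be independent; an
  iterate depending on the earlier ones yields a monic \<open>p\<close>.\<close>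

lemma exists_annihilating_poly: "\<exists>p. p \<noteq> 0 \<and> poly_act x p v = 0"
proof -
  let ?A = "\<lambda>n. (\<lambda>i. (x ^^ i) v) ` {..<n}"
  have "\<exists>n. (x ^^ n) v \<in> span (?A n)"
  proof (rule ccontr)
    assume "\<not> ?thesis"
    then have neg: "(x ^^ n) v \<notin> span (?A n)" for n by blast
    have "independent (?A n) \<and> card (?A n) = n" for n
    proof (induction n)
      case (Suc n)
      have "?A (Suc n) = insert ((x ^^ n) v) (?A n)" by (auto simp: lessThan_Suc)
      moreover have "(x ^^ n) v \<notin> ?A n" using neg[of n] span_base[of "(x ^^ n) v" "?A n"] by argo
      ultimately show ?case using Suc neg[of n] by (simp add: independent_insertI)
    qed (simp add: independent_empty)
    from this[of "Suc dimension"] show False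
      using independent_card_le_dim[OF subset_UNIV, of "?A (Suc dimension)"] by (simp add: dimension_def)
  qed
  then obtain n where "(x ^^ n) v \<in> span (?A n)" by blast
  then obtain c where c: "(x ^^ n) v = (\<Sum>i<n. scale (c i) ((x ^^ i) v))"
    using span_image_sum[of "{..<n}"] by blast
  define p where "p = monom 1 n - (\<Sum>i<n. monom (c i) i)"
  have cf: "coeff p i = (if i = n then 1 else if i < n then - c i else 0)" for i
    by (auto simp: p_def coeff_sum)
  have "degree p \<le> n" by (rule degree_le) (simp add: cf)
  then have "poly_act x p v = (\<Sum>i<n. scale (- c i) ((x ^^ i) v)) + (x ^^ n) v"
    by (simp add: poly_act_bound[of p n] cf flip: lessThan_Suc_atMost)
  also have "\<dots> = 0" by (simp add: c sum_negf)
  finally have "poly_act x p v = 0" .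
  moreover have "p \<noteq> 0" using cf[of n] by auto
  ultimately show ?thesis by blast
qed

text \<open>Induction on the degree of an annihilating polynomial: a root \<open>z\<close> splits
  off a factor, the induction hypothesis treats \<open>(x - z) v\<close>, and
  \<open>span_gev_step\<close> goes back to \<open>v\<close>.\<close>

lemma span_gev:
  assumes x: "lin x"
  shows "span {v. \<exists>c. gev x c v} = UNIV"
proof -
  let ?G = "{v. \<exists>c. gev x c v}"
  have "v \<in> span ?G" if "p \<noteq> 0" "poly_act x p v \<in> span ?G" for p v
    using that
  proof (induction "degree p" arbitrary: p v)
    case 0
    then obtain a where a: "p = [:a:]" "a \<noteq> 0" by (metis degree_eq_zeroE pCons_eq_0_iff)
    then have "scale a v \<in> span ?G"
      using 0 by (simp add: poly_act_def)
    then have "scale (1 / a) (scale a v) \<in> span ?G" by (rule span_scale)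
    then show ?case using a by simp
  next
    case (Suc n)
    then have "\<not> constant (poly p)" by (simp add: constant_degree)
    then obtain z where "poly p z = 0" using fundamental_theorem_of_algebra by blast
    then obtain q where q: "p = [:- z, 1:] * q" using poly_eq_0_iff_dvd by (metis dvdE)
    then have q0: "q \<noteq> 0" using Suc.prems by auto
    then have "n = degree q"
      using Suc.hyps(2) degree_mult_eq[of "[:- z, 1:]" q] by (simp add: q del: mult_pCons_left)
    moreover have "poly_act x q (x v - scale z v) \<in> span ?G"
      using Suc.prems(2) by (simp only: q poly_act_linear_factor[OF x])
    ultimately have "x v - scale z v \<in> span ?G" using Suc.hyps(1) q0 by blast
    then show ?case by (rule span_gev_step[OF x])
  qed
  then have "v \<in> span ?G" for v
    using exists_annihilating_poly[of x v] by (metis span_zero)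
  then show ?thesis by blast
qed

text \<open>Modulo an invariant \<open>W\<close>, the map \<open>x - d\<close> is injective on
  generalized \<open>c\<close>-eigenvectors, since it differs from the scalar \<open>c - d\<close>
  by a nilpotent map.\<close>

lemma gev_in_invariant:
  assumes x: "lin x" and W: "subspace W" "\<And>w. w \<in> W \<Longrightarrow> x w \<in> W"
    and z: "gev x c z" and "((\<lambda>v. x v - scale d v) ^^ m) z \<in> W" and "c \<noteq> d"
  shows "z \<in> W"
proof -
  have 1: "z \<in> W" if "((\<lambda>v. x v - scale c v) ^^ k) z = 0" "x z - scale d z \<in> W" for k z
    using that
  proof (induction k arbitrary: z)
    case 0
    then show ?case by (simp add: subspace_0[OF W(1)])
  next
    case (Suc k)
    let ?u = "x z - scale c z"
    have "x ?u - scale d ?u = x (x z - scale d z) - scale c (x z - scale d z)"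
      by (simp add: lin_diff[OF x] lin_scale[OF x] algebra_simps)
    then have "x ?u - scale d ?u \<in> W"
      using subspace_diff[OF W(1) W(2)[OF Suc.prems(2)] subspace_scale[OF W(1) Suc.prems(2), of c]] by simp
    moreover have "((\<lambda>v. x v - scale c v) ^^ k) ?u = 0" using Suc.prems by (simp add: funpow_Suc_right del: funpow.simps(2))
    ultimately have "?u \<in> W" by (rule Suc.IH[rotated])
    from subspace_scale[OF W(1) subspace_diff[OF W(1) Suc.prems(2) this], of "1 / (c - d)"]
    have "scale (1 / (c - d)) ((x z - scale d z) - ?u) \<in> W" .
    moreover have "(x z - scale d z) - ?u = scale (c - d) z" by (simp add: algebra_simps)
    ultimately show ?case using \<open>c \<noteq> d\<close> by simp
  qed
  show ?thesis
    using z assms(5)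
  proof (induction m arbitrary: z)
    case (Suc m)
    let ?u = "x z - scale d z"
    have "gev x c ?u" by (rule gev_shift_other[OF x Suc.prems(1)])
    moreover have "((\<lambda>v. x v - scale d v) ^^ m) ?u \<in> W" using Suc.prems by (simp add: funpow_Suc_right del: funpow.simps(2))
    ultimately have "?u \<in> W" by (rule Suc.IH)
    then show ?case using 1 Suc.prems(1) unfolding gev_def by blast
  qed simp
qed

text \<open>A power of \<open>x - d\<close> kills the \<open>d\<close>-component, the others are
  treated by induction, and \<open>gev_in_invariant\<close> undoes the power. For
  \<open>W = {0}\<close> this is directness of the decomposition; for a subalgebra \<open>W\<close>
  stable under \<open>ad x\<close> it splits elements of \<open>W\<close> inside
  \<open>W\<close>.\<close>

lemma gev_sum_in_invariant:
  assumes x: "lin x" and W: "subspace W" "\<And>w. w \<in> W \<Longrightarrow> x w \<in> W"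
    and "finite C" "\<And>c. c \<in> C \<Longrightarrow> gev x c (z c)" "(\<Sum>c\<in>C. z c) \<in> W" "c \<in> C"
  shows "z c \<in> W"
  using assms(4-)
proof (induction C arbitrary: z c rule: finite_induct)
  case (insert d C)
  let ?f = "\<lambda>v. x v - scale d v"
  note lf = lin_shift[OF x, of d]
  obtain m where m: "(?f ^^ m) (z d) = 0" using insert.prems(1)[of d] by (auto simp: gev_def)
  have fW: "(?f ^^ m) w \<in> W" if "w \<in> W" for w
    using that by (induction m) (simp_all add: W subspace_diff subspace_scale)
  have gz: "gev x c ((?f ^^ k) (z c))" if "c \<in> C" for c k
  proof (induction k)
    case (Suc k)
    then show ?case using gev_shift_other[OF x Suc, of d] by simp
  qed (use insert.prems(1) that in simp)
  have "(?f ^^ m) (\<Sum>c\<in>insert d C. z c) = (\<Sum>c\<in>C. (?f ^^ m) (z c))"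
    using insert.hyps m by (simp add: lin_add[OF lin_funpow[OF lf]] lin_sum[OF lin_funpow[OF lf]])
  then have "(\<Sum>c\<in>C. (?f ^^ m) (z c)) \<in> W" using fW[OF insert.prems(2)] by simp
  then have "(?f ^^ m) (z c) \<in> W" if "c \<in> C" for c
    using insert.IH[of "\<lambda>c. (?f ^^ m) (z c)" c] gz that by blast
  then have C: "z c \<in> W" if "c \<in> C" for c
    using gev_in_invariant[OF x W, of c "z c" m d] insert.prems(1)[of c] insert.hyps(2) that by auto
  then have "(\<Sum>c\<in>C. z c) \<in> W" by (intro subspace_sum[OF W(1)])
  then have "(\<Sum>c\<in>insert d C. z c) - (\<Sum>c\<in>C. z c) \<in> W"
    using insert.prems(2) by (rule subspace_diff[OF W(1), rotated])
  then have "z d \<in> W" using insert.hyps by simp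
  then show ?case using C insert.prems(3) by blast
qed simp

lemma gev_basis:
  assumes x: "lin x"
  obtains B l where "independent B" "span B = UNIV" "\<And>b. b \<in> B \<Longrightarrow> gev x (l b) b"
proof -
  obtain B where B: "B \<subseteq> {v. \<exists>c. gev x c v}" "independent B" "{v. \<exists>c. gev x c v} \<subseteq> span B"
    by (rule maximal_independent_subset)
  have "span B = UNIV"
    using span_minimal[OF B(3) subspace_span] span_gev[OF x] by auto
  moreover have "\<forall>b\<in>B. \<exists>c. gev x c b" using B(1) by blast
  then obtain l where "\<forall>b\<in>B. gev x (l b) b" by (rule bchoice[THEN exE])
  ultimately show thesis using that B(2) by blast
qed

lemma gev_decomposition:
  assumes x: "lin x"
  obtains C z where "finite C" "\<And>c. gev x c (z c)" "v = (\<Sum>c\<in>C. z c)"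
proof -
  obtain B l where B: "independent B" "span B = UNIV" "\<And>b. b \<in> B \<Longrightarrow> gev x (l b) b"
    using gev_basis[OF x] by blast
  have fin: "finite B" using B(1) by (rule finiteI_independent)
  let ?z = "\<lambda>c. \<Sum>b\<in>{b\<in>B. l b = c}. scale (representation B v b) b"
  have g: "gev x c (?z c)" for c
    using subspace_sum[OF subspace_gev[OF x], of "{b\<in>B. l b = c}"
        "\<lambda>b. scale (representation B v b) b" c] B(3) subspace_scale[OF subspace_gev[OF x]] by auto
  have v: "v = (\<Sum>c\<in>l ` B. ?z c)"
    using sum.image_gen[OF fin, of "\<lambda>b. scale (representation B v b) b" l] rep_sum[OF B(1), of v] B(2)
    by simp
  show thesis by (rule that[OF finite_imageI[OF fin] g v])
qed

lemma nilp_basis: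
  assumes f: "lin f" and B: "finite B" "span B = UNIV" "\<And>b. b \<in> B \<Longrightarrow> \<exists>k. (f ^^ k) b = 0"
  shows "nilp f"
proof -
  have "\<forall>b\<in>B. \<exists>k. (f ^^ k) b = 0" using B(3) by blast
  then obtain k where k: "\<forall>b\<in>B. (f ^^ k b) b = 0" by (rule bchoice[THEN exE])
  have "(f ^^ sum k B) b = 0" if "b \<in> B" for b
    using funpow_zero_mono[OF f] k that member_le_sum[of b B k] B(1) by blast
  then have "(f ^^ sum k B) v = 0" for v
    using lin_eq_on_span[OF lin_funpow[OF f] lin_zero, of B "sum k B" v] B(2) by simp
  then show ?thesis unfolding nilp_def by blast
qed

text \<open>\<open>y\<close> is the function \<open>w\<close> of the semisimple part of
  \<open>x\<close>. The eigenvalue list \<open>l\<close> on \<open>B\<close> is fixed before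
  \<open>w\<close>, so that traces for different \<open>w\<close> refer to the same list.\<close>

lemma spectral_operator:
  assumes x: "lin x"
  obtains B :: "'a set" and l where "finite B" "span B = UNIV" "\<And>b. b \<in> B \<Longrightarrow> gev x (l b) b"
    "\<And>w. \<exists>y. lin y \<and> (\<forall>c v. gev x c v \<longrightarrow> y v = scale (w c) v) \<and> tr y = (\<Sum>b\<in>B. w (l b))"
proof -
  obtain B l where B: "independent B" "span B = UNIV" "\<And>b. b \<in> B \<Longrightarrow> gev x (l b) b"
    using gev_basis[OF x] by blast
  have fin: "finite B" using B(1) by (rule finiteI_independent)
  have sp: "v \<in> span B" for v using B(2) by simp
  have op: "\<exists>y. lin y \<and> (\<forall>c v. gev x c v \<longrightarrow> y v = scale (w c) v) \<and> tr y = (\<Sum>b\<in>B. w (l b))" for w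
  proof -
    let ?z = "\<lambda>v c. \<Sum>b\<in>{b\<in>B. l b = c}. scale (representation B v b) b"
    define y where "y v = (\<Sum>b\<in>B. scale (w (l b)) (scale (representation B v b) b))" for v
    have ly: "lin y"
      unfolding y_def by (intro lin_fun_sum lin_fun_scale lin_rep[OF B(1) sp lin_id])
    have gz: "gev x c (?z v c)" for c v
      using subspace_sum[OF subspace_gev[OF x], of "{b\<in>B. l b = c}"
          "\<lambda>b. scale (representation B v b) b" c] B(3) subspace_scale[OF subspace_gev[OF x]] by auto
    have vz: "v = (\<Sum>c\<in>l ` B. ?z v c)" for v
      using sum.image_gen[OF fin, of "\<lambda>b. scale (representation B v b) b" l] rep_sum[OF B(1), of v] B(2)
      by simp
    have yz: "y v = (\<Sum>c\<in>l ` B. scale (w c) (?z v c))" for v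
      unfolding y_def using sum.image_gen[OF fin, of "\<lambda>b. scale (w (l b)) (scale (representation B v b) b)" l]
      by (simp add: scale_sum_right)
    have ev: "y v = scale (w c) v" if v: "gev x c v" for c v
    proof -
      let ?C = "insert c (l ` B)"
      \<comment> \<open>The components of \<open>v\<close> minus the decomposition of
        \<open>v\<close> into the single part \<open>v\<close> at \<open>c\<close>. These
        differences sum to zero, so each vanishes. If \<open>c\<close> is not among the eigenvalues
        in \<open>l\<close>, this says \<open>v = 0\<close>, which is why \<open>c\<close> is
        inserted.\<close>
      let ?u = "\<lambda>d. (if d \<in> l ` B then ?z v d else 0) - (if d = c then v else 0)"
      have g0: "gev x d 0" for d using subspace_0[OF subspace_gev[OF x]] by simp
      have gu: "gev x d (?u d)" for d
        using subspace_diff[OF subspace_gev[OF x], of _ d] gz[of d v] g0[of d] v by auto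
      have "sum ?u ?C = v - v"
        using fin vz[of v] by (simp add: sum_subtractf sum.inter_restrict[symmetric] insert_absorb
            Int_absorb1 subset_insertI)
      then have "?u d \<in> {0}" if "d \<in> ?C" for d
        using gev_sum_in_invariant[OF x subspace_single_0, of ?C ?u d] gu that fin lin_0[OF x] by auto
      then have u0: "?u d = 0" if "d \<in> ?C" for d using that by blast
      have "scale (w d) (?z v d) = (if d = c then scale (w c) v else 0)" if "d \<in> l ` B" for d
        using u0[of d] that by (auto split: if_splits)
      then have "y v = (\<Sum>d\<in>l ` B. if d = c then scale (w c) v else 0)"
        unfolding yz by (intro sum.cong) auto
      also have "\<dots> = scale (w c) v"
        using fin u0[of c] by (auto split: if_splits)
      finally show ?thesis .
    qed
    have "tr y = (\<Sum>b\<in>B. w (l b))"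
    proof -
      have "representation B (y b) b = w (l b)" if "b \<in> B" for b
        using ev[OF B(3)[OF that]] representation_scale[OF B(1) sp]
          representation_basis[OF B(1) that] by simp
      then show ?thesis by (simp add: tr_independent[OF ly B(1) sp])
    qed
    then show ?thesis using ly ev by blast
  qed
  show thesis by (rule that[OF fin B(2,3) op])
qed

text \<open>Let \<open>s\<close> be the scalar \<open>c * cnj c\<close> on each generalized
  \<open>c\<close>-eigenspace. There \<open>x y - s = cnj c * (x - c)\<close>, which is nilpotent,
  so \<open>x y\<close> has the trace of \<open>s\<close>: a sum of squared moduli. If it is zero,
  all eigenvalues of \<open>x\<close> are zero.\<close>

lemma conjugate_operator:
  assumes x: "lin x"
  obtains y where "lin y" "\<And>c v. gev x c v \<Longrightarrow> y v = scale (cnj c) v"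
    "tr (\<lambda>v. x (y v)) = 0 \<Longrightarrow> nilp x"
proof -
  obtain B :: "'a set" and l where B: "finite B" "span B = UNIV" "\<And>b. b \<in> B \<Longrightarrow> gev x (l b) b"
    and op: "\<And>w. \<exists>y. lin y \<and> (\<forall>c v. gev x c v \<longrightarrow> y v = scale (w c) v) \<and> tr y = (\<Sum>b\<in>B. w (l b))"
    using spectral_operator[OF x] by blast
  obtain y where y: "lin y" "\<And>c v. gev x c v \<Longrightarrow> y v = scale (cnj c) v" using op[of cnj] by blast
  obtain s where s: "lin s" "\<And>c v. gev x c v \<Longrightarrow> s v = scale (c * cnj c) v"
    "tr s = (\<Sum>b\<in>B. l b * cnj (l b))" using op[of "\<lambda>c. c * cnj c"] by blast
  define n where "n v = x (y v) - s v" for v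
  have ln: "lin n" unfolding n_def by (intro lin_fun_diff lin_comp[OF x] y s)
  have n: "(n ^^ k) v = scale (cnj c ^ k) (((\<lambda>v. x v - scale c v) ^^ k) v)"
    if "gev x c v" for c v k
    using that
  proof (induction k arbitrary: v)
    case (Suc k)
    have "n v = scale (cnj c) (x v - scale c v)"
      by (simp add: n_def y(2)[OF Suc.prems] s(2)[OF Suc.prems] lin_scale[OF x]
          scale_right_diff_distrib mult.commute)
    then show ?case
      using Suc.IH[OF gev_shift[OF x Suc.prems]]
      by (simp add: funpow_Suc_right lin_scale[OF lin_funpow[OF ln]] del: funpow.simps(2))
  qed simp
  have "\<exists>k. (n ^^ k) b = 0" if b: "b \<in> B" for b
  proof -
    obtain k where "((\<lambda>v. x v - scale (l b) v) ^^ k) b = 0" using B(3)[OF b] by (auto simp: gev_def)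
    then have "(n ^^ k) b = 0" by (simp add: n[OF B(3)[OF b]])
    then show ?thesis by blast
  qed
  then have "nilp n" by (rule nilp_basis[OF ln B(1,2)])
  then have "tr n = 0" by (rule tr_nilp[OF ln])
  then have trxy: "tr (\<lambda>v. x (y v)) = (\<Sum>b\<in>B. l b * cnj (l b))"
    using tr_diff[of "\<lambda>v. x (y v)" s] s(3) by (simp add: n_def[abs_def])
  have nx: "nilp x" if "tr (\<lambda>v. x (y v)) = 0"
  proof (rule nilp_basis[OF x B(1,2)])
    fix b assume b: "b \<in> B"
    have "(\<Sum>b\<in>B. l b * cnj (l b)) = complex_of_real (\<Sum>b\<in>B. (cmod (l b))\<^sup>2)"
      by (simp only: complex_norm_square[symmetric] of_real_sum)
    then have "(\<Sum>b\<in>B. (cmod (l b))\<^sup>2) = 0"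
      using that trxy by (simp only: of_real_eq_0_iff)
    then have "l b = 0" using b B(1) by (simp add: sum_nonneg_eq_0_iff)
    then show "\<exists>k. (x ^^ k) b = 0" using B(3)[OF b] by (simp add: gev_def)
  qed
  show thesis by (rule that[OF y nx])
qed

subsection \<open>Flags of nilpotent families\<close>

text \<open>The vectors killed by every product of \<open>n\<close> operators \<open>r k\<close>
  with \<open>k\<close> in \<open>K\<close>; \<open>flag r K m = UNIV\<close> says that the family
  is jointly nilpotent.\<close>

primrec flag :: "('k \<Rightarrow> 'a \<Rightarrow> 'a) \<Rightarrow> 'k set \<Rightarrow> nat \<Rightarrow> 'a set" where
  "flag r K 0 = {0}"
| "flag r K (Suc n) = {v. \<forall>k\<in>K. r k v \<in> flag r K n}"

lemma subspace_flag:
  assumes r: "\<And>k. lin (r k)"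
  shows "subspace (flag r K n)"
proof (induction n)
  case (Suc n)
  then show ?case
    by (auto simp: subspace_def lin_add[OF r] lin_scale[OF r] lin_0[OF r])
qed simp

lemma flag_Suc:
  assumes r: "\<And>k. lin (r k)"
  shows "flag r K n \<subseteq> flag r K (Suc n)"
  by (induction n) (auto simp: lin_0[OF r])

lemma flag_mono:
  assumes r: "\<And>k. lin (r k)" and "i \<le> j"
  shows "flag r K i \<subseteq> flag r K j"
  using lift_Suc_mono_le[of "flag r K", OF flag_Suc[OF r] \<open>i \<le> j\<close>] .

text \<open>The truncated \<open>n - 1\<close> is harmless at \<open>n = 0\<close>, where
  \<open>v\<close> is zero.\<close>

lemma flag_lower:
  assumes r: "\<And>k. lin (r k)" and "k \<in> K" "v \<in> flag r K n"
  shows "r k v \<in> flag r K (n - 1)"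
  using assms(2,3) by (cases n) (auto simp: lin_0[OF r])

lemma subspace_dim_less:
  assumes "subspace U" "subspace V" "U \<subset> V"
  shows "dim U < dim V"
  using dim_psubset[of U V] assms by (simp add: span_eq_iff[THEN iffD2])

lemma flag_UNIV:
  assumes r: "\<And>k. lin (r k)"
    and step: "\<And>n. flag r K n \<noteq> UNIV \<Longrightarrow> \<exists>v. v \<notin> flag r K n \<and> (\<forall>k\<in>K. r k v \<in> flag r K n)"
  shows "\<exists>m. flag r K m = UNIV"
proof (rule ccontr)
  assume "\<not> ?thesis"
  then have neq: "flag r K n \<noteq> UNIV" for n by blast
  have "n \<le> dim (flag r K n)" for n
  proof (induction n)
    case (Suc n)
    obtain v where "v \<notin> flag r K n" "\<forall>k\<in>K. r k v \<in> flag r K n" using step[OF neq[of n]] by blast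
    then have "v \<in> flag r K (Suc n)" "v \<notin> flag r K n" by simp_all
    then have "flag r K n \<subset> flag r K (Suc n)" using flag_Suc[of r K n, OF r] by blast
    then have "dim (flag r K n) < dim (flag r K (Suc n))"
      by (intro subspace_dim_less subspace_flag r)
    then show ?case using Suc by simp
  qed simp
  from this[of "Suc dimension"] show False
    using dim_subset_UNIV[of "flag r K (Suc dimension)"] by simp
qed

text \<open>In the first flag term not inside \<open>U\<close>, any vector outside \<open>U\<close>
  works: \<open>K\<close> sends it to the previous term, which is inside \<open>U\<close>.\<close>

lemma flag_escape:
  assumes "flag r K m = UNIV" "0 \<in> U" "U \<noteq> UNIV"
  shows "\<exists>v. v \<notin> U \<and> (\<forall>k\<in>K. r k v \<in> U)"
proof -
  have "\<exists>i. \<not> flag r K i \<subseteq> U" using assms by (intro exI[of _ m]) auto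
  then obtain i where i: "\<not> flag r K i \<subseteq> U" "\<And>j. j < i \<Longrightarrow> flag r K j \<subseteq> U"
    using exists_least_iff[of "\<lambda>i. \<not> flag r K i \<subseteq> U"] by blast
  then obtain j where j: "i = Suc j" using assms(2) by (cases i) auto
  obtain v where "v \<in> flag r K i" "v \<notin> U" using i(1) by blast
  then show ?thesis using i(2)[of j] j by auto
qed

end

sublocale fd_left_leibniz_algebra \<subseteq> complex_fd_space scale Basis
  by unfold_locales

context fd_left_leibniz_algebra begin

subsection \<open>Representations on the ambient space\<close>

lemma br_lin: "lin (br a)" "lin (\<lambda>a. br a b)"
  using linear_right[of a] linear_left[of b] by simp_all

lemmas br_simps = lin_simps[OF br_lin(1)] lin_simps[OF br_lin(2)]

text \<open>The module is always the ambient space. Linearity in the acting element is required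
  everywhere, the commutator rule only on \<open>L\<close>, so that a compressed action
  \<open>p (r t (p v))\<close> qualifies when only \<open>L\<close> preserves the subspaces.\<close>

definition rep_on :: "'a set \<Rightarrow> ('a \<Rightarrow> 'a \<Rightarrow> 'a) \<Rightarrow> bool" where
  "rep_on L r \<longleftrightarrow> (\<forall>a. lin (r a)) \<and> (\<forall>v. lin (\<lambda>a. r a v)) \<and>
     (\<forall>a\<in>L. \<forall>b\<in>L. \<forall>v. r (br a b) v = r a (r b v) - r b (r a v))"

lemma rep_onD:
  assumes "rep_on L r"
  shows "lin (r a)" "lin (\<lambda>a. r a v)"
    "a \<in> L \<Longrightarrow> b \<in> L \<Longrightarrow> r (br a b) v = r a (r b v) - r b (r a v)"
  using assms by (simp_all add: rep_on_def)

lemma rep_on_subset: "rep_on L r \<Longrightarrow> K \<subseteq> L \<Longrightarrow> rep_on K r"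
  unfolding rep_on_def by blast

lemma rep_on_br: "rep_on L br"
  unfolding rep_on_def
proof (intro conjI allI ballI)
  show "br (br a b) v = br a (br b v) - br b (br a v)" for a b v
    unfolding left_leibniz[of a b v] by simp
qed (rule br_lin)+

lemma subalgebraD:
  assumes "subalgebra L"
  shows "subspace L" "a \<in> L \<Longrightarrow> b \<in> L \<Longrightarrow> br a b \<in> L"
  using assms by (simp_all add: subalgebra_def)

lemma br_in_bracket: "a \<in> A \<Longrightarrow> b \<in> B \<Longrightarrow> br a b \<in> bracket A B"
  unfolding bracket_def by (rule span_base) blast

lemma bracket_minimal: "(\<And>a b. a \<in> A \<Longrightarrow> b \<in> B \<Longrightarrow> br a b \<in> W) \<Longrightarrow> subspace W \<Longrightarrow> bracket A B \<subseteq> W"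
  unfolding bracket_def by (intro span_minimal) auto

text \<open>\<open>(x - c - d) (b v) = ((x - d) b) v + b ((x - c) v)\<close>, so a power
  \<open>i + j\<close> leaves only terms in which \<open>i\<close> factors have hit \<open>b\<close>
  or \<open>j\<close> factors have hit \<open>v\<close>.\<close>

lemma gev_rep:
  assumes r: "rep_on L r" and L: "subalgebra L" and x: "x \<in> L" and b: "b \<in> L"
    and gb: "gev (br x) d b" and gv: "gev (r x) c v"
  shows "gev (r x) (c + d) (r b v)"
proof -
  note rl = rep_onD[OF r]
  let ?f = "\<lambda>v. r x v - scale (c + d) v"
  have *: "(?f ^^ n) (r b v) = 0"
    if "n = i + j" "b \<in> L" "((\<lambda>b. br x b - scale d b) ^^ i) b = 0" "((\<lambda>v. r x v - scale c v) ^^ j) v = 0"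
    for n i j b v
    using that
  proof (induction n arbitrary: i j b v)
    case 0
    then show ?case by (simp add: lin_0[OF rl(1)])
  next
    case (Suc n)
    have z: "(?f ^^ k) 0 = 0" for k by (rule lin_0[OF lin_funpow[OF lin_shift[OF rl(1)]]])
    show ?case
    proof (cases "i = 0 \<or> j = 0")
      case True
      then have "b = 0 \<or> v = 0" using Suc.prems by auto
      then have "r b v = 0" by (auto simp: lin_0[OF rl(1)] lin_0[OF rl(2)])
      then show ?thesis using z[of "Suc n"] by simp
    next
      case False
      then obtain i' j' where ij: "i = Suc i'" "j = Suc j'" by (metis not0_implies_Suc)
      let ?b = "br x b - scale d b" and ?v = "r x v - scale c v"
      have bL: "?b \<in> L"
        using subalgebraD[OF L] x Suc.prems(2) by (simp add: subspace_diff subspace_scale)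
      have "?f (r b v) = r ?b v + r b ?v"
        by (simp add: lin_simps[OF rl(1)] lin_simps[OF rl(2)] rl(3)[OF x Suc.prems(2)] algebra_simps)
      moreover have "(?f ^^ n) (r ?b v) = 0"
        by (rule Suc.IH[of i' j ?b v])
          (use Suc.prems bL ij in \<open>simp_all add: funpow_Suc_right del: funpow.simps(2)\<close>)
      moreover have "(?f ^^ n) (r b ?v) = 0"
        by (rule Suc.IH[of i j' b ?v])
          (use Suc.prems bL ij in \<open>simp_all add: funpow_Suc_right del: funpow.simps(2)\<close>)
      ultimately show ?thesis
        by (simp add: funpow_Suc_right lin_add[OF lin_funpow[OF lin_shift[OF rl(1)]]]
            del: funpow.simps(2))
    qed
  qed
  then show ?thesis using gb gv b unfolding gev_def by blast
qed

subsection \<open>Cartan's criterion\<close>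

text \<open>If \<open>y\<close> has eigenvalue \<open>cnj c\<close> on the generalized \<open>c\<close>-eigenspace of \<open>r x\<close>, then commuting with
  \<open>y\<close> maps \<open>r L\<close> to itself; hence \<open>tr (r x \<circ> y) = 0\<close>, while this trace is the sum of the squared
  moduli of the eigenvalues of \<open>r x\<close>.\<close>

lemma nilp_of_trace_form_zero:
  assumes L: "subalgebra L" and r: "rep_on L r"
    and tr0: "\<And>a b. a \<in> L \<Longrightarrow> b \<in> L \<Longrightarrow> tr (\<lambda>v. r a (r b v)) = 0"
    and xL: "x \<in> L" and x: "x \<in> bracket L L"
  shows "nilp (r x)"
proof -
  note rl = rep_onD[OF r]
  obtain y where y: "lin y" "\<And>c v. gev (r x) c v \<Longrightarrow> y v = scale (cnj c) v"
    "tr (\<lambda>v. r x (y v)) = 0 \<Longrightarrow> nilp (r x)"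
    using conjugate_operator[OF rl(1)] by blast
  have comm: "\<exists>b'\<in>L. \<forall>v. y (r b v) - r b (y v) = r b' v" if b: "b \<in> L" for b
  proof -
    obtain C z where C: "finite C" "\<And>c. gev (br x) c (z c)" "b = (\<Sum>c\<in>C. z c)"
      using gev_decomposition[OF br_lin(1)[of x], of b] by metis
    have zL: "z c \<in> L" if "c \<in> C" for c
      using gev_sum_in_invariant[OF br_lin(1) subalgebraD(1)[OF L], of x C z c] C b that xL
        subalgebraD(2)[OF L] by blast
    \<comment> \<open>\<open>r (z d)\<close> shifts the eigenvalue from \<open>c\<close> to
      \<open>c + d\<close>, so its commutator with \<open>y\<close> is
      \<open>cnj (c + d) - cnj c = cnj d\<close> times itself. As this does not depend on
      \<open>c\<close>, one \<open>b'\<close> serves all eigenspaces.\<close>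
    define b' where "b' = (\<Sum>c\<in>C. scale (cnj c) (z c))"
    have "b' \<in> L" unfolding b'_def
      using zL subalgebraD(1)[OF L] by (intro subspace_sum subspace_scale)
    moreover have "y (r b v) - r b (y v) = r b' v" for v
    proof (rule lin_eq_on_span[where B = "{v. \<exists>c. gev (r x) c v}"
          and f = "\<lambda>v. y (r b v) - r b (y v)" and g = "r b'"])
      show "lin (\<lambda>v. y (r b v) - r b (y v))"
        by (intro lin_fun_diff lin_comp[OF y(1) rl(1)] lin_comp[OF rl(1) y(1)])
      show "lin (r b')" by (rule rl(1))
      show "v \<in> span {v. \<exists>c. gev (r x) c v}" by (simp add: span_gev[OF rl(1)])
      fix v assume "v \<in> {v. \<exists>c. gev (r x) c v}"
      then obtain c where c: "gev (r x) c v" by blast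
      have "y (r (z d) v) - r (z d) (y v) = scale (cnj d) (r (z d) v)" if "d \<in> C" for d
        using y(2)[OF gev_rep[OF r L xL zL[OF that] C(2) c]]
        by (simp add: y(2)[OF c] lin_simps[OF rl(1)] algebra_simps)
      then have "(\<Sum>d\<in>C. y (r (z d) v) - r (z d) (y v)) = (\<Sum>d\<in>C. scale (cnj d) (r (z d) v))"
        by simp
      then show "y (r b v) - r b (y v) = r b' v"
        by (simp add: C(3) b'_def lin_simps[OF rl(2)] lin_simps[OF y(1)] sum_subtractf)
    qed
    ultimately show ?thesis by blast
  qed
  \<comment> \<open>Cyclicity turns the trace of \<open>[a, b] y\<close> into that of
    \<open>a (b y - y b)\<close>, which is minus the trace form at \<open>a\<close> and
    \<open>b'\<close>.\<close>
  have "bracket L L \<subseteq> {u. tr (\<lambda>v. r u (y v)) = 0}"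
  proof (rule bracket_minimal)
    show "subspace {u. tr (\<lambda>v. r u (y v)) = 0}"
      by (auto simp: subspace_def lin_simps[OF rl(2)] tr_add tr_scale tr_zero)
    fix a b assume ab: "a \<in> L" "b \<in> L"
    obtain b' where b': "b' \<in> L" "\<And>v. y (r b v) - r b (y v) = r b' v" using comm[OF ab(2)] by blast
    have "tr (\<lambda>v. r (br a b) (y v)) = tr (\<lambda>v. r a (r b (y v))) - tr (\<lambda>v. r b (r a (y v)))"
      by (simp add: rl(3)[OF ab] tr_diff)
    also have "tr (\<lambda>v. r b (r a (y v))) = tr (\<lambda>v. r a (y (r b v)))"
      by (rule tr_cyclic[OF rl(1) lin_comp[OF rl(1) y(1)]])
    also have "tr (\<lambda>v. r a (r b (y v))) - \<dots> = tr (\<lambda>v. r a (r b (y v)) - r a (y (r b v)))"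
      by (rule tr_diff[symmetric])
    also have "\<dots> = tr (\<lambda>v. scale (- 1) (r a (r b' v)))"
      by (simp add: lin_simps[OF rl(1)] flip: b'(2))
    also have "\<dots> = 0" by (simp only: tr_scale tr0[OF ab(1) b'(1)] mult_zero_right)
    finally show "br a b \<in> {u. tr (\<lambda>v. r u (y v)) = 0}" by simp
  qed
  then show ?thesis using x y(3) by blast
qed

text \<open>The commutator rule annihilates squares and symmetric sums of products, so
  \<open>L\<close> modulo the kernel is a Lie algebra. This lets Engel's argument run for Leibniz
  subalgebras.\<close>

lemma rep_kernel_ideal:
  assumes L: "subalgebra L" and r: "rep_on L r"
  shows "subspace {x\<in>L. \<forall>v. r x v = 0}"
    and "a \<in> L \<Longrightarrow> b \<in> {x\<in>L. \<forall>v. r x v = 0} \<Longrightarrow> br a b \<in> {x\<in>L. \<forall>v. r x v = 0}"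
    and "a \<in> L \<Longrightarrow> b \<in> {x\<in>L. \<forall>v. r x v = 0} \<Longrightarrow> br b a \<in> {x\<in>L. \<forall>v. r x v = 0}"
    and "a \<in> L \<Longrightarrow> b \<in> L \<Longrightarrow> br a b + br b a \<in> {x\<in>L. \<forall>v. r x v = 0}"
    and "a \<in> L \<Longrightarrow> br a a \<in> {x\<in>L. \<forall>v. r x v = 0}"
  using subalgebraD[OF L]
  by (auto simp: subspace_def lin_simps[OF rep_onD(2)[OF r]] lin_simps[OF rep_onD(1)[OF r]]
      rep_onD(3)[OF r])

section \<open>Engel's theorem for Leibniz subalgebras\<close>

lemma engel_normalizer:
  assumes L: "subalgebra L" and r: "rep_on L r"
    and K: "K \<subseteq> L" "{x\<in>L. \<forall>v. r x v = 0} \<subseteq> K" "flag r K m = UNIV" and "K \<noteq> L"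
  shows "\<exists>x\<in>L. x \<notin> K \<and> (\<forall>k\<in>K. br k x \<in> K)"
proof -
  note rl = rep_onD[OF r]
  note fs = subspace_flag[of r K, OF rl(1)]
  obtain x where x: "x \<in> L" "x \<notin> K" using K(1) \<open>K \<noteq> L\<close> by blast
  \<comment> \<open>\<open>A n\<close> holds the \<open>n\<close>-fold left brackets of
    \<open>x\<close> with elements of \<open>K\<close>. Long ones act as zero and so lie in the
    kernel, hence in \<open>K\<close>; the last stage that still leaves \<open>K\<close> supplies
    the normalizing element.\<close>
  define A where "A n = ((\<lambda>X. {br k a | k a. k \<in> K \<and> a \<in> X}) ^^ n) {x}" for n
  have A0: "A 0 = {x}" and AS: "A (Suc n) = {br k a | k a. k \<in> K \<and> a \<in> A n}" for n
    by (simp_all add: A_def)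
  have AL: "A n \<subseteq> L" for n
    using x(1) K(1) subalgebraD(2)[OF L] by (induction n) (auto simp: A0 AS)
  \<comment> \<open>Each bracket with \<open>K\<close> gains one step in the flag. For
    \<open>n = 2 * m\<close> and \<open>j = m\<close> the index is 0, so \<open>r a\<close> vanishes
    on the whole space.\<close>
  have Af: "r a v \<in> flag r K (m + j - n)" if "a \<in> A n" "v \<in> flag r K j" for a v j n
    using that
  proof (induction n arbitrary: a v j)
    case 0
    have "flag r K m \<subseteq> flag r K (m + j)" by (rule flag_mono[OF rl(1)]) simp
    then show ?case using K(3) by auto
  next
    case (Suc n)
    then obtain k a' where a: "k \<in> K" "a' \<in> A n" "a = br k a'" by (auto simp: AS)
    have kL: "k \<in> L" "a' \<in> L" using a K(1) AL by auto
    have eq: "r a v = r k (r a' v) - r a' (r k v)" by (simp add: a(3) rl(3)[OF kL])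
    show ?case
    proof (cases j)
      case 0
      then have "v = 0" using Suc.prems by simp
      then show ?thesis using subspace_0[OF fs] by (simp add: lin_0[OF rl(1)])
    next
      case (Suc i)
      have "r k v \<in> flag r K i" using Suc.prems(2) a(1) by (simp add: Suc)
      then have 1: "r a' (r k v) \<in> flag r K (m + j - Suc n)"
        using Suc.IH[OF a(2), of "r k v" i] by (simp add: Suc)
      have "r k (r a' v) \<in> flag r K (m + j - n - 1)"
        by (rule flag_lower[OF rl(1) a(1) Suc.IH[OF a(2) Suc.prems(2)]])
      then show ?thesis unfolding eq using subspace_diff[OF fs _ 1] by simp
    qed
  qed
  have "A (2 * m) \<subseteq> K"
  proof
    fix a assume a: "a \<in> A (2 * m)"
    have "r a v = 0" for v using Af[OF a, of v m] K(3) by simp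
    then show "a \<in> K" using a AL K(2) by blast
  qed
  then obtain i where i: "A i \<subseteq> K" "\<And>j. j < i \<Longrightarrow> \<not> A j \<subseteq> K"
    using exists_least_iff[of "\<lambda>i. A i \<subseteq> K"] by blast
  then obtain j where j: "i = Suc j" using A0 x(2) by (cases i) auto
  then obtain x' where "x' \<in> A j" "x' \<notin> K" using i(2)[of j] by auto
  then show ?thesis using i(1) j AS[of j] AL[of j] by blast
qed

text \<open>A largest jointly nilpotent \<open>K\<close> above the kernel is all of
  \<open>L\<close>: otherwise some \<open>x\<close> outside \<open>K\<close> has
  \<open>[K, x] \<subseteq> K\<close>, and \<open>K\<close> enlarged by \<open>x\<close> is again
  jointly nilpotent. Containing the kernel makes \<open>br x k\<close> and \<open>br x x\<close>
  fall into \<open>K\<close> as well.\<close>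

lemma engel:
  assumes L: "subalgebra L" and r: "rep_on L r" and nil: "\<And>x. x \<in> L \<Longrightarrow> nilp (r x)"
  shows "\<exists>m. flag r L m = UNIV"
proof -
  note rl = rep_onD[OF r]
  let ?Z = "{x\<in>L. \<forall>v. r x v = 0}"
  note Z = rep_kernel_ideal[OF L r]
  note sL = subalgebraD(1)[OF L] and cL = subalgebraD(2)[OF L]
  let ?P = "\<lambda>K. subalgebra K \<and> ?Z \<subseteq> K \<and> K \<subseteq> L \<and> (\<exists>m. flag r K m = UNIV)"
  have "?P ?Z"
  proof (intro conjI)
    show "subalgebra ?Z" using Z(1,2) by (auto simp: subalgebra_def)
    show "\<exists>m. flag r ?Z m = UNIV" by (rule exI[of _ "Suc 0"]) auto
  qed auto
  moreover have "\<forall>K. ?P K \<longrightarrow> dim K < Suc dimension"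
    by (simp add: dim_subset_UNIV less_Suc_eq_le)
  ultimately obtain K where K: "?P K" and max: "\<And>K'. ?P K' \<Longrightarrow> dim K' \<le> dim K"
    using ex_has_greatest_nat[of ?P ?Z dim "Suc dimension"] by auto
  obtain m where m: "flag r K m = UNIV" using K by blast
  note sK = subalgebraD(1)[OF conjunct1[OF K]] and cK = subalgebraD(2)[OF conjunct1[OF K]]
  have KL: "K \<subseteq> L" and ZK: "?Z \<subseteq> K" using K by auto
  have "K = L"
  proof (rule ccontr)
    assume "K \<noteq> L"
    then obtain x where x: "x \<in> L" "x \<notin> K" "\<And>k. k \<in> K \<Longrightarrow> br k x \<in> K"
      using engel_normalizer[OF L r KL ZK m] by blast
    have xk: "br x k \<in> K" if "k \<in> K" for k
    proof -
      have "br x k + br k x \<in> K" using Z(4)[of x k] x(1) that KL ZK by blast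
      from subspace_diff[OF sK this x(3)[OF that]] show ?thesis by simp
    qed
    have xx: "br x x \<in> K" using Z(5)[OF x(1)] ZK by blast
    define K' where "K' = span (insert x K)"
    have K'_iff: "u \<in> K' \<longleftrightarrow> (\<exists>c. u - scale c x \<in> K)" for u
      using sK by (simp add: K'_def span_insert span_eq_iff[THEN iffD2])
    have xK': "x \<in> K'" and KK': "K \<subseteq> K'"
      unfolding K'_def by (auto intro: span_base)
    have sK': "subspace K'" unfolding K'_def by (rule subspace_span)
    have K'L: "K' \<subseteq> L" unfolding K'_def using KL x(1) sL by (intro span_minimal) auto
    have "br u w \<in> K" if uw: "u \<in> K'" "w \<in> K'" for u w
    proof -
      obtain c d where cd: "u - scale c x \<in> K" "w - scale d x \<in> K" using uw K'_iff by blast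
      have "br u w = br (u - scale c x) (w - scale d x) + scale d (br (u - scale c x) x)
          + scale c (br x (w - scale d x)) + scale (c * d) (br x x)"
        by (simp add: br_simps algebra_simps)
      then show ?thesis
        using cd x(3) xk xx cK
        by (simp only:) (intro subspace_add[OF sK] subspace_scale[OF sK]; blast)
    qed
    then have "subalgebra K'" using sK' KK' by (auto simp: subalgebra_def)
    moreover have "\<exists>m. flag r K' m = UNIV"
    proof (rule flag_UNIV[OF rl(1)])
      fix n
      let ?U = "flag r K' n"
      note sU = subspace_flag[of r K' n, OF rl(1)]
      assume U: "?U \<noteq> UNIV"
      have inv: "r k u \<in> ?U" if "k \<in> K'" "u \<in> ?U" for k u
        using flag_lower[of r, OF rl(1) that] flag_mono[of r "n - 1" n, OF rl(1)] by auto
      obtain v where v: "v \<notin> ?U" "\<And>k. k \<in> K \<Longrightarrow> r k v \<in> ?U"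
        using flag_escape[OF m subspace_0[OF sU] U] by blast
      \<comment> \<open>The vectors sent into \<open>?U\<close> by all of \<open>K\<close> are
        stable under \<open>x\<close>; as \<open>x\<close> is nilpotent, the last iterate of
        \<open>v\<close> outside \<open>?U\<close> is sent into \<open>?U\<close> by
        \<open>x\<close> too.\<close>
      have Zx: "r k ((r x ^^ i) v) \<in> ?U" if "k \<in> K" for k i
        using that
      proof (induction i arbitrary: k)
        case (Suc i)
        let ?w = "(r x ^^ i) v"
        have "r k (r x ?w) = r x (r k ?w) + r (br k x) ?w"
          using rl(3)[of k x] Suc.prems KL x(1) by auto
        moreover have "r x (r k ?w) \<in> ?U" using inv[OF xK'] Suc by blast
        moreover have "r (br k x) ?w \<in> ?U" using Suc.IH x(3)[OF Suc.prems] by blast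
        ultimately show ?case using subspace_add[OF sU] by simp
      qed (use v in simp)
      obtain N where "\<And>w. (r x ^^ N) w = 0" using nil[OF x(1)] by (auto simp: nilp_def)
      then have "(r x ^^ N) v \<in> ?U" using subspace_0[OF sU] by simp
      then obtain i where i: "(r x ^^ i) v \<in> ?U" "\<And>j. j < i \<Longrightarrow> (r x ^^ j) v \<notin> ?U"
        using exists_least_iff[of "\<lambda>i. (r x ^^ i) v \<in> ?U"] by blast
      then obtain j where j: "i = Suc j" using v(1) by (cases i) auto
      let ?w = "(r x ^^ j) v"
      have w: "?w \<notin> ?U" "r x ?w \<in> ?U" using i j by auto
      have "r u ?w \<in> ?U" if "u \<in> K'" for u
      proof -
        obtain c where c: "u - scale c x \<in> K" using \<open>u \<in> K'\<close> K'_iff by blast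
        have "r u ?w = r (u - scale c x) ?w + scale c (r x ?w)" by (simp add: lin_simps[OF rl(2)])
        then show ?thesis using Zx[OF c, of j] w(2) subspace_add[OF sU] subspace_scale[OF sU] by simp
      qed
      then show "\<exists>v. v \<notin> ?U \<and> (\<forall>k\<in>K'. r k v \<in> ?U)" using w(1) by blast
    qed
    ultimately have "dim K' \<le> dim K" using max[of K'] KK' ZK K'L by blast
    then have "K = K'" using subspace_dim_equal[OF sK sK' KK'] by simp
    then show False using xK' x(2) by simp
  qed
  then show ?thesis using m by blast
qed

text \<open>By Engel's theorem \<open>L\<close> lowers a flag by one step. If \<open>L\<close>
  lowers it by \<open>n + 1\<close> steps, products of two elements lower it by at least
  \<open>n + 2\<close>; since \<open>L = [L, L]\<close>, so does \<open>L\<close>. Hence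
  \<open>L\<close> acts as zero.\<close>

lemma cartan_perfect:
  assumes L: "subalgebra L" and r: "rep_on L r" and perf: "bracket L L = L"
    and tr0: "\<And>a b. a \<in> L \<Longrightarrow> b \<in> L \<Longrightarrow> tr (\<lambda>v. r a (r b v)) = 0" and x: "x \<in> L"
  shows "r x v = 0"
proof -
  note rl = rep_onD[OF r]
  note fs = subspace_flag[of r L, OF rl(1)]
  have "nilp (r x)" if "x \<in> L" for x
    using nilp_of_trace_form_zero[OF L r tr0 that] that perf by simp
  then obtain m where m: "flag r L m = UNIV" using engel[OF L r] by blast
  have "r x v \<in> flag r L (j - Suc n)" if "x \<in> L" "v \<in> flag r L j" for n x v j
    using that
  proof (induction n arbitrary: x v j)
    case 0
    then show ?case using flag_lower[of r, OF rl(1) 0] by simp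
  next
    case (Suc n)
    let ?W = "{x. r x v \<in> flag r L (j - Suc (Suc n))}"
    have "bracket L L \<subseteq> ?W"
    proof (rule bracket_minimal)
      show "subspace ?W" by (rule subspace_lin_vimage[OF rl(2) fs])
      fix a b assume ab: "a \<in> L" "b \<in> L"
      have "flag r L (j - Suc n - Suc n) \<subseteq> flag r L (j - Suc (Suc n))"
        by (rule flag_mono[OF rl(1)]) simp
      then have "r a (r b v) - r b (r a v) \<in> flag r L (j - Suc (Suc n))"
        using Suc.IH[OF ab(1) Suc.IH[OF ab(2) Suc.prems(2)]]
          Suc.IH[OF ab(2) Suc.IH[OF ab(1) Suc.prems(2)]] subspace_diff[OF fs] by blast
      then show "br a b \<in> ?W" by (simp add: rl(3)[OF ab])
    qed
    then show ?case using Suc.prems(1) perf by blast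
  qed
  from this[OF x, of v m m] show ?thesis using m by simp
qed

lemma derived_subalgebra: "subalgebra L \<Longrightarrow> subalgebra (derived L n)"
proof (induction n)
  case (Suc n)
  have "derived L (Suc n) \<subseteq> derived L n"
    using derived_subset[of "derived L n" 1] Suc by simp
  then show ?case
    using bracket_mono[of "derived L (Suc n)" "derived L n" "derived L (Suc n)" "derived L n"]
      br_in_bracket[of _ "derived L (Suc n)" _ "derived L (Suc n)"]
    by (auto simp: subalgebra_def subspace_bracket)
qed simp

text \<open>A derived term of least dimension equals its successor, so it is perfect and
  \<open>cartan_perfect\<close> applies to it.\<close>

lemma cartan_criterion:
  assumes L: "subalgebra L" and r: "rep_on L r"
    and tr0: "\<And>a b. a \<in> L \<Longrightarrow> b \<in> L \<Longrightarrow> tr (\<lambda>v. r a (r b v)) = 0"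
  shows "\<exists>n. \<forall>x\<in>derived L n. \<forall>v. r x v = 0"
proof -
  obtain n where n: "\<And>m. dim (derived L n) \<le> dim (derived L m)"
    using ex_has_least_nat[of "\<lambda>_. True" 0 "\<lambda>n. dim (derived L n)"] by auto
  let ?D = "derived L n"
  note D = derived_subalgebra[OF L, of n] and DS = derived_subalgebra[OF L, of "Suc n"]
  have sub: "derived L (Suc n) \<subseteq> ?D" using derived_subset[OF D, of 1] by simp
  have "derived L (Suc n) = ?D"
    by (rule subspace_dim_equal[OF subalgebraD(1)[OF DS] subalgebraD(1)[OF D] sub n])
  then have perf: "bracket ?D ?D = ?D" by simp
  have DL: "?D \<subseteq> L" by (rule derived_subset[OF L])
  have "r x v = 0" if "x \<in> ?D" for x v
    by (rule cartan_perfect[OF D rep_on_subset[OF r DL] perf _ that]) (use tr0 DL in blast)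
  then show ?thesis by blast
qed

end

section \<open>Dual bases for a symmetric bilinear form\<close>

context complex_fd_space begin

text \<open>Extending \<open>f\<close> by the identity on a complement of \<open>J\<close> gives an
  injective, hence surjective, endomorphism of the whole space.\<close>

lemma lin_inj_on_subspace_surj:
  assumes f: "lin f" and J: "subspace J" and fJ: "\<And>x. x \<in> J \<Longrightarrow> f x \<in> J"
    and inj: "\<And>x. x \<in> J \<Longrightarrow> f x = 0 \<Longrightarrow> x = 0" and y: "y \<in> J"
  shows "\<exists>x\<in>J. f x = y"
proof -
  obtain p where p: "lin p" "\<And>v. p v \<in> J" "\<And>v. v \<in> J \<Longrightarrow> v - p v \<in> {0}"
    using subquotient_projection[of "{0}" J] J subspace_0[OF J]
    by (metis empty_subsetI insert_subset subspace_single_0)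
  have pJ: "p v = v" if "v \<in> J" for v using p(3)[OF that] by simp
  define g where "g x = f (p x) + (x - p x)" for x
  have lg: "lin g" unfolding g_def
    by (intro lin_fun_add lin_fun_diff lin_id lin_comp[OF f p(1)] p(1))
  have pg: "p (g x) = f (p x)" for x
    using fJ[OF p(2)[of x]] p(2)[of x] by (simp add: g_def lin_simps[OF p(1)] pJ)
  have "g x = 0 \<Longrightarrow> x = 0" for x
  proof -
    assume gx: "g x = 0"
    then have "f (p x) = 0" using pg[of x] by (simp add: lin_0[OF p(1)])
    then have "p x = 0" using inj[OF p(2)] by blast
    then show "x = 0" using gx by (simp add: g_def lin_0[OF f])
  qed
  then have "inj g"
    by (intro injI) (metis lin_diff[OF lg] eq_iff_diff_eq_0)
  then have "surj g" using linear_inj_imp_surj lg by blast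
  then obtain x where "y = g x" by (rule surjE)
  then have "f (p x) = y" using pg[of x] pJ[OF y] by simp
  then show ?thesis using p(2) by blast
qed

text \<open>By nondegeneracy the map sending \<open>x\<close> to the sum of the
  \<open>\<beta> x b\<close> times \<open>b\<close> is injective on \<open>J\<close>, hence onto;
  \<open>d b\<close> is a preimage of \<open>b\<close>.\<close>

lemma dual_basis:
  fixes \<beta> :: "'a \<Rightarrow> 'a \<Rightarrow> complex"
  assumes J: "subspace J"
    and add: "\<And>a b c. \<beta> (a + b) c = \<beta> a c + \<beta> b c" and scale: "\<And>t a b. \<beta> (scale t a) b = t * \<beta> a b"
    and sym: "\<And>a b. \<beta> a b = \<beta> b a"
    and nondeg: "\<And>x. x \<in> J \<Longrightarrow> (\<And>y. y \<in> J \<Longrightarrow> \<beta> x y = 0) \<Longrightarrow> x = 0"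
  obtains B d where "finite B" "B \<subseteq> J" "\<And>b. b \<in> B \<Longrightarrow> d b \<in> J" "J \<noteq> {0} \<Longrightarrow> B \<noteq> {}"
    "\<And>b. b \<in> B \<Longrightarrow> \<beta> b (d b) = 1"
    "\<And>z. z \<in> J \<Longrightarrow> z = (\<Sum>b\<in>B. scale (\<beta> z (d b)) b)"
    "\<And>z. z \<in> J \<Longrightarrow> z = (\<Sum>b\<in>B. scale (\<beta> z b) (d b))"
proof -
  obtain B where B: "B \<subseteq> J" "independent B" "J \<subseteq> span B" by (rule maximal_independent_subset)
  have fin: "finite B" using B(2) by (rule finiteI_independent)
  have zero: "\<beta> 0 c = 0" for c using scale[of 0 0 c] by simp
  have sums: "\<beta> (sum h A) c = (\<Sum>i\<in>A. \<beta> (h i) c)" for h and A :: "'a set" and c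
    by (induction A rule: infinite_finite_induct) (simp_all add: add zero)
  have span0: "x = 0" if x: "x \<in> J" "\<And>b. b \<in> B \<Longrightarrow> \<beta> x b = 0" for x
  proof (rule nondeg[OF x(1)])
    fix y assume "y \<in> J"
    then have "y \<in> span B" using B(3) by blast
    then show "\<beta> x y = 0"
      by (induction rule: span_induct_alt)
        (simp_all add: sym[of x] add scale zero x(2)[unfolded sym[of x]])
  qed
  define \<phi> where "\<phi> x = (\<Sum>b\<in>B. scale (\<beta> x b) b)" for x
  have l\<phi>: "lin \<phi>"
    unfolding \<phi>_def by (rule linI) (simp_all add: add scale scale_left_distrib sum.distrib scale_sum_right)
  have "\<phi> x \<in> J" for x
    unfolding \<phi>_def using B(1) J by (intro subspace_sum subspace_scale) auto
  moreover have "x = 0" if "x \<in> J" "\<phi> x = 0" for x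
    using independentD[OF B(2) fin subset_refl] that unfolding \<phi>_def by (intro span0) blast+
  ultimately have "\<exists>x\<in>J. \<phi> x = b" if "b \<in> B" for b
    using lin_inj_on_subspace_surj[OF l\<phi> J, of b] that B(1) by blast
  then have "\<forall>b\<in>B. \<exists>x. x \<in> J \<and> \<phi> x = b" by blast
  then obtain d where "\<forall>b\<in>B. d b \<in> J \<and> \<phi> (d b) = b" by (rule bchoice[THEN exE])
  then have d: "\<And>b. b \<in> B \<Longrightarrow> d b \<in> J" "\<And>b. b \<in> B \<Longrightarrow> \<phi> (d b) = b" by auto
  have \<beta>d: "\<beta> (d b) c = (if c = b then 1 else 0)" if "b \<in> B" "c \<in> B" for b c
  proof -
    have "(\<Sum>e\<in>B. scale (\<beta> (d b) e - (if e = b then 1 else 0)) e) = \<phi> (d b) - (\<Sum>e\<in>B. if e = b then e else 0)"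
      unfolding \<phi>_def sum_subtractf[symmetric]
      by (intro sum.cong) (simp_all add: scale_left_diff_distrib)
    also have "\<dots> = 0" using fin that d(2) by simp
    finally show ?thesis
      using independentD[OF B(2) fin subset_refl _ that(2)] by fastforce
  qed
  have e1: "z = (\<Sum>b\<in>B. scale (\<beta> z (d b)) b)" if z: "z \<in> J" for z
  proof -
    have "z = (\<Sum>b\<in>B. scale (representation B z b) b)"
      using rep_sum[OF B(2), of z] B(3) z by auto
    moreover have "\<beta> z (d b) = representation B z b" if "b \<in> B" for b
    proof -
      have "\<beta> z (d b) = (\<Sum>c\<in>B. representation B z c * (if c = b then 1 else 0))"
        by (subst calculation) (simp add: sums scale \<beta>d[OF \<open>b \<in> B\<close>, unfolded sym[of "d b"]])
      then show ?thesis using fin that by (simp add: if_distrib[of "\<lambda>x. _ * x"] cong: if_cong)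
    qed
    ultimately show ?thesis by simp
  qed
  have e2: "z = (\<Sum>b\<in>B. scale (\<beta> z b) (d b))" if z: "z \<in> J" for z
  proof -
    let ?y = "\<Sum>b\<in>B. scale (\<beta> z b) (d b)"
    have "?y \<in> J" using d(1) J by (intro subspace_sum subspace_scale)
    then have yJ: "z - ?y \<in> J" using z J by (intro subspace_diff)
    have "\<beta> ?y c = \<beta> z c" if "c \<in> B" for c
    proof -
      have "\<beta> ?y c = (\<Sum>b\<in>B. \<beta> z b * (if c = b then 1 else 0))"
        by (simp add: sums scale \<beta>d that)
      then show ?thesis using fin that by (simp add: if_distrib[of "\<lambda>x. _ * x"] cong: if_cong)
    qed
    moreover have "\<beta> (z - ?y) c = \<beta> z c - \<beta> ?y c" for c
      using add[of "z - ?y" ?y c] by simp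
    ultimately have "z - ?y = 0" using span0[OF yJ] by simp
    then show ?thesis by simp
  qed
  have ne: "B \<noteq> {}" if "J \<noteq> {0}"
  proof
    assume "B = {}"
    then have "J \<subseteq> {0}" using B(3) by simp
    then show False using that subspace_0[OF J] by blast
  qed
  have one: "\<beta> b (d b) = 1" if "b \<in> B" for b
    using \<beta>d[OF that that] by (simp add: sym)
  show thesis by (rule that[OF fin B(1) d(1) ne one e1 e2])
qed

end

context fd_left_leibniz_algebra begin

subsection \<open>Semisimple Lie subalgebras\<close>

lemma ideal_ofD:
  assumes "ideal_of I L"
  shows "subspace I" "I \<subseteq> L" "a \<in> L \<Longrightarrow> b \<in> I \<Longrightarrow> br a b \<in> I" "a \<in> L \<Longrightarrow> b \<in> I \<Longrightarrow> br b a \<in> I"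
  using assms by (auto simp: ideal_of_def)

lemma semisimple_subalgebra: "semisimple_lie_subalgebra T \<Longrightarrow> subalgebra T"
  by (simp add: semisimple_lie_subalgebra_def lie_subalgebra_def)

lemma semisimple_antisym:
  assumes T: "semisimple_lie_subalgebra T" and xy: "x \<in> T" "y \<in> T"
  shows "br y x = - br x y"
proof -
  have sq: "br a a = 0" if "a \<in> T" for a
    using T that by (simp add: semisimple_lie_subalgebra_def lie_subalgebra_def)
  have "x + y \<in> T" using subspace_add[OF subalgebraD(1)[OF semisimple_subalgebra[OF T]]] xy by blast
  then have "br (x + y) (x + y) = 0" by (rule sq)
  then have "br x y + br y x = 0" by (simp add: br_add_left br_add_right sq xy add.commute)
  then show ?thesis by (simp add: add_eq_0_iff)
qed

lemma ideal_ofI: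
  assumes T: "semisimple_lie_subalgebra T" and J: "subspace J" "J \<subseteq> T"
    and l: "\<And>t x. t \<in> T \<Longrightarrow> x \<in> J \<Longrightarrow> br t x \<in> J"
  shows "ideal_of J T"
proof -
  have "br x t \<in> J" if "t \<in> T" "x \<in> J" for t x
    using semisimple_antisym[OF T, of t x] subspace_neg[OF J(1) l[OF that]] that J(2) by auto
  then show ?thesis using J l by (auto simp: ideal_of_def)
qed

lemma semisimple_solvable_ideal:
  assumes T: "semisimple_lie_subalgebra T" and J: "ideal_of J T" "solvable J"
  shows "J = {0}"
proof -
  have "\<exists>!I. maximal_solvable_ideal I T"
    by (rule maximal_solvable_ideal_unique_exists[OF semisimple_subalgebra[OF T]])
  then have "maximal_solvable_ideal (solvable_radical T) T"
    unfolding solvable_radical_def by (rule theI')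
  then have "maximal_solvable_ideal {0} T" using T by (simp add: semisimple_lie_subalgebra_def)
  then show ?thesis
    using J subspace_0[OF ideal_ofD(1)[OF J(1)]] unfolding maximal_solvable_ideal_def by blast
qed

lemma semisimple_abelian_ideal:
  assumes T: "semisimple_lie_subalgebra T" and J: "ideal_of J T"
    and ab: "\<And>a b. a \<in> J \<Longrightarrow> b \<in> J \<Longrightarrow> br a b = 0"
  shows "J = {0}"
proof -
  have "bracket J J \<subseteq> {0}" using ab by (intro bracket_minimal) auto
  then have "derived J 1 = {0}" using subspace_0[OF subspace_bracket] by auto
  then show ?thesis using semisimple_solvable_ideal[OF T J] unfolding solvable_def by blast
qed

definition trace_form :: "('a \<Rightarrow> 'a \<Rightarrow> 'a) \<Rightarrow> 'a \<Rightarrow> 'a \<Rightarrow> complex" where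
  "trace_form r a b = tr (\<lambda>v. r a (r b v))"

lemma trace_form_simps:
  assumes r: "rep_on L r"
  shows "trace_form r (a + b) c = trace_form r a c + trace_form r b c"
    "trace_form r (scale t a) b = t * trace_form r a b"
    "trace_form r a b = trace_form r b a"
  using tr_cyclic[OF rep_onD(1)[OF r, of a] rep_onD(1)[OF r, of b]]
  by (simp_all add: trace_form_def lin_simps[OF rep_onD(2)[OF r]] tr_add tr_scale)

lemma trace_form_invariant:
  assumes r: "rep_on L r" and L: "t \<in> L" "a \<in> L" "b \<in> L"
  shows "trace_form r (br t a) b = - trace_form r a (br t b)"
proof -
  note rl = rep_onD[OF r]
  have "tr (\<lambda>v. r t (r a (r b v))) = tr (\<lambda>v. r a (r b (r t v)))"
    by (rule tr_cyclic[OF rl(1) lin_comp[OF rl(1) rl(1)]])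
  then show ?thesis
    by (simp add: trace_form_def rl(3) L tr_diff lin_simps[OF rl(1)])
qed

text \<open>The radical of the form on \<open>J\<close> is an ideal of \<open>T\<close> by
  invariance. By Cartan's criterion one of its derived terms acts as zero and so is zero by
  faithfulness; a solvable ideal of \<open>T\<close> vanishes.\<close>

lemma trace_form_nondegenerate:
  assumes T: "semisimple_lie_subalgebra T" and r: "rep_on T r" and J: "ideal_of J T"
    and faithful: "\<And>x. x \<in> J \<Longrightarrow> (\<And>v. r x v = 0) \<Longrightarrow> x = 0"
    and x: "x \<in> J" "\<And>y. y \<in> J \<Longrightarrow> trace_form r x y = 0"
  shows "x = 0"
proof -
  note Jd = ideal_ofD[OF J]
  note tf = trace_form_simps[OF r]
  let ?R = "{x\<in>J. \<forall>y\<in>J. trace_form r x y = 0}"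
  have tf0: "trace_form r 0 y = 0" for y using tf(2)[of 0 0 y] by simp
  have R: "ideal_of ?R T"
  proof (rule ideal_ofI[OF T])
    show "subspace ?R"
      using Jd(1) by (auto simp: subspace_def tf(1,2) tf0)
    fix t x assume t: "t \<in> T" and x: "x \<in> ?R"
    have "trace_form r (br t x) y = 0" if y: "y \<in> J" for y
      using trace_form_invariant[OF r t, of x y] x y Jd(2) Jd(3)[OF t y] by auto
    then show "br t x \<in> ?R" using Jd(3)[OF t, of x] x by simp
  qed (use Jd(2) in auto)
  note RT = ideal_ofD(2)[OF R]
  obtain n where n: "\<forall>x\<in>derived ?R n. \<forall>v. r x v = 0"
    using cartan_criterion[OF ideal_subalgebra[OF R] rep_on_subset[OF r RT]]
    by (auto simp: trace_form_def)
  have "derived ?R n \<subseteq> ?R" by (rule derived_subset[OF ideal_subalgebra[OF R]])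
  then have "derived ?R n \<subseteq> {0}" using n faithful by blast
  then have "derived ?R n = {0}" using zero_in_derived[OF ideal_ofD(1)[OF R], of n] by blast
  then have "?R = {0}" using semisimple_solvable_ideal[OF T R] unfolding solvable_def by blast
  then show ?thesis using x by blast
qed

text \<open>An element acting as zero is central in \<open>T\<close>, and the center is an abelian
  ideal.\<close>

lemma semisimple_faithful:
  assumes T: "semisimple_lie_subalgebra T" and x: "x \<in> T" "\<And>v. br x v = 0"
  shows "x = 0"
proof -
  note sT = semisimple_subalgebra[OF T]
  let ?Z = "{x\<in>T. \<forall>y\<in>T. br x y = 0}"
  have "ideal_of ?Z T"
  proof (rule ideal_ofI[OF T])
    show "subspace ?Z"
      using subalgebraD(1)[OF sT] by (auto simp: subspace_def br_simps)
    fix t x assume t: "t \<in> T" and x: "x \<in> ?Z"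
    then have "br t x = 0" using semisimple_antisym[OF T, of x t] by simp
    then show "br t x \<in> ?Z" using subspace_0[OF subalgebraD(1)[OF sT]] by (simp add: br_0_left)
  qed auto
  then have "?Z = {0}" by (rule semisimple_abelian_ideal[OF T]) auto
  then show ?thesis using x by blast
qed

text \<open>\<open>J\<close> is the orthogonal complement of \<open>I\<close> for the trace form of
  \<open>T\<close> acting on all of \<open>M\<close>, not for the Killing form of \<open>T\<close>.
  By faithfulness the form is nondegenerate on \<open>I\<close>, whence orthogonal projection onto
  \<open>I\<close> exists.\<close>

lemma semisimple_complement:
  assumes T: "semisimple_lie_subalgebra T" and I: "ideal_of I T"
  obtains J where "ideal_of J T" "I \<inter> J = {0}" "\<And>t. t \<in> T \<Longrightarrow> \<exists>i\<in>I. t - i \<in> J"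
proof -
  note Id = ideal_ofD[OF I]
  note tf = trace_form_simps[OF rep_on_br[of T]]
  let ?k = "trace_form br"
  let ?J = "{x\<in>T. \<forall>y\<in>I. ?k x y = 0}"
  note sT = subalgebraD(1)[OF semisimple_subalgebra[OF T]]
  have tf0: "?k 0 y = 0" for y using tf(2)[of 0 0 y] by simp
  have nd: "x = 0" if "x \<in> I" "\<And>y. y \<in> I \<Longrightarrow> ?k x y = 0" for x
    by (rule trace_form_nondegenerate[OF T rep_on_br I _ that])
      (use semisimple_faithful[OF T] Id(2) in blast)+
  obtain B d where B: "finite B" "B \<subseteq> I" "\<And>b. b \<in> B \<Longrightarrow> d b \<in> I"
    "\<And>z. z \<in> I \<Longrightarrow> z = (\<Sum>b\<in>B. scale (?k z (d b)) b)"
    "\<And>z. z \<in> I \<Longrightarrow> z = (\<Sum>b\<in>B. scale (?k z b) (d b))"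
    by (rule dual_basis[of I ?k, OF Id(1) tf nd]) blast+
  have J: "ideal_of ?J T"
  proof (rule ideal_ofI[OF T])
    show "subspace ?J"
      using sT by (auto simp: subspace_def tf(1,2) tf0)
    fix t x assume t: "t \<in> T" and x: "x \<in> ?J"
    have "?k (br t x) y = 0" if y: "y \<in> I" for y
      using trace_form_invariant[OF rep_on_br t, of x y] x y Id(2) Id(3)[OF t y] by auto
    then show "br t x \<in> ?J" using subalgebraD(2)[OF semisimple_subalgebra[OF T] t, of x] x by simp
  qed auto
  have IJ: "I \<inter> ?J = {0}"
    using nd subspace_0[OF Id(1)] subspace_0[OF ideal_ofD(1)[OF J]] by blast
  have sum: "\<exists>i\<in>I. t - i \<in> ?J" if t: "t \<in> T" for t
  proof -
    have ksum: "?k (sum h A) c = (\<Sum>i\<in>A. ?k (h i) c)" for h and A :: "'a set" and c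
      by (induction A rule: infinite_finite_induct) (simp_all add: tf(1) tf0)
    \<comment> \<open>The orthogonal projection of \<open>t\<close> onto \<open>I\<close>, written
      in the dual basis.\<close>
    let ?i = "\<Sum>b\<in>B. scale (?k t b) (d b)"
    have i: "?i \<in> I" using B(3) Id(1) by (intro subspace_sum subspace_scale)
    have "?k (t - ?i) y = 0" if y: "y \<in> I" for y
    proof -
      have ks: "?k a (sum h A) = (\<Sum>i\<in>A. ?k a (h i))" for a h and A :: "'a set"
        using ksum[of h A a] by (simp add: tf(3)[of a])
      have "?k t y = (\<Sum>b\<in>B. ?k y (d b) * ?k t b)"
        by (subst B(4)[OF y]) (simp add: ks tf(2) tf(3)[of t])
      moreover have "?k ?i y = (\<Sum>b\<in>B. ?k t b * ?k (d b) y)"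
        by (simp add: ksum tf(2))
      moreover have "?k (t - ?i) y + ?k ?i y = ?k t y"
        using tf(1)[of "t - ?i" ?i y] by simp
      ultimately show ?thesis by (simp add: tf(3)[of y] mult.commute)
    qed
    then have "t - ?i \<in> ?J" using t i Id(2) subspace_diff[OF sT] by auto
    then show ?thesis using i by blast
  qed
  show thesis by (rule that[OF J IJ sum])
qed

text \<open>A complementary ideal of \<open>[T, T]\<close> has its products in both summands, so it
  is abelian and therefore zero.\<close>

lemma semisimple_perfect:
  assumes T: "semisimple_lie_subalgebra T"
  shows "bracket T T = T"
proof -
  note sT = semisimple_subalgebra[OF T]
  have sub: "bracket T T \<subseteq> T" using derived_subset[OF sT, of 1] by simp
  have I: "ideal_of (bracket T T) T"
    by (rule ideal_ofI[OF T subspace_bracket sub]) (use sub br_in_bracket in blast)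
  obtain J where J: "ideal_of J T" "bracket T T \<inter> J = {0}" "\<And>t. t \<in> T \<Longrightarrow> \<exists>i\<in>bracket T T. t - i \<in> J"
    using semisimple_complement[OF T I] by blast
  have "br a b = 0" if "a \<in> J" "b \<in> J" for a b
    using that J(2) ideal_ofD[OF J(1)] br_in_bracket[of a T b T] by blast
  then have "J = {0}" by (rule semisimple_abelian_ideal[OF T J(1)])
  then have "T \<subseteq> bracket T T" using J(3) by force
  then show ?thesis using sub by blast
qed

subsection \<open>Whitehead's first lemma\<close>

text \<open>This is \<open>T\<close>-invariance of the Casimir tensor, the sum of \<open>b\<close>
  tensor \<open>d b\<close>, tested on an arbitrary bilinear map \<open>g\<close>. In the dual bases
  the two halves have opposite coefficients because the trace form is invariant.\<close>

lemma invariant_tensor: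
  assumes r: "rep_on T r" and T: "subalgebra T" and J: "ideal_of J T"
    and B: "finite B" "B \<subseteq> J" "\<And>b. b \<in> B \<Longrightarrow> d b \<in> J"
    and e1: "\<And>z. z \<in> J \<Longrightarrow> z = (\<Sum>b\<in>B. scale (trace_form r z (d b)) b)"
    and e2: "\<And>z. z \<in> J \<Longrightarrow> z = (\<Sum>b\<in>B. scale (trace_form r z b) (d b))"
    and g: "\<And>u. lin (g u)" "\<And>v. lin (\<lambda>u. g u v)" and x: "x \<in> T"
  shows "(\<Sum>b\<in>B. g (br x b) (d b) + g b (br x (d b))) = 0"
proof -
  note Jd = ideal_ofD[OF J]
  let ?k = "trace_form r"
  have 1: "g (br x b) (d b) = (\<Sum>c\<in>B. scale (?k (br x b) (d c)) (g c (d b)))" if "b \<in> B" for b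
    by (subst e1[of "br x b"]) (use Jd(3)[OF x] B(2) that in \<open>auto simp: lin_simps[OF g(2)]\<close>)
  have 2: "g b (br x (d b)) = (\<Sum>c\<in>B. scale (?k (br x (d b)) c) (g b (d c)))" if "b \<in> B" for b
    by (subst e2[of "br x (d b)"]) (use Jd(3)[OF x] B(3) that in \<open>auto simp: lin_simps[OF g(1)]\<close>)
  have 3: "?k (br x (d b)) c = - ?k (br x c) (d b)" if "b \<in> B" "c \<in> B" for b c
    using trace_form_invariant[OF r x, of "d b" c] trace_form_simps(3)[OF r] B(2) B(3)[OF that(1)] Jd(2) that
    by (metis subsetD)
  have "(\<Sum>b\<in>B. g b (br x (d b))) = (\<Sum>b\<in>B. \<Sum>c\<in>B. scale (- ?k (br x c) (d b)) (g b (d c)))"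
    using 2 3 by simp
  also have "\<dots> = (\<Sum>c\<in>B. \<Sum>b\<in>B. scale (- ?k (br x c) (d b)) (g b (d c)))"
    by (rule sum.swap)
  also have "\<dots> = - (\<Sum>b\<in>B. g (br x b) (d b))"
    using 1 by (simp add: sum_negf)
  finally show ?thesis by (simp add: sum.distrib)
qed

text \<open>\<open>r\<close> is an action on \<open>E\<close> extended to the ambient space through
  \<open>p\<close>, so ambient traces are those on \<open>E\<close>. If \<open>J = {0}\<close>,
  \<open>f\<close> kills \<open>[T, T] = T\<close>. Otherwise the Casimir operator \<open>c\<close>
  of \<open>J\<close> commutes with \<open>T\<close> and has nonzero trace \<open>card B\<close>; by
  irreducibility it is invertible on \<open>E\<close>, and \<open>w\<close> solves
  \<open>c w = w0\<close>.\<close>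

lemma whitehead_irreducible:
  assumes T: "semisimple_lie_subalgebra T" and r: "rep_on T r" and f: "lin f"
    and cocycle: "\<And>s t. s \<in> T \<Longrightarrow> t \<in> T \<Longrightarrow> f (br s t) = r s (f t) - r t (f s)"
    and E: "subspace E" "\<And>t. t \<in> T \<Longrightarrow> f t \<in> E" "\<And>t v. r t v \<in> E"
    and p: "\<And>v. p v \<in> E" "\<And>t v. r t (p v) = r t v"
    and irr: "\<And>Z. subspace Z \<Longrightarrow> Z \<subseteq> E \<Longrightarrow> (\<And>t z. t \<in> T \<Longrightarrow> z \<in> Z \<Longrightarrow> r t z \<in> Z) \<Longrightarrow> Z = {0} \<or> Z = E"
  shows "\<exists>w\<in>E. \<forall>t\<in>T. f t = r t w"
proof -
  note rl = rep_onD[OF r]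
  note sT = semisimple_subalgebra[OF T]
  let ?I = "{x\<in>T. \<forall>v. r x v = 0}"
  have I: "ideal_of ?I T"
    by (rule ideal_ofI[OF T rep_kernel_ideal(1)[OF sT r] _ rep_kernel_ideal(2)[OF sT r]]) auto
  obtain J where J: "ideal_of J T" "?I \<inter> J = {0}" "\<And>t. t \<in> T \<Longrightarrow> \<exists>i\<in>?I. t - i \<in> J"
    using semisimple_complement[OF T I] by blast
  note Jd = ideal_ofD[OF J(1)]
  show ?thesis
  proof (cases "J = {0}")
    case True
    then have T0: "r t v = 0" if "t \<in> T" for t v using J(3)[OF that] by force
    have "bracket T T \<subseteq> {t. f t = 0}"
      using cocycle T0 by (intro bracket_minimal) (auto simp: subspace_def lin_simps[OF f])
    then have "f t = 0" if "t \<in> T" for t using semisimple_perfect[OF T] that by blast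
    then show ?thesis using T0 subspace_0[OF E(1)] by (intro bexI[of _ 0]) auto
  next
    case False
    have nd: "x = 0" if x: "x \<in> J" "\<And>y. y \<in> J \<Longrightarrow> trace_form r x y = 0" for x
      by (rule trace_form_nondegenerate[OF T r J(1) _ x]) (use J(2) Jd(2) in blast)
    obtain B d where B: "finite B" "B \<subseteq> J" "\<And>b. b \<in> B \<Longrightarrow> d b \<in> J" "B \<noteq> {}"
      "\<And>b. b \<in> B \<Longrightarrow> trace_form r b (d b) = 1"
      "\<And>z. z \<in> J \<Longrightarrow> z = (\<Sum>b\<in>B. scale (trace_form r z (d b)) b)"
      "\<And>z. z \<in> J \<Longrightarrow> z = (\<Sum>b\<in>B. scale (trace_form r z b) (d b))"
      by (rule dual_basis[of J "trace_form r", OF Jd(1) trace_form_simps[OF r] nd]) (use False in blast)+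
    have inv: "(\<Sum>b\<in>B. g (br x b) (d b) + g b (br x (d b))) = 0"
      if "\<And>u. lin (g u)" "\<And>v. lin (\<lambda>u. g u v)" "x \<in> T" for g :: "'a \<Rightarrow> 'a \<Rightarrow> 'a" and x
      by (rule invariant_tensor[OF r sT J(1)]; fact)
    have BT: "b \<in> T" "d b \<in> T" if "b \<in> B" for b using that B(2,3) Jd(2) by auto
    define c where "c v = (\<Sum>b\<in>B. r b (r (d b) v))" for v
    have lc: "lin c" unfolding c_def by (intro lin_fun_sum lin_comp[OF rl(1) rl(1)])
    have trc: "tr c = of_nat (card B)"
      unfolding c_def tr_sum using B(5) by (simp add: trace_form_def)
    have commute: "r x (c v) = c (r x v)" if x: "x \<in> T" for x v
    proof -
      have "r x (c v) - c (r x v) = (\<Sum>b\<in>B. r (br x b) (r (d b) v) + r b (r (br x (d b)) v))"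
        unfolding c_def lin_sum[OF rl(1)] sum_subtractf[symmetric]
        by (intro sum.cong) (simp_all add: rl(3) BT x lin_simps[OF rl(1)] algebra_simps)
      also have "\<dots> = 0"
        by (rule inv[of "\<lambda>u w. r u (r w v)", OF lin_comp[OF rl(1) rl(2)[of v]] rl(2) x])
      finally show ?thesis by simp
    qed
    \<comment> \<open>The Casimir tensor with its second factor passed through \<open>f\<close>. If
      \<open>f\<close> were \<open>r x u\<close> in \<open>x\<close>, this would be
      \<open>c u\<close>; the cocycle rule and invariance give \<open>r x w0 = c (f x)\<close> in
      general.\<close>
    define w0 where "w0 = (\<Sum>b\<in>B. r b (f (d b)))"
    have w0: "r x w0 = c (f x)" if x: "x \<in> T" for x
    proof -
      have "r x w0 - c (f x) = (\<Sum>b\<in>B. r (br x b) (f (d b)) + r b (f (br x (d b))))"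
        unfolding w0_def c_def lin_sum[OF rl(1)] sum_subtractf[symmetric]
        by (intro sum.cong) (simp_all add: rl(3) BT x cocycle lin_simps[OF rl(1)] algebra_simps)
      also have "\<dots> = 0"
        by (rule inv[of "\<lambda>u w. r u (f w)", OF lin_comp[OF rl(1) f] rl(2) x])
      finally show ?thesis by simp
    qed
    have w0E: "w0 \<in> E" unfolding w0_def using E by (intro subspace_sum) auto
    have cE: "c v \<in> E" for v unfolding c_def using E by (intro subspace_sum) auto
    let ?Z = "{v\<in>E. c v = 0}"
    have sZ: "subspace ?Z" using E(1) by (auto simp: subspace_def lin_simps[OF lc])
    have "r t z \<in> ?Z" if "t \<in> T" "z \<in> ?Z" for t z
      using commute[OF that(1), of z] that(2) E(3) by (simp add: lin_simps[OF rl(1)])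
    then have "?Z = {0} \<or> ?Z = E" using irr[OF sZ] by blast
    moreover have "?Z \<noteq> E"
    proof
      assume "?Z = E"
      then have "c (p v) = 0" for v using p(1) by blast
      then have "c v = 0" for v unfolding c_def by (simp add: p(2))
      then have "c = (\<lambda>v. 0)" by (rule ext)
      then have "of_nat (card B) = (0::complex)" using trc by (simp add: tr_zero)
      then show False using B(1,4) by simp
    qed
    ultimately have Z: "?Z = {0}" by blast
    obtain w where w: "w \<in> E" "c w = w0"
      using lin_inj_on_subspace_surj[OF lc E(1) cE _ w0E] Z by blast
    have "f t = r t w" if t: "t \<in> T" for t
    proof -
      have "c (f t - r t w) = 0"
        using w0[OF t] commute[OF t, of w] w(2) by (simp add: lin_simps[OF lc])
      moreover have "f t - r t w \<in> E" using subspace_diff[OF E(1) E(2)[OF t] E(3)] .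
      ultimately have "f t - r t w \<in> ?Z" by simp
      then show ?thesis unfolding Z by simp
    qed
    then show ?thesis using w(1) by blast
  qed
qed

text \<open>Compression by \<open>p\<close> carries the action on \<open>V / U\<close> to the range
  of \<open>p\<close>: \<open>v\<close> and \<open>p v\<close> differ by an element of
  \<open>U\<close>, which stays in \<open>U\<close> and is then killed by \<open>p\<close>.\<close>

lemma subquotient_rep:
  assumes r: "rep_on L r"
    and Ui: "\<And>t u. t \<in> L \<Longrightarrow> u \<in> U \<Longrightarrow> r t u \<in> U" and Vi: "\<And>t v. t \<in> L \<Longrightarrow> v \<in> V \<Longrightarrow> r t v \<in> V"
    and p: "lin p" "\<And>v. p v \<in> V" "\<And>u. u \<in> U \<Longrightarrow> p u = 0"
      "\<And>v. v \<in> V \<Longrightarrow> v - p v \<in> U" "\<And>v. p (p v) = p v"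
  shows "t \<in> L \<Longrightarrow> v \<in> V \<Longrightarrow> p (r t (p v)) = p (r t v)"
    and "rep_on L (\<lambda>t v. p (r t (p v)))"
proof -
  note rl = rep_onD[OF r]
  have prp: "p (r t (p v)) = p (r t v)" if t: "t \<in> L" and v: "v \<in> V" for t v
    using p(3)[OF Ui[OF t p(4)[OF v]]] by (simp add: lin_simps[OF rl(1)] lin_simps[OF p(1)])
  then show "t \<in> L \<Longrightarrow> v \<in> V \<Longrightarrow> p (r t (p v)) = p (r t v)" .
  let ?r = "\<lambda>t v. p (r t (p v))"
  show "rep_on L ?r"
    unfolding rep_on_def
  proof (intro conjI allI ballI)
    show "lin (?r a)" for a by (rule lin_comp[OF p(1) lin_comp[OF rl(1) p(1)]])
    show "lin (\<lambda>a. ?r a v)" for v by (rule lin_comp[OF p(1) rl(2)])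
    fix a b v assume ab: "a \<in> L" "b \<in> L"
    show "?r (br a b) v = ?r a (?r b v) - ?r b (?r a v)"
      using prp[OF ab(1) Vi[OF ab(2) p(2)[of v]]] prp[OF ab(2) Vi[OF ab(1) p(2)[of v]]]
      by (simp add: rl(3)[OF ab] lin_simps[OF p(1)] p(5))
  qed
qed

lemma whitehead:
  assumes T: "semisimple_lie_subalgebra T" and r: "rep_on T r"
    and "subspace U" "subspace V" "U \<subseteq> V"
    and "\<And>t u. t \<in> T \<Longrightarrow> u \<in> U \<Longrightarrow> r t u \<in> U" "\<And>t v. t \<in> T \<Longrightarrow> v \<in> V \<Longrightarrow> r t v \<in> V"
    and "lin f" "\<And>t. t \<in> T \<Longrightarrow> f t \<in> V"
    and "\<And>s t. s \<in> T \<Longrightarrow> t \<in> T \<Longrightarrow> f (br s t) - (r s (f t) - r t (f s)) \<in> U"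
  shows "\<exists>w\<in>V. \<forall>t\<in>T. f t - r t w \<in> U"
  using assms(3-)
proof (induction "dim V - dim U" arbitrary: U V f rule: less_induct)
  case (less U V f)
  note rl = rep_onD[OF r]
  note sU = less.prems(1) and sV = less.prems(2) and UV = less.prems(3)
    and Ui = less.prems(4) and Vi = less.prems(5)
    and f = less.prems(6) and fV = less.prems(7) and co = less.prems(8)
  show ?case
  proof (cases "\<exists>Z. subspace Z \<and> U \<subset> Z \<and> Z \<subset> V \<and> (\<forall>t\<in>T. \<forall>z\<in>Z. r t z \<in> Z)")
    case True
    then obtain Z where Z: "subspace Z" "U \<subset> Z" "Z \<subset> V" and "\<forall>t\<in>T. \<forall>z\<in>Z. r t z \<in> Z" by blast
    then have Zi: "\<And>t z. t \<in> T \<Longrightarrow> z \<in> Z \<Longrightarrow> r t z \<in> Z" by blast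
    have UZ: "U \<subseteq> Z" and ZV: "Z \<subseteq> V" using Z by auto
    have d1: "dim U < dim Z" by (rule subspace_dim_less[OF sU Z(1,2)])
    have d2: "dim Z < dim V" by (rule subspace_dim_less[OF Z(1) sV Z(3)])
    have "dim V - dim Z < dim V - dim U" using d1 d2 by simp
    from less.hyps[OF this Z(1) sV ZV Zi Vi f fV] co UZ
    obtain w1 where w1: "w1 \<in> V" "\<And>t. t \<in> T \<Longrightarrow> f t - r t w1 \<in> Z" by blast
    let ?f = "\<lambda>t. f t - r t w1"
    have lf: "lin ?f" by (rule lin_fun_diff[OF f rl(2)])
    have co': "?f (br s t) - (r s (?f t) - r t (?f s)) \<in> U" if st: "s \<in> T" "t \<in> T" for s t
    proof -
      have "?f (br s t) - (r s (?f t) - r t (?f s)) = f (br s t) - (r s (f t) - r t (f s))"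
        by (simp add: rl(3) st lin_simps[OF rl(1)])
      then show ?thesis using co[OF st] by (simp only:)
    qed
    have "dim Z - dim U < dim V - dim U" using d1 d2 by simp
    from less.hyps[OF this sU Z(1) UZ Ui Zi lf w1(2) co']
    obtain w2 where w2: "w2 \<in> Z" "\<And>t. t \<in> T \<Longrightarrow> ?f t - r t w2 \<in> U" by blast
    have "f t - r t (w1 + w2) \<in> U" if "t \<in> T" for t
      using w2(2)[OF that] by (simp add: lin_simps[OF rl(1)] algebra_simps)
    moreover have "w1 + w2 \<in> V" using subspace_add[OF sV w1(1)] w2(1) ZV by blast
    ultimately show ?thesis by blast
  next
    case False
    obtain p where p: "lin p" "\<And>v. p v \<in> V" "\<And>u. u \<in> U \<Longrightarrow> p u = 0"
      "\<And>v. v \<in> V \<Longrightarrow> v - p v \<in> U" "\<And>v. p (p v) = p v"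
      using subquotient_projection[OF sU sV UV] by metis
    have prp: "p (r t (p v)) = p (r t v)" if "t \<in> T" "v \<in> V" for t v
      by (rule subquotient_rep(1)[OF r]; fact)
    let ?r = "\<lambda>t v. p (r t (p v))"
    let ?E = "range p"
    have sE: "subspace ?E" by (rule subspace_lin_image[OF p(1) subspace_UNIV])
    have r': "rep_on T ?r" by (rule subquotient_rep(2)[OF r]; fact)
    have co': "p (f (br s t)) = ?r s (p (f t)) - ?r t (p (f s))" if st: "s \<in> T" "t \<in> T" for s t
      using p(3)[OF co[OF st]] prp[OF st(1) fV[OF st(2)]] prp[OF st(2) fV[OF st(1)]]
      by (simp add: lin_simps[OF p(1)] p(5))
    have irr: "Z = {0} \<or> Z = ?E"
      if Z: "subspace Z" "Z \<subseteq> ?E" "\<And>t z. t \<in> T \<Longrightarrow> z \<in> Z \<Longrightarrow> ?r t z \<in> Z" for Z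
    proof -
      let ?Z = "{v\<in>V. p v \<in> Z}"
      have "subspace ?Z"
        using sV Z(1) by (auto simp: subspace_def lin_simps[OF p(1)])
      moreover have UZ: "U \<subseteq> ?Z" using UV p(3) subspace_0[OF Z(1)] by auto
      moreover have "r t v \<in> ?Z" if tv: "t \<in> T" "v \<in> ?Z" for t v
        using Vi[OF tv(1), of v] Z(3)[OF tv(1), of "p v"] prp[OF tv(1), of v] tv(2)
        by (simp add: p(5))
      ultimately have "?Z = U \<or> ?Z = V" using False by blast
      then show ?thesis
      proof
        assume ZU: "?Z = U"
        have "z = 0" if z: "z \<in> Z" for z
        proof -
          have pz: "p z = z" using z Z(2) p(5) by blast
          then have "z \<in> ?Z" using z p(2)[of z] by simp
          then show ?thesis using p(3)[of z] pz ZU by simp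
        qed
        then show ?thesis using subspace_0[OF Z(1)] by blast
      next
        assume ZV: "?Z = V"
        have "p v \<in> Z" for v using p(2)[of v] p(5)[of v] ZV by (metis (mono_tags, lifting) mem_Collect_eq)
        then show ?thesis using Z(2) by blast
      qed
    qed
    have "\<exists>w\<in>?E. \<forall>t\<in>T. p (f t) = ?r t w"
      by (rule whitehead_irreducible[OF T r' lin_comp[OF p(1) f] co' sE _ _ _ _ irr, of p])
        (simp_all add: p(5))
    then obtain w where w: "w \<in> ?E" "\<And>t. t \<in> T \<Longrightarrow> p (f t) = ?r t w" by blast
    have pw: "p w = w" using w(1) p(5) by blast
    then have wV: "w \<in> V" using p(2)[of w] by simp
    have "f t - r t w \<in> U" if t: "t \<in> T" for t
    proof -
      have "f t - r t w \<in> V" using subspace_diff[OF sV fV[OF t] Vi[OF t wV]] .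
      moreover have "p (f t - r t w) = 0" using w(2)[OF t] by (simp add: lin_simps[OF p(1)] pw)
      ultimately show ?thesis using p(4)[of "f t - r t w"] by simp
    qed
    then show ?thesis using wV by blast
  qed
qed

subsection \<open>The bracket with a solvable ideal acts nilpotently\<close>

text \<open>Take a smallest \<open>Q\<close>-stable \<open>Z\<close> strictly above
  \<open>U\<close>. For \<open>q\<close> in \<open>Q\<close> the part of \<open>Z\<close> sent into
  \<open>U\<close> by \<open>q\<close> is \<open>Q\<close>-stable, as \<open>Q\<close> commutes
  modulo \<open>U\<close>, and exceeds \<open>U\<close>, as \<open>q\<close> is nilpotent; so it is
  all of \<open>Z\<close>.\<close>

lemma commuting_nilpotents:
  assumes r: "rep_on UNIV r" and U: "subspace U" "\<And>t u. u \<in> U \<Longrightarrow> r t u \<in> U"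
    and V: "subspace V" "U \<subset> V" "\<And>t v. v \<in> V \<Longrightarrow> r t v \<in> V"
    and nil: "\<And>q. q \<in> Q \<Longrightarrow> \<exists>k. \<forall>v\<in>V. (r q ^^ k) v \<in> U"
    and comm: "\<And>p q v. p \<in> Q \<Longrightarrow> q \<in> Q \<Longrightarrow> v \<in> V \<Longrightarrow> r (br p q) v \<in> U"
  shows "\<exists>v\<in>V. v \<notin> U \<and> (\<forall>q\<in>Q. r q v \<in> U)"
proof -
  note rl = rep_onD[OF r, simplified]
  let ?P = "\<lambda>Z. subspace Z \<and> U \<subset> Z \<and> Z \<subseteq> V \<and> (\<forall>q\<in>Q. \<forall>z\<in>Z. r q z \<in> Z)"
  have "?P V" using V by auto
  then obtain Z where Z: "?P Z" and min: "\<And>Z'. ?P Z' \<Longrightarrow> dim Z \<le> dim Z'"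
    using ex_has_least_nat[of ?P V dim] by blast
  have sZ: "subspace Z" and UZ: "U \<subset> Z" and ZV: "Z \<subseteq> V"
    and Zi: "\<And>q z. q \<in> Q \<Longrightarrow> z \<in> Z \<Longrightarrow> r q z \<in> Z" using Z by auto
  obtain v where v: "v \<in> Z" "v \<notin> U" using UZ by blast
  have "r q v \<in> U" if q: "q \<in> Q" for q
  proof -
    let ?Z = "{z\<in>Z. r q z \<in> U}"
    have sZ': "subspace ?Z"
      using sZ U(1) by (auto simp: subspace_def lin_simps[OF rl(1)])
    have "r p z \<in> ?Z" if p: "p \<in> Q" and z: "z \<in> ?Z" for p z
    proof -
      have "r q (r p z) = r p (r q z) + r (br q p) z" by (simp add: rl(3))
      moreover have "r p (r q z) \<in> U" using U(2) z by blast
      moreover have "r (br q p) z \<in> U" using comm[OF q p] z ZV by blast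
      ultimately show ?thesis using subspace_add[OF U(1)] Zi[OF p] z by simp
    qed
    moreover have "U \<noteq> ?Z"
    proof -
      obtain k where "(r q ^^ k) v \<in> U" using nil[OF q] v(1) ZV by blast
      then obtain i where i: "(r q ^^ i) v \<in> U" "\<And>j. j < i \<Longrightarrow> (r q ^^ j) v \<notin> U"
        using exists_least_iff[of "\<lambda>i. (r q ^^ i) v \<in> U"] by blast
      then obtain j where j: "i = Suc j" using v(2) by (cases i) auto
      have "(r q ^^ n) v \<in> Z" for n by (induction n) (simp_all add: v Zi q)
      then have "(r q ^^ j) v \<in> ?Z" using i(1) j by simp
      then show ?thesis using i(2)[of j] j by blast
    qed
    moreover have "U \<subseteq> ?Z" using UZ U(2) by blast
    ultimately have "dim Z \<le> dim ?Z" using sZ' ZV by (intro min) blast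
    then have "?Z = Z" by (intro subspace_dim_equal[OF sZ' sZ]) auto
    then show ?thesis using v(1) by blast
  qed
  then show ?thesis using v ZV by blast
qed

text \<open>Jacobson's lemma: \<open>b\<close> also commutes with the conjugate operator \<open>y\<close> of \<open>x\<close>, so
  \<open>tr (x y) = tr (a b y) - tr (a y b) = 0\<close>.\<close>

lemma commutator_nilp:
  assumes a: "lin a" and b: "lin b" and x: "\<And>v. x v = a (b v) - b (a v)"
    and comm: "\<And>v. x (b v) = b (x v)"
  shows "nilp x"
proof -
  have lx: "lin x"
    using lin_fun_diff[OF lin_comp[OF a b] lin_comp[OF b a]] by (simp add: x[abs_def])
  obtain y where y: "lin y" "\<And>c v. gev x c v \<Longrightarrow> y v = scale (cnj c) v"
    "tr (\<lambda>v. x (y v)) = 0 \<Longrightarrow> nilp x"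
    using conjugate_operator[OF lx] by blast
  have yb: "y (b v) = b (y v)" for v
  proof (rule lin_eq_on_span[where B = "{v. \<exists>c. gev x c v}"
        and f = "\<lambda>v. y (b v)" and g = "\<lambda>v. b (y v)"])
    show "lin (\<lambda>v. y (b v))" by (rule lin_comp[OF y(1) b])
    show "lin (\<lambda>v. b (y v))" by (rule lin_comp[OF b y(1)])
    show "v \<in> span {v. \<exists>c. gev x c v}" by (simp add: span_gev[OF lx])
    fix v assume "v \<in> {v. \<exists>c. gev x c v}"
    then obtain c where c: "gev x c v" by blast
    then obtain k where k: "((\<lambda>v. x v - scale c v) ^^ k) v = 0" by (auto simp: gev_def)
    have "((\<lambda>v. x v - scale c v) ^^ n) (b w) = b (((\<lambda>v. x v - scale c v) ^^ n) w)" for n w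
      by (induction n) (simp_all add: comm lin_simps[OF b])
    then have "((\<lambda>v. x v - scale c v) ^^ k) (b v) = 0" using k by (simp add: lin_0[OF b])
    then have "gev x c (b v)" unfolding gev_def by (rule exI)
    then show "y (b v) = b (y v)" by (simp only: y(2)[OF c] y(2) lin_scale[OF b])
  qed
  have "tr (\<lambda>v. x (y v)) = tr (\<lambda>v. a (b (y v))) - tr (\<lambda>v. b (a (y v)))"
    by (simp add: x tr_diff)
  also have "tr (\<lambda>v. b (a (y v))) = tr (\<lambda>v. a (y (b v)))"
    by (rule tr_cyclic[OF b lin_comp[OF a y(1)]])
  finally show ?thesis using y(3) by (simp add: yb)
qed

text \<open>Jacobson's lemma on \<open>V / U\<close>: the hypothesis says that \<open>[a, b]\<close>
  commutes with \<open>b\<close> there. It is applied to the compressions by \<open>p\<close>, and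
  \<open>p\<close> intertwines the powers.\<close>

lemma subquotient_commutator_nilp:
  assumes r: "rep_on UNIV r" and U: "subspace U" "\<And>t u. u \<in> U \<Longrightarrow> r t u \<in> U"
    and V: "subspace V" "U \<subset> V" "\<And>t v. v \<in> V \<Longrightarrow> r t v \<in> V"
    and comm: "\<And>v. v \<in> V \<Longrightarrow> r (br (br a b) b) v \<in> U"
  shows "\<exists>k. \<forall>v\<in>V. (r (br a b) ^^ k) v \<in> U"
proof -
  have UV: "U \<subseteq> V" using V(2) by blast
  obtain p where p: "lin p" "\<And>v. p v \<in> V" "\<And>u. u \<in> U \<Longrightarrow> p u = 0"
    "\<And>v. v \<in> V \<Longrightarrow> v - p v \<in> U" "\<And>v. p (p v) = p v"
    using subquotient_projection[OF U(1) V(1) UV] by metis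
  let ?r = "\<lambda>t v. p (r t (p v))"
  have prp: "p (r t (p v)) = p (r t v)" if "v \<in> V" for t v
    by (rule subquotient_rep(1)[OF r U(2) V(3) p UNIV_I that])
  have r': "rep_on UNIV ?r"
    by (rule subquotient_rep(2)[OF r U(2) V(3) p])
  note rl' = rep_onD[OF r', simplified]
  let ?x = "br a b"
  have "?r ?x (?r b v) = ?r b (?r ?x v)" for v
  proof -
    have "?r (br ?x b) v = 0" using p(3)[OF comm[OF p(2)[of v]]] by simp
    then show ?thesis by (simp add: rl'(3) del: p(5))
  qed
  then have "nilp (?r ?x)"
    by (intro commutator_nilp[of "?r a" "?r b" "?r ?x", OF rl'(1) rl'(1) rl'(3)])
  then obtain k where k: "\<And>v. (?r ?x ^^ k) v = 0" by (auto simp: nilp_def)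
  have "(r ?x ^^ k) v \<in> U" if v: "v \<in> V" for v
  proof -
    have n: "(r ?x ^^ n) v \<in> V" for n by (induction n) (simp_all add: v V(3))
    have "p ((r ?x ^^ n) v) = (?r ?x ^^ n) (p v)" for n
    proof (induction n)
      case (Suc n)
      have "p ((r ?x ^^ Suc n) v) = ?r ?x (p ((r ?x ^^ n) v))"
        using prp[OF n[of n], of ?x] by (simp add: p(5))
      then show ?case using Suc by simp
    qed simp
    then have "p ((r ?x ^^ k) v) = 0" by (simp add: k)
    then show ?thesis using p(4)[OF n[of k]] by simp
  qed
  then show ?thesis by blast
qed

text \<open>On an irreducible subquotient \<open>V / U\<close> all of \<open>[M, B]\<close> acts as
  zero. Triviality climbs the derived series of \<open>B\<close> from its zero term by alternating
  \<open>claim1\<close> and \<open>claim2\<close>; each uses Jacobson's lemma for nilpotency and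
  irreducibility to turn one common null vector into triviality.\<close>

lemma solvable_ideal_escape:
  assumes r: "rep_on UNIV r" and B: "ideal_of B UNIV" "solvable B"
    and U: "subspace U" "\<And>t u. u \<in> U \<Longrightarrow> r t u \<in> U" "U \<noteq> UNIV"
  shows "\<exists>v. v \<notin> U \<and> (\<forall>x\<in>bracket UNIV B. r x v \<in> U)"
proof -
  note rl = rep_onD[OF r, simplified]
  let ?P = "\<lambda>V. subspace V \<and> U \<subset> V \<and> (\<forall>t. \<forall>v\<in>V. r t v \<in> V)"
  have "?P UNIV" using U(3) by auto
  then obtain V where V0: "?P V" and min: "\<And>V'. ?P V' \<Longrightarrow> dim V \<le> dim V'"
    using ex_has_least_nat[of ?P UNIV dim] by blast
  have sV: "subspace V" and UV: "U \<subset> V" and Vi: "\<And>t v. v \<in> V \<Longrightarrow> r t v \<in> V" using V0 by auto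
  have irr: "Z = V" if Z: "subspace Z" "U \<subset> Z" "Z \<subseteq> V" "\<And>t z. z \<in> Z \<Longrightarrow> r t z \<in> Z" for Z
    by (rule subspace_dim_equal[OF Z(1) sV Z(3) min]) (use Z in blast)
  define triv where "triv X \<longleftrightarrow> (\<forall>x\<in>X. \<forall>v\<in>V. r x v \<in> U)" for X
  have trivD: "r x v \<in> U" if "triv X" "x \<in> X" "v \<in> V" for X x v using that by (auto simp: triv_def)
  have triv_span: "triv (span X)" if "triv X" for X
  proof -
    have "subspace {x. \<forall>v\<in>V. r x v \<in> U}"
      using U(1) by (auto simp: subspace_def lin_simps[OF rl(2)])
    then have "span X \<subseteq> {x. \<forall>v\<in>V. r x v \<in> U}"
      using that by (intro span_minimal) (auto simp: triv_def)
    then show ?thesis by (auto simp: triv_def)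
  qed
  \<comment> \<open>The vectors of \<open>V\<close> sent into \<open>U\<close> by all of
    \<open>Q\<close> are invariant under the whole algebra, because \<open>span Q\<close> is stable
    under left multiplication; by irreducibility they fill \<open>V\<close>.\<close>
  have triv_commuting: "triv Q"
    if nil: "\<And>q. q \<in> Q \<Longrightarrow> \<exists>k. \<forall>v\<in>V. (r q ^^ k) v \<in> U"
      and comm: "\<And>p q v. p \<in> Q \<Longrightarrow> q \<in> Q \<Longrightarrow> v \<in> V \<Longrightarrow> r (br p q) v \<in> U"
      and ideal: "\<And>t q. q \<in> Q \<Longrightarrow> br t q \<in> span Q" for Q
  proof -
    let ?Z = "{v\<in>V. \<forall>q\<in>Q. r q v \<in> U}"
    obtain v where v: "v \<in> V" "v \<notin> U" "\<forall>q\<in>Q. r q v \<in> U"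
      using commuting_nilpotents[OF r U(1,2) sV UV Vi nil comm] by blast
    have sZ: "subspace ?Z"
      using sV U(1) by (auto simp: subspace_def lin_simps[OF rl(1)])
    have UZ: "U \<subset> ?Z" using v U(2) UV by blast
    have "r t z \<in> ?Z" if z: "z \<in> ?Z" for t z
    proof -
      have sub: "subspace {x. r x z \<in> U}" by (rule subspace_lin_vimage[OF rl(2) U(1)])
      have "span Q \<subseteq> {x. r x z \<in> U}" by (rule span_minimal[OF _ sub]) (use z in blast)
      then have "r (br t q) z \<in> U" if "q \<in> Q" for q using ideal[OF that] by blast
      moreover have "r t (r q z) \<in> U" if "q \<in> Q" for q using U(2) z that by blast
      moreover have "r q (r t z) = r t (r q z) - r (br t q) z" for q by (simp add: rl(3))
      ultimately have "r q (r t z) \<in> U" if "q \<in> Q" for q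
        using subspace_diff[OF U(1)] that by simp
      then show ?thesis using Vi z by blast
    qed
    then have "?Z = V" by (intro irr[OF sZ UZ]) auto
    then show ?thesis unfolding triv_def by blast
  qed
  have nilC: "\<exists>k. \<forall>v\<in>V. (r (br a b) ^^ k) v \<in> U" if "\<And>v. v \<in> V \<Longrightarrow> r (br (br a b) b) v \<in> U" for a b
    by (rule subquotient_commutator_nilp[OF r U(1,2) sV UV Vi that])
  \<comment> \<open>For \<open>b\<close> in \<open>J\<close>, \<open>[[a, b], b]\<close> lies in
    \<open>[J, J]\<close> and acts trivially, so \<open>[a, b]\<close> acts nilpotently.\<close>
  have claim1: "triv (bracket UNIV J)"
    if J: "\<And>t x. x \<in> J \<Longrightarrow> br t x \<in> J" and t: "triv (bracket J J)" for J
  proof -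
    let ?Q = "{br a b | a b. a \<in> UNIV \<and> b \<in> J}"
    have Q: "q \<in> J" if "q \<in> ?Q" for q using that J by blast
    have "triv ?Q"
    proof (rule triv_commuting)
      show "\<exists>k. \<forall>v\<in>V. (r q ^^ k) v \<in> U" if "q \<in> ?Q" for q
        using that nilC trivD[OF t br_in_bracket[OF J]] by blast
      show "r (br p q) v \<in> U" if "p \<in> ?Q" "q \<in> ?Q" "v \<in> V" for p q v
        by (rule trivD[OF t br_in_bracket[OF Q[OF that(1)] Q[OF that(2)]] that(3)])
      fix t q assume "q \<in> ?Q"
      then obtain a b where ab: "q = br a b" "b \<in> J" by blast
      have "br (br t a) b + br a (br t b) \<in> span ?Q"
        by (intro span_add span_base) (use ab(2) J in blast)+
      then show "br t q \<in> span ?Q" by (simp only: ab(1) left_leibniz[of t a b])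
    qed
    then show ?thesis unfolding bracket_def by (rule triv_span)
  qed
  \<comment> \<open>For \<open>q = [a, b]\<close> the product \<open>[q, b]\<close> acts as
    \<open>- [b, q]\<close>, and \<open>[b, q]\<close> lies in the trivial
    \<open>[M, [C, C]]\<close>; so \<open>q\<close> acts nilpotently.\<close>
  have claim2: "triv (bracket C C)"
    if C: "\<And>t x. x \<in> C \<Longrightarrow> br t x \<in> C" and t: "triv (bracket UNIV (bracket C C))" for C
  proof -
    let ?Q = "{br a b | a b. a \<in> C \<and> b \<in> C}"
    have Q: "q \<in> bracket C C" if "q \<in> ?Q" for q using that br_in_bracket by blast
    have "triv ?Q"
    proof (rule triv_commuting)
      show "\<exists>k. \<forall>v\<in>V. (r q ^^ k) v \<in> U" if "q \<in> ?Q" for q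
      proof -
        obtain a b where ab: "q = br a b" using \<open>q \<in> ?Q\<close> by blast
        have "r (br (br a b) b) v \<in> U" if v: "v \<in> V" for v
        proof -
          have "r (br b q) v \<in> U" by (rule trivD[OF t br_in_bracket[OF UNIV_I Q[OF \<open>q \<in> ?Q\<close>]] v])
          moreover have "r (br (br a b) b) v = - r (br b q) v" by (simp add: rl(3) ab)
          ultimately show ?thesis using subspace_neg[OF U(1)] by simp
        qed
        then show ?thesis unfolding ab by (rule nilC)
      qed
      show "r (br p q) v \<in> U" if "p \<in> ?Q" "q \<in> ?Q" "v \<in> V" for p q v
        by (rule trivD[OF t br_in_bracket[OF UNIV_I Q[OF that(2)]] that(3)])
      fix t q assume "q \<in> ?Q"
      then obtain a b where ab: "q = br a b" "a \<in> C" "b \<in> C" by blast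
      have "br (br t a) b + br a (br t b) \<in> span ?Q"
        by (intro span_add span_base) (use ab C in blast)+
      then show "br t q \<in> span ?Q" by (simp only: ab(1) left_leibniz[of t a b])
    qed
    then show ?thesis unfolding bracket_def by (rule triv_span)
  qed
  have D: "br t x \<in> derived B k" if "x \<in> derived B k" for t x k
    using that
  proof (induction k arbitrary: x)
    case 0
    then show ?case using ideal_ofD(3)[OF B(1)] by simp
  next
    case (Suc k)
    have "bracket (derived B k) (derived B k) \<subseteq> {x. br t x \<in> bracket (derived B k) (derived B k)}"
    proof (rule bracket_minimal)
      show "subspace {x. br t x \<in> bracket (derived B k) (derived B k)}"
        by (rule subspace_lin_vimage[OF br_lin(1) subspace_bracket])
      fix a b assume ab: "a \<in> derived B k" "b \<in> derived B k"
      have "br (br t a) b + br a (br t b) \<in> bracket (derived B k) (derived B k)"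
        by (intro subspace_add[OF subspace_bracket] br_in_bracket ab Suc.IH)
      then show "br a b \<in> {x. br t x \<in> bracket (derived B k) (derived B k)}"
        by (simp add: left_leibniz[of t a b])
    qed
    then show ?case using Suc.prems by auto
  qed
  obtain n where n: "derived B n = {0}" using B(2) by (auto simp: solvable_def)
  \<comment> \<open>\<open>claim1\<close> passes from the derived term \<open>k + 1\<close> to
    \<open>[M, D]\<close> with \<open>D\<close> the term \<open>k\<close>; for positive
    \<open>k\<close>, \<open>claim2\<close> then passes to \<open>D\<close> itself. At
    \<open>n - j = 0\<close> the truncated index repeats, and \<open>claim1\<close> alone finishes
    below.\<close>
  have "triv (derived B (Suc (n - j)))" for j
  proof (induction j)
    case 0
    have "bracket (derived B n) (derived B n) \<subseteq> {0}"
      unfolding n by (rule bracket_minimal) (auto simp: br_0_left)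
    then show ?case using subspace_0[OF U(1)] lin_0[OF rl(2)] by (auto simp: triv_def)
  next
    case (Suc j)
    show ?case
    proof (cases "n - j = 0")
      case True
      then show ?thesis using Suc by simp
    next
      case False
      then have e: "n - j = Suc (n - Suc j)" by simp
      have "triv (bracket UNIV (derived B (Suc (n - Suc j))))"
        by (rule claim1[OF D]) (use Suc e in simp_all)
      then have "triv (bracket (derived B (n - Suc j)) (derived B (n - Suc j)))"
        by (intro claim2[OF D]) simp_all
      then show ?thesis by simp
    qed
  qed
  from this[of n] have "triv (bracket B B)" by simp
  then have "triv (bracket UNIV B)"
    using claim1[of B] ideal_ofD(3)[OF B(1)] by blast
  then show ?thesis using UV unfolding triv_def by blast
qed

text \<open>The flag terms are left ideals because \<open>[M, B]\<close> is stable under left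
  multiplication; this is the invariance that \<open>solvable_ideal_escape\<close> needs to enlarge
  each proper term.\<close>

lemma solvable_ideal_flag:
  assumes r: "rep_on UNIV r" and B: "ideal_of B UNIV" "solvable B"
  shows "v \<in> flag r (bracket UNIV B) n \<Longrightarrow> r t v \<in> flag r (bracket UNIV B) n"
    and "\<exists>m. flag r (bracket UNIV B) m = UNIV"
proof -
  note rl = rep_onD[OF r, simplified]
  let ?P = "bracket UNIV B"
  note fs = subspace_flag[of r ?P, OF rl(1)]
  have P: "br t x \<in> ?P" if "x \<in> ?P" for t x
  proof -
    have "?P \<subseteq> B" using ideal_ofD[OF B(1)] by (intro bracket_minimal) auto
    then show ?thesis using that br_in_bracket by blast
  qed
  have inv: "r t v \<in> flag r ?P n" if "v \<in> flag r ?P n" for t v n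
    using that
  proof (induction n arbitrary: v)
    case (Suc n)
    have "r x (r t v) \<in> flag r ?P n" if x: "x \<in> ?P" for x
    proof -
      have "r x (r t v) = r t (r x v) - r (br t x) v" by (simp add: rl(3))
      moreover have "r t (r x v) \<in> flag r ?P n" "r (br t x) v \<in> flag r ?P n"
        using Suc x P[OF x] by simp_all
      ultimately show ?thesis using subspace_diff[OF fs] by simp
    qed
    then show ?case by simp
  qed (simp add: lin_0[OF rl(1)])
  then show "v \<in> flag r ?P n \<Longrightarrow> r t v \<in> flag r ?P n" .
  show "\<exists>m. flag r ?P m = UNIV"
    by (rule flag_UNIV[OF rl(1)]) (rule solvable_ideal_escape[OF r B fs inv])
qed

end

section \<open>Truncated exponentials of nilpotent maps\<close>

context complex_fd_space begin

text \<open>This is the exponential once \<open>D ^^ m\<close> vanishes; all computations use the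
  finite sum, and convergence enters only in \<open>is_exp_nexp\<close>.\<close>

definition nexp :: "nat \<Rightarrow> ('a \<Rightarrow> 'a) \<Rightarrow> 'a \<Rightarrow> 'a" where
  "nexp m D v = (\<Sum>k<m. scale (1 / fact k) ((D ^^ k) v))"

lemma lin_nexp: "lin D \<Longrightarrow> lin (nexp m D)"
  unfolding nexp_def[abs_def] by (intro lin_fun_sum lin_fun_scale lin_funpow)

text \<open>If \<open>j\<close> is the last exponent with \<open>D ^^ j\<close> nonzero at
  \<open>v\<close>, then \<open>D ^^ j\<close> sends \<open>nexp m D v\<close> to the same nonzero
  vector, so the kernel is zero.\<close>

lemma bij_nexp:
  assumes D: "lin D" and m: "\<And>v. (D ^^ m) v = 0"
  shows "bij (nexp m D)"
proof -
  note lE = lin_nexp[OF D, of m]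
  have zero: "v = 0" if E: "nexp m D v = 0" for v
  proof (rule ccontr)
    assume "v \<noteq> 0"
    obtain i where i: "(D ^^ i) v = 0" "\<And>j. j < i \<Longrightarrow> (D ^^ j) v \<noteq> 0"
      using exists_least_iff[of "\<lambda>i. (D ^^ i) v = 0"] m by blast
    then obtain j where j: "i = Suc j" using \<open>v \<noteq> 0\<close> by (cases i) auto
    have jm: "j < m" using i(2)[of m] m j by (metis lessI linorder_not_less order_less_le_trans)
    have "(D ^^ j) (scale (1 / fact k) ((D ^^ k) v)) = (if k = 0 then (D ^^ j) v else 0)" for k
    proof (cases "k = 0")
      case False
      then have "(D ^^ (j + k)) v = 0" using funpow_zero_mono[OF D i(1), of "j + k"] j by simp
      then show ?thesis using False by (simp add: lin_scale[OF lin_funpow[OF D]] funpow_add)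
    qed simp
    then have "(D ^^ j) (nexp m D v) = (D ^^ j) v"
      using jm by (simp add: nexp_def lin_sum[OF lin_funpow[OF D]])
    then show False using E i(2)[of j] j by (simp add: lin_0[OF lin_funpow[OF D]])
  qed
  have "inj (nexp m D)"
  proof (rule injI)
    fix u v assume "nexp m D u = nexp m D v"
    then have "nexp m D (u - v) = 0" by (simp add: lin_diff[OF lE])
    then show "u = v" using zero[of "u - v"] by simp
  qed
  then show ?thesis using linear_inj_imp_surj[OF lE] by (simp add: bij_def)
qed

end

context fd_left_leibniz_algebra begin

subsection \<open>Exponentials of nilpotent derivations\<close>

lemma is_exp_nexp:
  assumes m: "\<And>v. (D ^^ m) v = 0" and D: "lin D"
  shows "is_exp D (nexp m D)"
  unfolding is_exp_def
proof (intro allI impI)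
  fix v and f :: "'a \<Rightarrow> complex" assume f: "Vector_Spaces.linear scale (*) f"
  interpret f: Vector_Spaces.linear scale "(*)" f by (rule f)
  have "f (scale (1 / fact n) ((D ^^ n) v)) = 0" if "n \<notin> {..<m}" for n
    using funpow_zero_mono[OF D m, of n v] that by (simp add: f.zero)
  then have "(\<lambda>n. f (scale (1 / fact n) ((D ^^ n) v))) sums
      (\<Sum>n<m. f (scale (1 / fact n) ((D ^^ n) v)))"
    by (intro sums_finite) auto
  then show "(\<lambda>n. f (scale (1 / fact n) ((D ^^ n) v))) sums f (nexp m D v)"
    by (simp only: nexp_def f.sum)
qed

text \<open>Dividing \<open>D ^^ k\<close> by \<open>fact k\<close> removes the binomial
  coefficients. Applying \<open>D\<close> once more gives the \<open>k\<close>-th product the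
  weights \<open>k\<close> and \<open>Suc n - k\<close>, whose sum \<open>Suc n\<close> is
  cancelled.\<close>

lemma leibniz_rule:
  assumes D: "lin D" and der: "\<And>a b. D (br a b) = br (D a) b + br a (D b)"
  shows "scale (1 / fact n) ((D ^^ n) (br a b)) =
    (\<Sum>k\<le>n. br (scale (1 / fact k) ((D ^^ k) a)) (scale (1 / fact (n - k)) ((D ^^ (n - k)) b)))"
proof (induction n)
  case (Suc n)
  define d where "d k v = scale (1 / fact k) ((D ^^ k) v)" for k v
  have dS: "D (d k v) = scale (of_nat (Suc k)) (d (Suc k) v)" for k v
  proof -
    have "(1::complex) / fact k = of_nat (Suc k) * (1 / fact (Suc k))"
      by (simp add: divide_simps del: of_nat_Suc)
    then show ?thesis by (simp add: d_def lin_scale[OF D] del: of_nat_Suc fact_Suc)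
  qed
  have IH: "d n (br a b) = (\<Sum>k\<le>n. br (d k a) (d (n - k) b))" using Suc by (simp add: d_def)
  let ?g = "\<lambda>k. br (d k a) (d (Suc n - k) b)"
  have "scale (of_nat (Suc n)) (d (Suc n) (br a b)) = (\<Sum>k\<le>n. D (br (d k a) (d (n - k) b)))"
    by (simp only: dS[symmetric] IH lin_sum[OF D])
  also have "\<dots> = (\<Sum>k\<le>n. scale (of_nat (Suc k)) (?g (Suc k))) + (\<Sum>k\<le>n. scale (of_nat (Suc n - k)) (?g k))"
    unfolding sum.distrib[symmetric]
    by (intro sum.cong) (simp_all add: der dS br_simps Suc_diff_le del: of_nat_Suc)
  also have "(\<Sum>k\<le>n. scale (of_nat (Suc k)) (?g (Suc k))) = (\<Sum>k\<le>Suc n. scale (of_nat k) (?g k))"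
    by (subst sum.atMost_Suc_shift) simp
  also have "(\<Sum>k\<le>n. scale (of_nat (Suc n - k)) (?g k)) = (\<Sum>k\<le>Suc n. scale (of_nat (Suc n - k)) (?g k))"
    by simp
  also have "(\<Sum>k\<le>Suc n. scale (of_nat k) (?g k)) + \<dots> = (\<Sum>k\<le>Suc n. scale (of_nat (Suc n)) (?g k))"
    unfolding sum.distrib[symmetric]
    by (intro sum.cong) (simp_all flip: scale_left_distrib of_nat_add del: of_nat_Suc)
  also have "\<dots> = scale (of_nat (Suc n)) (\<Sum>k\<le>Suc n. ?g k)"
    by (simp only: scale_sum_right)
  finally have "d (Suc n) (br a b) = (\<Sum>k\<le>Suc n. ?g k)"
    by (simp only: scale_cancel_left of_nat_eq_0_iff) simp
  then show ?case by (simp only: d_def)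
qed simp

lemma nexp_br:
  assumes D: "lin D" and der: "\<And>a b. D (br a b) = br (D a) b + br a (D b)"
    and m: "\<And>v. (D ^^ m) v = 0"
  shows "nexp m D (br a b) = br (nexp m D a) (nexp m D b)"
proof -
  define d where "d k v = scale (1 / fact k) ((D ^^ k) v)" for k v
  have d0: "d k v = 0" if "m \<le> k" for k v
    using funpow_zero_mono[OF D m that] by (simp add: d_def)
  let ?g = "\<lambda>i j. br (d i a) (d j b)"
  let ?A = "{(i, j). i + j < 2 * m}"
  have fin: "finite ?A" by (rule finite_subset[of _ "{..<2 * m} \<times> {..<2 * m}"]) auto
  \<comment> \<open>Up to \<open>2 * m\<close> the triangle of index pairs contains the full
    \<open>m\<close> by \<open>m\<close> square; all further terms vanish.\<close>
  have "nexp m D (br a b) = (\<Sum>n<2 * m. d n (br a b))"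
    unfolding nexp_def d_def[symmetric] by (rule sum.mono_neutral_left) (auto simp: d0)
  also have "\<dots> = (\<Sum>n<2 * m. \<Sum>k\<le>n. ?g k (n - k))"
    using leibniz_rule[OF D der, of _ a b] by (simp add: d_def)
  also have "\<dots> = (\<Sum>(i, j)\<in>?A. ?g i j)" by (rule sum.triangle_reindex[symmetric])
  also have "\<dots> = (\<Sum>(i, j)\<in>{..<m} \<times> {..<m}. ?g i j)"
  proof (rule sum.mono_neutral_right[OF fin])
    show "{..<m} \<times> {..<m} \<subseteq> ?A" by auto
    show "\<forall>x\<in>?A - {..<m} \<times> {..<m}. (case x of (i, j) \<Rightarrow> ?g i j) = 0"
    proof
      fix x assume "x \<in> ?A - {..<m} \<times> {..<m}"
      then obtain i j where x: "x = (i, j)" "m \<le> i \<or> m \<le> j" by force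
      then show "(case x of (i, j) \<Rightarrow> ?g i j) = 0" by (auto simp: d0 br_0_left br_0_right)
    qed
  qed
  also have "\<dots> = (\<Sum>i<m. \<Sum>j<m. ?g i j)" by (rule sum.cartesian_product[symmetric])
  also have "\<dots> = br (nexp m D a) (nexp m D b)"
    by (subst sum.swap) (simp add: nexp_def d_def[symmetric] br_simps)
  finally show ?thesis .
qed

lemma automorphism_nexp:
  assumes m: "\<And>v. (br x ^^ m) v = 0"
  shows "automorphism (nexp m (br x))"
  unfolding automorphism_def
  using lin_nexp[OF br_lin(1)] bij_nexp[OF br_lin(1) m] nexp_br[OF br_lin(1) left_leibniz m] by blast

subsection \<open>The Leibniz kernel and the radical\<close>

text \<open>The Leibniz identity with its first two arguments equal says that \<open>br a a\<close>
  multiplies to zero from the left.\<close>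

lemma br_kernel_left: "n \<in> leibniz_kernel \<Longrightarrow> br n v = 0"
proof -
  assume "n \<in> leibniz_kernel"
  moreover have "leibniz_kernel \<subseteq> {n. br n v = 0}"
    unfolding leibniz_kernel_def
  proof (rule span_minimal)
    show "subspace {n. br n v = 0}" by (auto simp: subspace_def br_simps)
    show "{br a a | a. True} \<subseteq> {n. br n v = 0}"
      using left_leibniz[of a a v for a] by auto
  qed
  ultimately show ?thesis by blast
qed

lemma subspace_kernel: "subspace leibniz_kernel"
  unfolding leibniz_kernel_def by (rule subspace_span)

lemma br_antisym_kernel: "br a b + br b a \<in> leibniz_kernel"
proof -
  have sq: "br c c \<in> leibniz_kernel" for c
    unfolding leibniz_kernel_def by (rule span_base) blast
  have "br a b + br b a = br (a + b) (a + b) - br a a - br b b"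
    by (simp add: br_simps)
  then show ?thesis using subspace_diff[OF subspace_kernel] sq by simp
qed

lemma br_kernel_right: "n \<in> leibniz_kernel \<Longrightarrow> br v n \<in> leibniz_kernel"
proof -
  assume n: "n \<in> leibniz_kernel"
  have "br v n = br v n + br n v" using br_kernel_left[OF n] by simp
  then show ?thesis using br_antisym_kernel by metis
qed

lemma radical_ideal: "ideal_of (solvable_radical UNIV) UNIV" "solvable (solvable_radical UNIV)"
  and radical_maximal: "ideal_of J UNIV \<Longrightarrow> solvable J \<Longrightarrow> J \<subseteq> solvable_radical UNIV"
proof -
  let ?B = "solvable_radical UNIV"
  have L: "subalgebra UNIV" by (simp add: subalgebra_def)
  have B: "maximal_solvable_ideal ?B UNIV"
    unfolding solvable_radical_def by (rule theI'[OF maximal_solvable_ideal_unique_exists[OF L]])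
  then show B': "ideal_of ?B UNIV" "solvable ?B" by (auto simp: maximal_solvable_ideal_def)
  assume J: "ideal_of J UNIV" "solvable J"
  let ?K = "{i + j | i j. i \<in> ?B \<and> j \<in> J}"
  have "?B \<subseteq> ?K" "J \<subseteq> ?K"
    using subspace_0[OF ideal_ofD(1)[OF B'(1)]] subspace_0[OF ideal_ofD(1)[OF J(1)]] by force+
  then have "?K = ?B"
    using B solvable_ideal_sum[OF L B' J] unfolding maximal_solvable_ideal_def by blast
  then show "J \<subseteq> ?B" using \<open>J \<subseteq> ?K\<close> by blast
qed

lemma kernel_subset_radical: "leibniz_kernel \<subseteq> solvable_radical UNIV"
proof (rule radical_maximal)
  show "ideal_of leibniz_kernel UNIV"
    using subspace_kernel br_kernel_left br_kernel_right subspace_0[OF subspace_kernel]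
    by (auto simp: ideal_of_def)
  have "bracket leibniz_kernel leibniz_kernel \<subseteq> {0}"
    by (rule bracket_minimal) (simp_all add: br_kernel_left)
  then have "derived leibniz_kernel 1 = {0}" using subspace_0[OF subspace_bracket] by auto
  then show "solvable leibniz_kernel" unfolding solvable_def by blast
qed

subsection \<open>Conjugation into a Levi subalgebra\<close>

abbreviation "rad \<equiv> solvable_radical UNIV"

abbreviation "nilrad \<equiv> bracket UNIV rad"

text \<open>The intersection with \<open>nilrad\<close> keeps the corrections in
  \<open>[M, B]\<close>; adding the kernel allows factors to be swapped inside a layer.
  \<open>layer 0\<close> is the kernel itself.\<close>

definition layer :: "nat \<Rightarrow> 'a set" where
  "layer i = {u + n | u n. u \<in> flag br nilrad i \<inter> nilrad \<and> n \<in> leibniz_kernel}"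

lemma nilrad_left: "x \<in> nilrad \<Longrightarrow> br t x \<in> nilrad"
  and nilrad_subset: "nilrad \<subseteq> rad"
proof -
  show sub: "nilrad \<subseteq> rad" using ideal_ofD[OF radical_ideal(1)] by (intro bracket_minimal) auto
  show "x \<in> nilrad \<Longrightarrow> br t x \<in> nilrad" using sub br_in_bracket by blast
qed

lemma subspace_flag_nilrad: "subspace (flag br nilrad i)"
  by (rule subspace_flag[OF br_lin(1)])

lemma subspace_layer: "subspace (layer i)"
  unfolding layer_def
  by (intro subspace_sums subspace_inter subspace_flag_nilrad subspace_bracket subspace_kernel)

lemma layerI: "u \<in> flag br nilrad i \<Longrightarrow> u \<in> nilrad \<Longrightarrow> u \<in> layer i"
  and kernel_layer: "n \<in> leibniz_kernel \<Longrightarrow> n \<in> layer i"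
  unfolding layer_def
  using subspace_0[OF subspace_kernel] subspace_0[OF subspace_flag_nilrad] subspace_0[OF subspace_bracket]
  by force+

lemma layer_Suc: "layer i \<subseteq> layer (Suc i)"
  unfolding layer_def using flag_Suc[of br nilrad i, OF br_lin(1)] by blast

lemma layer_radical: "layer i \<subseteq> rad"
  unfolding layer_def
  using nilrad_subset kernel_subset_radical subspace_add[OF ideal_ofD(1)[OF radical_ideal(1)]] by blast

lemma layer_br_left: "f \<in> layer i \<Longrightarrow> br t f \<in> layer i"
proof -
  assume "f \<in> layer i"
  then obtain u n where u: "u \<in> flag br nilrad i" "u \<in> nilrad" "n \<in> leibniz_kernel" "f = u + n"
    by (auto simp: layer_def)
  have "br t u \<in> layer i"
    by (intro layerI solvable_ideal_flag(1)[OF rep_on_br radical_ideal] nilrad_left u)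
  then show ?thesis
    using subspace_add[OF subspace_layer _ kernel_layer[OF br_kernel_right[OF u(3)]]]
    by (simp add: u(4) br_add_right)
qed

lemma layer_br_right:
  assumes "br v f \<in> layer i"
  shows "br f v \<in> layer i"
proof -
  have "br f v = (br f v + br v f) - br v f" by simp
  then show ?thesis
    using subspace_diff[OF subspace_layer kernel_layer[OF br_antisym_kernel] assms] by metis
qed

text \<open>Only the \<open>nilrad\<close> part of \<open>a\<close> acts from the left. It lowers
  the flag part of \<open>f\<close> and keeps the kernel part in the kernel.\<close>

lemma layer_lower:
  assumes "a \<in> layer j" "f \<in> layer (Suc i)"
  shows "br a f \<in> layer i"
proof -
  obtain p n where a: "p \<in> nilrad" "n \<in> leibniz_kernel" "a = p + n"
    using assms(1) by (auto simp: layer_def)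
  obtain u n' where u: "u \<in> flag br nilrad (Suc i)" "u \<in> nilrad" "n' \<in> leibniz_kernel" "f = u + n'"
    using assms(2) by (auto simp: layer_def)
  have "br p u \<in> layer i"
    using u(1) a(1) by (intro layerI nilrad_left u) simp
  moreover have "br a f = br p u + br p n'"
    by (simp add: a(3) u(4) br_simps br_kernel_left[OF a(2)])
  ultimately show ?thesis
    using subspace_add[OF subspace_layer _ kernel_layer[OF br_kernel_right[OF u(3)]]] by simp
qed

text \<open>Used to replace \<open>nexp\<close> of \<open>t\<close> by \<open>t\<close> in products
  with an element of \<open>layer (Suc i)\<close>: by \<open>layer_lower\<close> the error lies in
  \<open>layer i\<close>.\<close>

lemma nexp_layer:
  assumes "x \<in> nilrad" "flag br nilrad m = UNIV"
  shows "nexp (Suc m) (br x) t - t \<in> layer m"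
proof -
  have x: "x \<in> layer m" using assms by (intro layerI) auto
  have "(br x ^^ Suc k) t \<in> layer m" for k
    by (induction k) (simp_all add: layer_br_left layer_br_right x)
  then have "(\<Sum>k<m. scale (1 / fact (Suc k)) ((br x ^^ Suc k) t)) \<in> layer m"
    by (intro subspace_sum[OF subspace_layer] subspace_scale[OF subspace_layer])
  moreover have "nexp (Suc m) (br x) t - t = (\<Sum>k<m. scale (1 / fact (Suc k)) ((br x ^^ Suc k) t))"
    unfolding nexp_def by (subst sum.lessThan_Suc_shift) simp
  ultimately show ?thesis by simp
qed

text \<open>Let \<open>?d k\<close> be the difference of the \<open>k\<close>-th powers at
  \<open>t\<close>. Then \<open>?d 1 = [w, t]\<close>, and \<open>?d (k + 1)\<close> is
  \<open>(x + w)\<close> applied to \<open>?d k\<close> plus \<open>w\<close> applied to a vector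
  that for positive \<open>k\<close> is in \<open>layer m\<close>; both are one layer lower.
  \<open>Suc (Suc m)\<close> terms leave exactly \<open>m\<close> after degrees 0 and 1.\<close>

lemma nexp_add_layer:
  assumes x: "x \<in> nilrad" and m: "flag br nilrad m = UNIV"
    and w: "w \<in> flag br nilrad (Suc i)" "w \<in> nilrad"
  shows "nexp (Suc (Suc m)) (br (x + w)) t - nexp (Suc (Suc m)) (br x) t - br w t \<in> layer i"
proof -
  have wL: "w \<in> layer (Suc i)" using w by (rule layerI)
  have xL: "x \<in> layer m" and xwL: "x + w \<in> layer m"
    using x w m subspace_add[OF subspace_bracket x] by (auto intro: layerI)
  let ?d = "\<lambda>k. (br (x + w) ^^ k) t - (br x ^^ k) t"
  have xk: "(br x ^^ Suc k) t \<in> layer m" for k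
    by (induction k) (simp_all add: layer_br_left layer_br_right xL)
  have step: "?d (Suc (Suc k)) \<in> layer i" if "?d (Suc k) \<in> layer (Suc i)" for k
  proof -
    have "?d (Suc (Suc k)) = br (x + w) (?d (Suc k)) + br w ((br x ^^ Suc k) t)"
      by (simp add: br_simps)
    moreover have "br w ((br x ^^ Suc k) t) \<in> layer i"
      by (rule layer_br_right[OF layer_lower[OF xk wL]])
    ultimately show ?thesis
      using layer_lower[OF xwL that] subspace_add[OF subspace_layer] by simp
  qed
  have d1: "?d (Suc 0) = br w t" by (simp add: br_simps)
  have "?d (Suc k) \<in> layer (Suc i)" for k
  proof (induction k)
    case 0
    show ?case unfolding d1 by (rule layer_br_right[OF layer_br_left[OF wL]])
  next
    case (Suc k)
    then show ?case using step layer_Suc by blast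
  qed
  then have "?d (Suc (Suc k)) \<in> layer i" for k by (rule step)
  then have "(\<Sum>k<m. scale (1 / fact (Suc (Suc k))) (?d (Suc (Suc k)))) \<in> layer i"
    by (intro subspace_sum[OF subspace_layer] subspace_scale[OF subspace_layer])
  moreover have "nexp (Suc (Suc m)) (br (x + w)) t - nexp (Suc (Suc m)) (br x) t
      = (\<Sum>k<Suc (Suc m). scale (1 / fact k) (?d k))"
    by (simp only: nexp_def scale_right_diff_distrib sum_subtractf)
  moreover have "\<dots> = br w t + (\<Sum>k<m. scale (1 / fact (Suc (Suc k))) (?d (Suc (Suc k))))"
    unfolding sum.lessThan_Suc_shift d1 by simp
  ultimately show ?thesis by simp
qed

lemma levi_projection:
  assumes S: "levi_subalgebra S"
  obtains \<pi> where "lin \<pi>" "\<And>v. \<pi> v \<in> rad" "\<And>v. v - \<pi> v \<in> S"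
    "\<And>b s. b \<in> rad \<Longrightarrow> s \<in> S \<Longrightarrow> \<pi> (b + s) = b"
proof -
  note sB = ideal_ofD(1)[OF radical_ideal(1)]
  have sS: "subspace S"
    using S by (simp add: levi_subalgebra_def subalgebraD(1) semisimple_subalgebra)
  have "\<forall>v. \<exists>b. b \<in> rad \<and> v - b \<in> S"
  proof
    fix v
    obtain b s where "v = b + s" "b \<in> rad" "s \<in> S"
      using S unfolding levi_subalgebra_def by blast
    then show "\<exists>b. b \<in> rad \<and> v - b \<in> S" by (intro exI[of _ b]) simp
  qed
  then obtain \<pi> where "\<forall>v. \<pi> v \<in> rad \<and> v - \<pi> v \<in> S" by (rule choice[THEN exE])
  then have \<pi>: "\<And>v. \<pi> v \<in> rad" "\<And>v. v - \<pi> v \<in> S" by auto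
  have uniq: "\<pi> (b + s) = b" if "b \<in> rad" "s \<in> S" for b s
  proof -
    have "b - \<pi> (b + s) \<in> rad" using subspace_diff[OF sB that(1) \<pi>(1)] .
    moreover have "(b + s - \<pi> (b + s)) - s \<in> S" using subspace_diff[OF sS \<pi>(2) that(2)] .
    then have "b - \<pi> (b + s) \<in> S" by simp
    ultimately have "b - \<pi> (b + s) = 0" using S unfolding levi_subalgebra_def by blast
    then show ?thesis by simp
  qed
  have "lin \<pi>"
  proof (rule linI)
    fix u v
    have "\<pi> ((\<pi> u + \<pi> v) + ((u - \<pi> u) + (v - \<pi> v))) = \<pi> u + \<pi> v"
      by (intro uniq subspace_add[OF sB] subspace_add[OF sS] \<pi>)
    then show "\<pi> (u + v) = \<pi> u + \<pi> v" by (simp add: algebra_simps)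
  next
    fix c v
    have "\<pi> (scale c (\<pi> v) + scale c (v - \<pi> v)) = scale c (\<pi> v)"
      by (intro uniq subspace_scale[OF sB] subspace_scale[OF sS] \<pi>)
    then show "\<pi> (scale c v) = scale c (\<pi> v)" by (simp add: scale_right_diff_distrib)
  qed
  then show thesis by (rule that[OF _ \<pi> uniq])
qed

lemma conjugation_step:
  assumes S: "levi_subalgebra S" and T: "semisimple_lie_subalgebra T"
    and m: "flag br nilrad m = UNIV" and x: "x \<in> nilrad"
    and E: "automorphism (nexp (Suc (Suc m)) (br x))"
    and ET: "\<And>t. t \<in> T \<Longrightarrow> \<exists>s\<in>S. nexp (Suc (Suc m)) (br x) t - s \<in> layer (Suc i)"
  shows "\<exists>y\<in>nilrad. \<forall>t\<in>T. \<exists>s\<in>S. nexp (Suc (Suc m)) (br y) t - s \<in> layer i"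
proof -
  let ?E = "nexp (Suc (Suc m)) (br x)"
  have lE: "lin ?E" and Ebr: "?E (br a b) = br (?E a) (?E b)" for a b
    using E by (simp_all add: automorphism_def)
  have cS: "br a b \<in> S" if "a \<in> S" "b \<in> S" for a b
    using S subalgebraD(2)[OF _ that] by (simp add: levi_subalgebra_def semisimple_subalgebra)
  obtain \<pi> where \<pi>: "lin \<pi>" "\<And>v. \<pi> v \<in> rad" "\<And>v. v - \<pi> v \<in> S"
    "\<And>b s. b \<in> rad \<Longrightarrow> s \<in> S \<Longrightarrow> \<pi> (b + s) = b"
    using levi_projection[OF S] by blast
  define f where "f t = \<pi> (?E t)" for t
  have lf: "lin f" unfolding f_def by (rule lin_comp[OF \<pi>(1) lE])
  have fS: "?E t - f t \<in> S" for t unfolding f_def by (rule \<pi>(3))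
  have fL: "f t \<in> layer (Suc i)" if t: "t \<in> T" for t
  proof -
    obtain s where s: "s \<in> S" "?E t - s \<in> layer (Suc i)" using ET[OF t] by blast
    then have "\<pi> ((?E t - s) + s) = ?E t - s" using layer_radical by (intro \<pi>(4)) blast+
    then show ?thesis using s(2) by (simp add: f_def)
  qed
  have cocycle: "f (br a b) - (br (?E a) (f b) - br (?E b) (f a)) \<in> layer i"
    if ab: "a \<in> T" "b \<in> T" for a b
  proof -
    let ?sa = "?E a - f a" and ?sb = "?E b - f b"
    \<comment> \<open>The bracket of the two \<open>S\<close>-parts stays in \<open>S\<close>, so
      \<open>\<pi>\<close> returns the remaining products. Reordering \<open>[f a, sb]\<close> costs
      an element of the kernel, and the error \<open>[f b, f a]\<close> is in
      \<open>layer i\<close>.\<close>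
    have e: "?E (br a b) - br ?sa ?sb = br (f a) ?sb + br (?E a) (f b)"
      unfolding Ebr by (simp add: br_simps algebra_simps)
    have "br (f a) ?sb + br (?E a) (f b) \<in> layer (Suc i)"
      by (intro subspace_add[OF subspace_layer] layer_br_right[of ?sb] layer_br_left fL ab)
    then have "\<pi> ((br (f a) ?sb + br (?E a) (f b)) + br ?sa ?sb) = br (f a) ?sb + br (?E a) (f b)"
      using layer_radical cS[OF fS fS] by (intro \<pi>(4)) blast+
    then have fab: "f (br a b) = br (f a) ?sb + br (?E a) (f b)"
      unfolding f_def[of "br a b"] e[symmetric] by simp
    have "f (br a b) - (br (?E a) (f b) - br (?E b) (f a))
        = (br (f a) ?sb + br ?sb (f a)) + br (f b) (f a)"
      unfolding fab by (simp add: br_simps algebra_simps)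
    moreover have "br (f b) (f a) \<in> layer i" by (rule layer_lower[OF fL[OF ab(2)] fL[OF ab(1)]])
    ultimately show ?thesis
      using subspace_add[OF subspace_layer kernel_layer[OF br_antisym_kernel]] by simp
  qed
  have rE: "rep_on T (\<lambda>t. br (?E t))"
    unfolding rep_on_def
  proof (intro conjI allI ballI)
    show "lin (\<lambda>t. br (?E t) v)" for v by (rule lin_comp[OF br_lin(2) lE])
    show "br (?E (br a b)) v = br (?E a) (br (?E b) v) - br (?E b) (br (?E a) v)" for a b v
      unfolding Ebr left_leibniz[of "?E a" "?E b" v] by simp
  qed (rule br_lin)
  \<comment> \<open>\<open>T\<close> acts through the automorphism, \<open>t\<close> by left
    multiplication with \<open>?E t\<close>; for this twisted action \<open>f\<close> is a cocycle
    exactly modulo \<open>layer i\<close>.\<close>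
  obtain w where w: "w \<in> layer (Suc i)" "\<And>t. t \<in> T \<Longrightarrow> f t - br (?E t) w \<in> layer i"
    using whitehead[OF T rE subspace_layer subspace_layer layer_Suc layer_br_left layer_br_left lf fL cocycle]
    by blast
  \<comment> \<open>Only \<open>u\<close> enters the new exponent, which must stay in
    \<open>nilrad\<close>; the part \<open>n\<close> contributes \<open>[?E t, n]\<close>, an
    element of the kernel.\<close>
  obtain u n where u: "u \<in> flag br nilrad (Suc i)" "u \<in> nilrad" "n \<in> leibniz_kernel" "w = u + n"
    using w(1) by (auto simp: layer_def)
  let ?F = "nexp (Suc (Suc m)) (br (x + u))"
  have m': "flag br nilrad (Suc m) = UNIV" using m by simp
  have "?F t - (?E t - f t) \<in> layer i" if t: "t \<in> T" for t
  proof -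
    have 1: "?F t - ?E t - br u t \<in> layer i" by (rule nexp_add_layer[OF x m u(1,2)])
    have 2: "br u t + br t u \<in> layer i" by (rule kernel_layer[OF br_antisym_kernel])
    have 3: "br (?E t - t) u \<in> layer i"
      by (rule layer_lower[OF nexp_layer[OF x m'] layerI[OF u(1,2)]])
    have 4: "br (?E t) n \<in> layer i" by (rule kernel_layer[OF br_kernel_right[OF u(3)]])
    \<comment> \<open>The \<open>S\<close>-part \<open>?E t - f t\<close> is kept. The groups on the
      right are the first-order error, the swap of \<open>u\<close> and \<open>t\<close>, the
      Whitehead error, and the cost of replacing \<open>[?E t, w]\<close> by
      \<open>[t, u]\<close>.\<close>
    have "?F t - (?E t - f t) = (?F t - ?E t - br u t) + (br u t + br t u)
        + (f t - br (?E t) w) + (br (?E t - t) u + br (?E t) n)"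
      by (simp add: u(4) br_simps algebra_simps)
    also have "\<dots> \<in> layer i"
      by (intro subspace_add[OF subspace_layer] 1 2 3 4 w(2) t)
    finally show ?thesis .
  qed
  then show ?thesis
    using fS subspace_add[OF subspace_bracket x u(2)] by (intro bexI[of _ "x + u"]) blast+
qed

lemma levi_conjugation:
  assumes S: "levi_subalgebra S" and SN: "bracket S leibniz_kernel = {0}"
    and T: "semisimple_lie_subalgebra T"
  shows "\<exists>x\<in>nilrad. \<exists>\<alpha>. is_exp (ad x) \<alpha> \<and> automorphism \<alpha> \<and> \<alpha> ` T \<subseteq> S"
proof -
  have sS: "subspace S" and cS: "\<And>a b. a \<in> S \<Longrightarrow> b \<in> S \<Longrightarrow> br a b \<in> S"
    using S subalgebraD[OF semisimple_subalgebra] by (simp_all add: levi_subalgebra_def)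
  obtain m where m: "flag br nilrad m = UNIV"
    using solvable_ideal_flag(2)[OF rep_on_br radical_ideal] by blast
  let ?E = "\<lambda>x. nexp (Suc (Suc m)) (br x)"
  have nil: "(br x ^^ Suc (Suc m)) v = 0" if x: "x \<in> nilrad" for x v
  proof -
    have "(br x ^^ k) v \<in> flag br nilrad (m - k)" for k
    proof (induction k)
      case (Suc k)
      then show ?case using flag_lower[OF br_lin(1) x Suc] by simp
    qed (simp add: m)
    from this[of "Suc (Suc m)"] show ?thesis by simp
  qed
  have aut: "automorphism (?E x)" if "x \<in> nilrad" for x
    by (rule automorphism_nexp[OF nil[OF that]])
  have start: "\<exists>s\<in>S. t - s \<in> layer m" if t: "t \<in> T" for t
  proof -
    \<comment> \<open>As \<open>T\<close> is perfect, products suffice. Writing both factors in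
      \<open>B + S\<close>, a product is one in \<open>S\<close> plus products with a factor in
      \<open>B\<close>, which lie in \<open>layer m\<close>, after a swap if that factor is on the
      left.\<close>
    let ?W = "{t. \<exists>s\<in>S. t - s \<in> layer m}"
    have "?W = {u + s | u s. u \<in> layer m \<and> s \<in> S}"
    proof (intro set_eqI iffI)
      fix t assume "t \<in> ?W"
      then obtain s where "s \<in> S" "t - s \<in> layer m" by blast
      then show "t \<in> {u + s | u s. u \<in> layer m \<and> s \<in> S}"
        by (intro CollectI exI[of _ "t - s"] exI[of _ s]) simp
    next
      fix t assume "t \<in> {u + s | u s. u \<in> layer m \<and> s \<in> S}"
      then obtain u s where "t = u + s" "u \<in> layer m" "s \<in> S" by blast
      then show "t \<in> ?W" by (intro CollectI bexI[of _ s]) simp_all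
    qed
    then have "subspace ?W" using subspace_sums[OF subspace_layer sS] by simp
    moreover have "br a b \<in> ?W" for a b
    proof -
      obtain u s where a: "a = u + s" "u \<in> rad" "s \<in> S"
        using S unfolding levi_subalgebra_def by blast
      obtain u' s' where b: "b = u' + s'" "u' \<in> rad" "s' \<in> S"
        using S unfolding levi_subalgebra_def by blast
      have radL: "br v c \<in> layer m" if "c \<in> rad" for v c
        by (rule layerI) (simp_all add: m br_in_bracket that)
      have "br a b - br s s' = br s u' + br u b"
        by (simp add: a(1) b(1) br_simps algebra_simps)
      moreover have "br s u' + br u b \<in> layer m"
        by (intro subspace_add[OF subspace_layer] layer_br_right[of b u] radL a b)
      ultimately have "br a b - br s s' \<in> layer m" by (simp only:)
      then show ?thesis using cS[OF a(3) b(3)] by blast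
    qed
    ultimately have "bracket T T \<subseteq> ?W" by (intro bracket_minimal)
    then show ?thesis using semisimple_perfect[OF T] t by blast
  qed
  have "\<exists>x\<in>nilrad. \<forall>t\<in>T. \<exists>s\<in>S. ?E x t - s \<in> layer (m - j)" for j
  proof (induction j)
    case 0
    have "?E 0 t = t" for t
    proof -
      have "(br 0 ^^ Suc k) t = 0" for k by (simp add: br_0_left)
      then show ?thesis unfolding nexp_def by (subst sum.lessThan_Suc_shift) (simp del: funpow.simps)
    qed
    then show ?case using start subspace_0[OF subspace_bracket] by (intro bexI[of _ 0]) auto
  next
    case (Suc j)
    then obtain x where x: "x \<in> nilrad" "\<And>t. t \<in> T \<Longrightarrow> \<exists>s\<in>S. ?E x t - s \<in> layer (m - j)" by blast
    show ?case
    proof (cases "m - j = 0")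
      case True
      then show ?thesis using x by (intro bexI[of _ x]) auto
    next
      case False
      then have "m - j = Suc (m - Suc j)" by simp
      then show ?thesis
        using conjugation_step[OF S T m x(1) aut[OF x(1)], of "m - Suc j"] x(2) by simp
    qed
  qed
  from this[of m] obtain x where x: "x \<in> nilrad" "\<And>t. t \<in> T \<Longrightarrow> \<exists>s\<in>S. ?E x t - s \<in> layer 0" by auto
  have lE: "lin (?E x)" and Ebr: "?E x (br a b) = br (?E x a) (?E x b)" for a b
    using aut[OF x(1)] by (simp_all add: automorphism_def)
  \<comment> \<open>\<open>T\<close> is now sent into \<open>S + N\<close>, where
    \<open>[s + n, s' + n'] = [s, s']\<close>; perfectness of \<open>T\<close> removes the
    \<open>N\<close>-parts without changing \<open>x\<close>.\<close>
  have "bracket T T \<subseteq> {t. ?E x t \<in> S}"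
  proof (rule bracket_minimal)
    show "subspace {t. ?E x t \<in> S}" by (rule subspace_lin_vimage[OF lE sS])
    fix a b assume ab: "a \<in> T" "b \<in> T"
    obtain s where s: "s \<in> S" "?E x a - s \<in> layer 0" using x(2)[OF ab(1)] by blast
    obtain s' where s': "s' \<in> S" "?E x b - s' \<in> layer 0" using x(2)[OF ab(2)] by blast
    let ?n = "?E x a - s" and ?n' = "?E x b - s'"
    have n: "?n \<in> leibniz_kernel" "?n' \<in> leibniz_kernel" using s s' by (auto simp: layer_def)
    have "br s ?n' = 0" using br_in_bracket[OF s(1) n(2)] SN by simp
    moreover have "br ?n (?E x b) = 0" by (rule br_kernel_left[OF n(1)])
    ultimately have "?E x (br a b) = br s s'" by (simp add: Ebr br_simps)
    then show "br a b \<in> {t. ?E x t \<in> S}" using cS[OF s(1) s'(1)] by simp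
  qed
  then have "?E x ` T \<subseteq> S" using semisimple_perfect[OF T] by blast
  moreover have "is_exp (ad x) (?E x)"
    using is_exp_nexp[OF nil[OF x(1)] br_lin(1)] by (simp add: ad_def[abs_def])
  ultimately show ?thesis using x(1) aut[OF x(1)] by blast
qed

end

theorem theorem1:
  fixes scale :: "complex \<Rightarrow> 'a::ab_group_add \<Rightarrow> 'a"
    and br :: "'a \<Rightarrow> 'a \<Rightarrow> 'a"
    and Basis S T :: "'a set"
  assumes "fd_left_leibniz_algebra scale br Basis"
    and "left_leibniz_algebra.levi_subalgebra scale br S"
    and "left_leibniz_algebra.bracket scale br S
           (left_leibniz_algebra.leibniz_kernel scale br) = {0}"
    and "left_leibniz_algebra.semisimple_lie_subalgebra scale br T"
  shows "\<exists>x \<in> left_leibniz_algebra.bracket scale br UNIV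
               (left_leibniz_algebra.solvable_radical scale br UNIV).
         \<exists>\<alpha>. left_leibniz_algebra.is_exp scale (left_leibniz_algebra.ad br x) \<alpha> \<and>
             left_leibniz_algebra.automorphism scale br \<alpha> \<and> \<alpha> ` T \<subseteq> S"
  by (rule fd_left_leibniz_algebra.levi_conjugation[OF assms])

end
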